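(* Let $\mathbb{K}$ be an algebraically closed field of characteristic $0$. Let $X_\sigma$ be a singular normal affine toric surface over $\mathbb{K}$ with associated continued fraction $[1,a_2,\dots,a_r]$ (so $r\ge 2$ and $a_i\ge 2$ for $2\le i\le r$). Then the Nash blowup of $X_\sigma$ is smooth if and only if $[1,a_2,\dots,a_r]$ is one of the following: (1) $[1,2]$ if $r=2$; (2) $[1,2,2]$ if $r=3$; (3) $[1,2,2,2]$ or $[1,2,3,2]$ if $r=4$; (4) $[1,2,a_3,\dots,a_{r-1},2]$ if $r\ge 5$, where $(a_i,a_{i+1})\in\{(2,2),(2,3),(3,2)\}$ for all $3\le i\le r-2$.
   Context: Normal toric surface and its continued fraction. Let $\check\sigma\subset\mathbb{R}^2$ be a strongly convex rational polyhedral cone of dimension two. The normal toric surface $X_\sigma$ is the affine variety with coordinate ring the semigroup algebra $\mathbb{K}[\check\sigma\cap\mathbb{Z}^2]$. Concretely, if $\gamma_1,\dots,\gamma_n$ generate the semigroup $\check\sigma\cap\mathbb{Z}^2$, then $X_\sigma\subset\mathbb{K}^n$ is the zero set of the kernel of the $\mathbb{K}$-algebra homomorphism $\mathbb{K}[x_1,\dots,x_n]\to\mathbb{K}[t_1^{\pm1},t_2^{\pm1}]$, $x_i\mapsto t^{\gamma_i}$. After a unimodular change of coordinates of $\mathbb{Z}^2$ one may take $\check\sigma$ in normal form $\check\sigma=\mathbb{R}_{\ge0}\{(1,0),(P,Q)\}$ with $P,Q$ coprime and $0\le P<Q$; the surface is singular exactly when $P\ge1$. For $P\ge 1$, the continued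 fraction associated with $X_\sigma$ is the unique expansion $$\frac{P}{Q}=[a_1,a_2,\dots,a_r]:=a_1-\cfrac{1}{a_2-\cfrac{1}{\ddots-\cfrac{1}{a_r}}}$$ with $a_1=1$ and integers $a_i>1$ for $i>1$. Nash blowup. Let $X\subset\mathbb{K}^n$ be an irreducible algebraic variety of dimension $d$, and let $Gr(d,n)$ be the Grassmannian of $d$-dimensional linear subspaces of $\mathbb{K}^n$. Let $G:X\setminus\operatorname{Sing}(X)\to X\times Gr(d,n)$, $G(q)=(q,T_q(X))$, where $T_q(X)$ is the tangent space of $X$ at $q$. Let $X^*$ be the Zariski closure of the image of $G$ in $X\times Gr(d,n)$ and $\nu:X^*\to X$ the restriction of the projection. The Nash blowup of $X$ is $(X^*,\nu)$. *)

theory Defs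
  imports "HOL-Analysis.Analysis" "HOL-Library.Poly_Mapping"
    "HOL-Computational_Algebra.Polynomial"
begin

section \<open>Polynomials in finitely many variables\<close>

text \<open>
  Polynomials over \<open>'k\<close> in variables indexed by \<open>'v\<close> are the monoid algebra of
  \<open>'v \<Rightarrow>\<^sub>0 nat\<close>; Laurent polynomials in two variables are the monoid algebra of \<open>int ^ 2\<close>.
  Both carry the convolution product of \<^theory>\<open>HOL-Library.Poly_Mapping\<close>.
\<close>

type_synonym ('v, 'k) mpoly = "('v \<Rightarrow>\<^sub>0 nat) \<Rightarrow>\<^sub>0 'k"
type_synonym 'k laurent2 = "(int ^ 2) \<Rightarrow>\<^sub>0 'k"

text \<open>Substitution \<open>x\<^sub>i \<mapsto> f i\<close>, with coefficients mapped to the target by \<open>c\<close>.\<close>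

definition subst :: "('k::zero \<Rightarrow> 'b::comm_ring_1) \<Rightarrow> ('v \<Rightarrow> 'b) \<Rightarrow> ('v, 'k) mpoly \<Rightarrow> 'b" where
  "subst c f p =
     (\<Sum>m\<in>Poly_Mapping.keys p.
        c (Poly_Mapping.lookup p m) * (\<Prod>i\<in>Poly_Mapping.keys m. f i ^ Poly_Mapping.lookup m i))"

definition evalp :: "('v, 'k::comm_ring_1) mpoly \<Rightarrow> 'k ^ 'v \<Rightarrow> 'k" where
  "evalp p x = subst (\<lambda>a. a) (\<lambda>i. x $ i) p"

definition partial :: "'v \<Rightarrow> ('v, 'k::comm_ring_1) mpoly \<Rightarrow> ('v, 'k) mpoly" where
  "partial i p =
     (\<Sum>m\<in>Poly_Mapping.keys p.
        Poly_Mapping.single (m - Poly_Mapping.single i 1)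
          (of_nat (Poly_Mapping.lookup m i) * Poly_Mapping.lookup p m))"


section \<open>Affine algebraic sets, tangent spaces, dimension, singular points\<close>

definition zero_set :: "('v, 'k::comm_ring_1) mpoly set \<Rightarrow> ('k ^ 'v) set" where
  "zero_set S = {x. \<forall>p\<in>S. evalp p x = 0}"

definition algebraic_set :: "('k::comm_ring_1 ^ 'v) set \<Rightarrow> bool" where
  "algebraic_set Z \<longleftrightarrow> (\<exists>S. Z = zero_set S)"

definition vanishing_ideal :: "('k::comm_ring_1 ^ 'v) set \<Rightarrow> ('v, 'k) mpoly set" where
  "vanishing_ideal X = {p. \<forall>x\<in>X. evalp p x = 0}"

definition irreducible_algebraic_set :: "('k::comm_ring_1 ^ 'v) set \<Rightarrow> bool" where
  "irreducible_algebraic_set Z \<longleftrightarrow>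
     algebraic_set Z \<and> Z \<noteq> {} \<and>
     (\<forall>A B. algebraic_set A \<and> algebraic_set B \<and> Z \<subseteq> A \<union> B \<longrightarrow> Z \<subseteq> A \<or> Z \<subseteq> B)"

definition irreducible_chain :: "('k::comm_ring_1 ^ 'v) set \<Rightarrow> nat \<Rightarrow> (nat \<Rightarrow> ('k ^ 'v) set) \<Rightarrow> bool"
  where
  "irreducible_chain X n Z \<longleftrightarrow>
     (\<forall>i\<le>n. irreducible_algebraic_set (Z i) \<and> Z i \<subseteq> X) \<and> (\<forall>i<n. Z i \<subset> Z (Suc i))"

text \<open>
  Krull dimension of \<open>X\<close>, and of the local ring of \<open>X\<close> at \<open>q\<close> (whose primes correspond to the
  irreducible closed subsets of \<open>X\<close> through \<open>q\<close>). Over a field and with \<open>'v\<close> finite, the lengths of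
  chains are bounded by \<open>CARD('v)\<close>, so the suprema in \<open>nat\<close> are maxima.
\<close>

definition alg_dim :: "('k::comm_ring_1 ^ 'v) set \<Rightarrow> nat" where
  "alg_dim X = Sup {n. \<exists>Z. irreducible_chain X n Z}"

definition local_dim :: "('k::comm_ring_1 ^ 'v) set \<Rightarrow> 'k ^ 'v \<Rightarrow> nat" where
  "local_dim X q = Sup {n. \<exists>Z. irreducible_chain X n Z \<and> q \<in> Z 0}"

definition tangent_space :: "('k::field ^ 'v::finite) set \<Rightarrow> 'k ^ 'v \<Rightarrow> ('k ^ 'v) set" where
  "tangent_space X q = {v. \<forall>p\<in>vanishing_ideal X. (\<Sum>i\<in>UNIV. evalp (partial i p) q * v $ i) = 0}"

definition Sing :: "('k::field ^ 'v::finite) set \<Rightarrow> ('k ^ 'v) set" where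
  "Sing X = {q \<in> X. vec.dim (tangent_space X q) \<noteq> local_dim X q}"


section \<open>The product of affine space with a Grassmannian\<close>

definition Grassmannian :: "nat \<Rightarrow> ('k::field ^ 'n::finite) set set" where
  "Grassmannian d = {W. vec.subspace W \<and> vec.dim W = d}"

text \<open>
  For \<open>card J = d\<close>, the standard open chart \<open>U\<^sub>J\<close> of the Grassmannian consists of the \<open>W\<close> that project
  isomorphically onto the coordinates in \<open>J\<close>. Such a \<open>W\<close> has a unique basis \<open>(w\<^sub>i)\<^sub>i\<^sub>\<in>\<^sub>J\<close> with
  \<open>w\<^sub>i $ j = \<delta>\<^sub>i\<^sub>j\<close> for \<open>j \<in> J\<close>, and the remaining entries are free affine coordinates. To stay in
  one type for all \<open>J\<close>, the \<open>w\<^sub>i\<close> are stored as the rows of an \<open>'n \<times> 'n\<close> matrix whose rows outside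
  \<open>J\<close> are zero; the constant entries do not affect closedness or regularity.
  \<open>chart J Z\<close> is \<open>Z \<inter> (K\<^sup>n \<times> U\<^sub>J)\<close> in these coordinates.
\<close>

definition chart ::
  "'n set \<Rightarrow> (('k::field ^ 'n::finite) \<times> ('k ^ 'n) set) set \<Rightarrow> ('k ^ ('n + 'n \<times> 'n)) set" where
  "chart J Z =
     {p. (\<forall>i\<in>J. \<forall>j\<in>J. p $ Inr (i, j) = (if i = j then 1 else 0)) \<and>
         (\<forall>i. i \<notin> J \<longrightarrow> (\<forall>k. p $ Inr (i, k) = 0)) \<and>
         ((\<chi> k. p $ Inl k), vec.span ((\<lambda>i. \<chi> k. p $ Inr (i, k)) ` J)) \<in> Z}"

definition closed_in_prod :: "nat \<Rightarrow> (('k::field ^ 'n::finite) \<times> ('k ^ 'n) set) set \<Rightarrow> bool" where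
  "closed_in_prod d Z \<longleftrightarrow>
     Z \<subseteq> UNIV \<times> Grassmannian d \<and> (\<forall>J. card J = d \<longrightarrow> algebraic_set (chart J Z))"

definition smooth_in_prod :: "nat \<Rightarrow> (('k::field ^ 'n::finite) \<times> ('k ^ 'n) set) set \<Rightarrow> bool" where
  "smooth_in_prod d Z \<longleftrightarrow> (\<forall>J. card J = d \<longrightarrow> Sing (chart J Z) = {})"


section \<open>Nash blowup\<close>

text \<open>
  For an irreducible variety \<open>X\<close>. The closure is taken among the closed subsets of
  \<open>X \<times> Gr(d,n)\<close>; the blowup morphism is the restriction of \<^const>\<open>fst\<close>.
\<close>

definition nash_blowup :: "('k::field ^ 'n::finite) set \<Rightarrow> (('k ^ 'n) \<times> ('k ^ 'n) set) set" where
  "nash_blowup X =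
     (\<lambda>Z. closed_in_prod (alg_dim X) Z \<and> Z \<subseteq> X \<times> Grassmannian (alg_dim X)) hull
       ((\<lambda>q. (q, tangent_space X q)) ` (X - Sing X))"

definition nash_blowup_smooth :: "('k::field ^ 'n::finite) set \<Rightarrow> bool" where
  "nash_blowup_smooth X \<longleftrightarrow> smooth_in_prod (alg_dim X) (nash_blowup X)"


section \<open>Normal affine toric surfaces\<close>

definition real_vec :: "int ^ 'm \<Rightarrow> real ^ 'm" where
  "real_vec m = (\<chi> i. real_of_int (m $ i))"

definition real_mat :: "int ^ 'm ^ 'l \<Rightarrow> real ^ 'm ^ 'l" where
  "real_mat A = (\<chi> i j. real_of_int (A $ i $ j))"

definition rational_polyhedral_cone :: "(real ^ 'm) set \<Rightarrow> bool" where
  "rational_polyhedral_cone C \<longleftrightarrow> (\<exists>S. finite S \<and> C = convex_cone hull (real_vec ` S))"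

definition strongly_convex :: "(real ^ 'm) set \<Rightarrow> bool" where
  "strongly_convex C \<longleftrightarrow> C \<inter> uminus ` C = {0}"

definition generates_semigroup :: "('n::finite \<Rightarrow> int ^ 'm) \<Rightarrow> (real ^ 'm) set \<Rightarrow> bool" where
  "generates_semigroup \<gamma> C \<longleftrightarrow>
     {m. real_vec m \<in> C} = {\<Sum>i\<in>UNIV. int (c i) *s \<gamma> i |c. True}"

text \<open>The \<open>K\<close>-algebra homomorphism \<open>x\<^sub>i \<mapsto> t\<^sup>\<gamma>\<^sup>i\<close> and the zero set of its kernel.\<close>

definition toric_hom :: "('n \<Rightarrow> int ^ 2) \<Rightarrow> ('n, 'k::comm_ring_1) mpoly \<Rightarrow> 'k laurent2" where
  "toric_hom \<gamma> = subst (Poly_Mapping.single 0) (\<lambda>i. Poly_Mapping.single (\<gamma> i) 1)"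

definition toric_surface :: "('n \<Rightarrow> int ^ 2) \<Rightarrow> ('k::comm_ring_1 ^ 'n) set" where
  "toric_surface \<gamma> = zero_set {p. toric_hom \<gamma> p = 0}"


section \<open>Normal form and continued fraction\<close>

definition has_normal_form :: "(real ^ 2) set \<Rightarrow> int \<Rightarrow> int \<Rightarrow> bool" where
  "has_normal_form C P Q \<longleftrightarrow>
     coprime P Q \<and> 0 \<le> P \<and> P < Q \<and>
     (\<exists>A :: int ^ 2 ^ 2. \<bar>det A\<bar> = 1 \<and>
        (\<lambda>v. real_mat A *v v) ` C =
          convex_cone hull (real_vec ` {vector [1, 0], vector [P, Q]}))"

fun neg_cfrac :: "int list \<Rightarrow> rat" where
  "neg_cfrac [] = 0"
| "neg_cfrac [a] = of_int a"
| "neg_cfrac (a # b # as) = of_int a - 1 / neg_cfrac (b # as)"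

text \<open>
  The pair \<open>(P, Q)\<close> is determined by the cone only up to replacing \<open>P\<close> by its inverse modulo \<open>Q\<close>
  (exchanging the two rays), which reverses the expansion after its first entry; hence a relation.
\<close>

definition associated_cfrac :: "(real ^ 2) set \<Rightarrow> int list \<Rightarrow> bool" where
  "associated_cfrac C as \<longleftrightarrow>
     (\<exists>P Q. has_normal_form C P Q \<and> 1 \<le> P \<and>
        as \<noteq> [] \<and> hd as = 1 \<and> (\<forall>a\<in>set (tl as). 1 < a) \<and>
        of_int P / of_int Q = neg_cfrac as)"

end

theory Submission
  imports Defs
begin

text \<open>
  The torus of \<open>X\<close> is parametrised by monomials, \<open>q\<^sub>k = t\<^bsup>\<delta>\<^sub>k\<^esup>\<close>, where the exponents
  generate the semigroup of the cone, and the Pluecker coordinates of its tangent planes are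
  \<open>det (\<delta>\<^sub>i, \<delta>\<^sub>j) t\<^bsup>\<delta>\<^sub>i + \<delta>\<^sub>j\<^esup>\<close>. In the chart of the Grassmannian where the coordinates
  \<open>i, j\<close> are parameters of the plane, the graph of the Gauss map is therefore again parametrised by
  multiples of monomials, with exponents \<open>\<delta>\<^sub>k\<close>, \<open>\<delta>\<^sub>k - \<delta>\<^sub>i\<close> if \<open>det (\<delta>\<^sub>k, \<delta>\<^sub>j) \<noteq> 0\<close>, and
  \<open>\<delta>\<^sub>k - \<delta>\<^sub>j\<close> if \<open>det (\<delta>\<^sub>i, \<delta>\<^sub>k) \<noteq> 0\<close>. So the Nash blowup is covered by affine toric surfaces
  that need not be normal, one for each pair with \<open>det (\<delta>\<^sub>i, \<delta>\<^sub>j) \<noteq> 0\<close>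
  (\<open>chart_nash_blowup\<close>), and it is smooth if and only if all of these are.

  A toric surface whose semigroup is \<open>\<nat>\<^sup>2\<close>, \<open>\<nat> \<times> \<int>\<close> or \<open>\<int>\<^sup>2\<close> is smooth (\<open>toric_smooth\<close>). If
  the semigroup has no units except \<open>0\<close> and has three irreducible elements, the fixed point of the
  torus is singular: every irreducible element contributes a tangent vector there
  (\<open>toric_singular\<close>), while the dimension is at most two (\<open>irreducible_chain_toric_le\<close>).

  Let \<open>g\<^sub>0, \<dots>, g\<^sub>m\<^sub>+\<^sub>1\<close> be the minimal generators of the semigroup of the cone in the order of their
  slopes, so that \<open>g\<^sub>k\<^sub>-\<^sub>1 + g\<^sub>k\<^sub>+\<^sub>1 = b\<^sub>k g\<^sub>k\<close> with \<open>b\<^sub>k = a\<^sub>k\<^sub>+\<^sub>1\<close>. If \<open>\<delta>\<^sub>i\<close> or \<open>\<delta>\<^sub>j\<close> is not a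
  minimal generator, or if they are generators that are not neighbours, then the semigroup of the
  chart contains a basis of the lattice one of whose members is invertible in it, and the chart is
  smooth (\<open>toric_smooth_unit\<close>). For neighbours \<open>g\<^sub>s, g\<^sub>s\<^sub>+\<^sub>1\<close> put \<open>p = b\<^sub>s\<close> and \<open>q = b\<^sub>s\<^sub>+\<^sub>1\<close>. In the basis
  \<open>g\<^sub>s, g\<^sub>s\<^sub>+\<^sub>1\<close> the semigroup of the chart is generated by \<open>(1, 0)\<close>, \<open>(0, 1)\<close>, \<open>(p - 1, -1)\<close>,
  \<open>(p, -2)\<close>, \<open>(-1, q - 1)\<close>, \<open>(-2, q)\<close>, where the elements with \<open>p\<close> are absent for \<open>s = 0\<close> and those
  with \<open>q\<close> for \<open>s = m\<close>. It is of one of the smooth types exactly if \<open>(p, q)\<close> is \<open>(2, 2)\<close>, \<open>(2, 3)\<close> or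
  \<open>(3, 2)\<close>, or if the only one of \<open>p, q\<close> that is present equals \<open>2\<close>; in all other cases it has no
  units except \<open>0\<close> and three irreducible elements (\<open>smooth_adjacent_iff\<close>). The conjunction over
  all \<open>s\<close> is the condition of the theorem.
\<close>

section \<open>Polynomial functions and their derivatives\<close>

text \<open>Evaluation, directional derivatives and the coefficients of a pullback to the torus are linear
  functionals, determined by their values on monomials; their common rules are proved once, for
  such functionals.\<close>

definition lfun :: "(('v \<Rightarrow>\<^sub>0 nat) \<Rightarrow> 'k) \<Rightarrow> ('v, 'k::comm_ring_1) mpoly \<Rightarrow> 'k" where
  "lfun \<Phi> p = (\<Sum>m\<in>Poly_Mapping.keys p. Poly_Mapping.lookup p m * \<Phi> m)"

lemma lfun_superset:
  assumes "finite M" "Poly_Mapping.keys p \<subseteq> M"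
  shows "lfun \<Phi> p = (\<Sum>m\<in>M. Poly_Mapping.lookup p m * \<Phi> m)"
  unfolding lfun_def
  by (rule sum.mono_neutral_left) (use assms in \<open>auto simp: in_keys_iff\<close>)

lemma lfun_add: "lfun \<Phi> (p + q) = lfun \<Phi> p + lfun \<Phi> q"
proof -
  let ?M = "Poly_Mapping.keys p \<union> Poly_Mapping.keys q"
  have "lfun \<Phi> (p + q) = (\<Sum>m\<in>?M. Poly_Mapping.lookup (p + q) m * \<Phi> m)"
    by (rule lfun_superset) (use Poly_Mapping.keys_add[of p q] in auto)
  moreover have "lfun \<Phi> p = (\<Sum>m\<in>?M. Poly_Mapping.lookup p m * \<Phi> m)"
    by (rule lfun_superset) auto
  moreover have "lfun \<Phi> q = (\<Sum>m\<in>?M. Poly_Mapping.lookup q m * \<Phi> m)"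
    by (rule lfun_superset) auto
  ultimately show ?thesis by (simp add: lookup_add sum.distrib algebra_simps)
qed

lemma lfun_zero [simp]: "lfun \<Phi> 0 = 0"
  by (simp add: lfun_def)

lemma lfun_single [simp]: "lfun \<Phi> (Poly_Mapping.single m a) = a * \<Phi> m"
  by (simp add: lfun_def)

lemma lfun_sum: "lfun \<Phi> (\<Sum>i\<in>I. f i) = (\<Sum>i\<in>I. lfun \<Phi> (f i))"
  by (induction I rule: infinite_finite_induct) (auto simp: lfun_add)

lemma mpoly_induct [case_names zero add]:
  fixes p :: "('v, 'k::comm_ring_1) mpoly"
  assumes "P 0" and "\<And>p m a. P p \<Longrightarrow> P (p + Poly_Mapping.single m a)"
  shows "P p"
proof (induction p rule: update_induct)
  case const
  then show ?case by (rule assms(1))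
next
  case (update f a b)
  have "Poly_Mapping.update a b f = f + Poly_Mapping.single a b"
    using update(1) by (intro poly_mapping_eqI) (auto simp: lookup_update lookup_add lookup_single in_keys_iff when_def)
  then show ?case using assms(2)[OF update(3)] by simp
qed

lemma lfun_mult:
  assumes "\<And>m n. \<Phi> (m + n) = \<Phi> m * \<Phi> n"
  shows "lfun \<Phi> (p * q) = lfun \<Phi> p * lfun \<Phi> q"
proof (induction p rule: mpoly_induct)
  case (add p m a)
  have "lfun \<Phi> (Poly_Mapping.single m a * q) = a * \<Phi> m * lfun \<Phi> q"
    by (induction q rule: mpoly_induct)
       (auto simp: lfun_add distrib_left mult_single assms algebra_simps)
  then show ?case using add by (simp add: lfun_add distrib_right)
qed auto

lemma lfun_mult_deriv:
  assumes "\<And>m n. \<Phi> (m + n) = \<Phi> m * \<Phi> n"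
    and "\<And>m n. \<Delta> (m + n) = \<Delta> m * \<Phi> n + \<Phi> m * \<Delta> n"
  shows "lfun \<Delta> (p * q) = lfun \<Delta> p * lfun \<Phi> q + lfun \<Phi> p * lfun \<Delta> q"
proof (induction p rule: mpoly_induct)
  case (add p m a)
  have "lfun \<Delta> (Poly_Mapping.single m a * q) = a * \<Delta> m * lfun \<Phi> q + a * \<Phi> m * lfun \<Delta> q"
    by (induction q rule: mpoly_induct)
       (auto simp: lfun_add distrib_left mult_single assms algebra_simps)
  then show ?case using add by (simp add: lfun_add algebra_simps)
qed auto

definition mval :: "('v::finite \<Rightarrow>\<^sub>0 nat) \<Rightarrow> 'k::comm_ring_1 ^ 'v \<Rightarrow> 'k" where
  "mval m x = (\<Prod>i\<in>UNIV. x $ i ^ Poly_Mapping.lookup m i)"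

definition dmval :: "('v::finite \<Rightarrow>\<^sub>0 nat) \<Rightarrow> 'k::comm_ring_1 ^ 'v \<Rightarrow> 'k ^ 'v \<Rightarrow> 'k" where
  "dmval m x w = (\<Sum>i\<in>UNIV. of_nat (Poly_Mapping.lookup m i) *
      mval (m - Poly_Mapping.single i 1) x * w $ i)"

definition dirderiv :: "('v::finite, 'k::comm_ring_1) mpoly \<Rightarrow> 'k ^ 'v \<Rightarrow> 'k ^ 'v \<Rightarrow> 'k" where
  "dirderiv p x w = (\<Sum>i\<in>UNIV. evalp (partial i p) x * w $ i)"

lemma prod_keys_eq_mval:
  "(\<Prod>i\<in>Poly_Mapping.keys m. x $ i ^ Poly_Mapping.lookup m i) = mval m x"
  unfolding mval_def by (rule prod.mono_neutral_left) (auto simp: in_keys_iff)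

lemma evalp_eq_lfun: "evalp p x = lfun (\<lambda>m. mval m x) p"
  by (simp add: evalp_def subst_def lfun_def prod_keys_eq_mval)

lemma dirderiv_eq_lfun: "dirderiv p x w = lfun (\<lambda>m. dmval m x w) p"
proof -
  have *: "evalp (partial i p) x =
     (\<Sum>m\<in>Poly_Mapping.keys p. of_nat (Poly_Mapping.lookup m i) * Poly_Mapping.lookup p m
        * mval (m - Poly_Mapping.single i 1) x)" for i
    by (simp add: evalp_eq_lfun partial_def lfun_sum)
  show ?thesis
    unfolding dirderiv_def * lfun_def dmval_def sum_distrib_right sum_distrib_left
    by (subst sum.swap) (auto intro!: sum.cong simp: algebra_simps)
qed

lemma tangent_space_eq: "tangent_space X q = {w. \<forall>p\<in>vanishing_ideal X. dirderiv p q w = 0}"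
  by (simp add: tangent_space_def dirderiv_def)

lemma mval_add: "mval (m + n) x = mval m x * mval n x"
  by (simp add: mval_def lookup_add power_add prod.distrib)

lemma mval_zero [simp]: "mval 0 x = 1"
  by (simp add: mval_def)

lemma mval_single [simp]: "mval (Poly_Mapping.single i n) x = x $ i ^ n"
  by (cases "n = 0") (simp_all flip: prod_keys_eq_mval)

lemma dmval_zero [simp]: "dmval 0 x w = 0"
  by (simp add: dmval_def)

lemma dmval_add: "dmval (m + n) x w = dmval m x w * mval n x + mval m x * dmval n x w"
proof -
  have *: "of_nat (Poly_Mapping.lookup m i) * mval (m - Poly_Mapping.single i 1 + n) x
     = of_nat (Poly_Mapping.lookup m i) * mval (m + n - Poly_Mapping.single i 1) x" for i m n
  proof (cases "Poly_Mapping.lookup m i = 0")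
    case False
    then have "m - Poly_Mapping.single i 1 + n = m + n - Poly_Mapping.single i 1"
      by (intro poly_mapping_eqI) (auto simp: lookup_add lookup_minus lookup_single when_def)
    then show ?thesis by simp
  qed auto
  have "of_nat (Poly_Mapping.lookup (m + n) i) * mval (m + n - Poly_Mapping.single i 1) x * w $ i
     = of_nat (Poly_Mapping.lookup m i) * mval (m - Poly_Mapping.single i 1) x * w $ i * mval n x
     + mval m x * (of_nat (Poly_Mapping.lookup n i) * mval (n - Poly_Mapping.single i 1) x * w $ i)" for i
    using *[of m i n] *[of n i m]
    by (simp add: lookup_add mval_add algebra_simps)
  then show ?thesis
    by (simp add: dmval_def sum.distrib sum_distrib_left sum_distrib_right)
qed

lemma dmval_var [simp]: "dmval (Poly_Mapping.single i (Suc 0)) x w = w $ i"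
proof -
  have "dmval (Poly_Mapping.single i 1) x w = (\<Sum>j\<in>UNIV. if j = i then w $ i else 0)"
    unfolding dmval_def by (intro sum.cong) (auto simp: lookup_single)
  then show ?thesis by simp
qed

lemma expo_induct [case_names zero step]:
  fixes m :: "'v::finite \<Rightarrow>\<^sub>0 nat"
  assumes "P 0" and "\<And>m i. P m \<Longrightarrow> P (m + Poly_Mapping.single i 1)"
  shows "P m"
proof (induction "\<Sum>i\<in>UNIV. Poly_Mapping.lookup m i" arbitrary: m)
  case 0
  then have "m = 0" by (intro poly_mapping_eqI) simp
  then show ?case using assms(1) by simp
next
  case (Suc k)
  then obtain i where i: "Poly_Mapping.lookup m i \<noteq> 0"
    by (metis (no_types) Zero_not_Suc sum.neutral)
  define n where "n = m - Poly_Mapping.single i 1"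
  have m: "m = n + Poly_Mapping.single i 1"
    using i by (intro poly_mapping_eqI) (auto simp: n_def lookup_add lookup_minus lookup_single when_def)
  have "(\<Sum>j\<in>UNIV. Poly_Mapping.lookup m j)
      = (\<Sum>j\<in>UNIV. Poly_Mapping.lookup n j) + (\<Sum>j\<in>UNIV. if j = i then 1 else 0)"
    unfolding m lookup_add sum.distrib by (auto simp: lookup_single when_def intro!: sum.cong)
  then have "k = (\<Sum>j\<in>UNIV. Poly_Mapping.lookup n j)" using Suc(2) by simp
  then show ?case using Suc(1)[of n] assms(2)[of n i] m by simp
qed

subsection \<open>Polynomial functions\<close>

abbreviation Cst :: "'k::comm_ring_1 \<Rightarrow> ('v, 'k) mpoly" where
  "Cst a \<equiv> Poly_Mapping.single 0 a"
abbreviation Var :: "'v \<Rightarrow> ('v, 'k::comm_ring_1) mpoly" where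
  "Var i \<equiv> Poly_Mapping.single (Poly_Mapping.single i (Suc 0)) 1"

lemma evalp_add [simp]: "evalp (p + q) x = evalp p x + evalp q x"
  by (simp add: evalp_eq_lfun lfun_add)
lemma evalp_mult [simp]: "evalp (p * q) x = evalp p x * evalp q x"
  by (simp add: evalp_eq_lfun lfun_mult mval_add)
lemma evalp_Cst [simp]: "evalp (Cst a) x = a"
  by (simp add: evalp_eq_lfun)
lemma evalp_zero [simp]: "evalp 0 x = 0"
  by (simp add: evalp_eq_lfun)
lemma evalp_one [simp]: "evalp 1 x = 1"
  using evalp_Cst[of 1 x] by simp
lemma evalp_Var [simp]: "evalp (Var i) x = x $ i"
  by (simp add: evalp_eq_lfun)
lemma evalp_uminus [simp]: "evalp (- p) x = - evalp p x"
  using evalp_add[of p "- p" x] by (simp add: eq_neg_iff_add_eq_0 add.commute)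
lemma evalp_diff [simp]: "evalp (p - q) x = evalp p x - evalp q x"
  using evalp_add[of p "- q" x] by simp
lemma evalp_sum [simp]: "evalp (\<Sum>i\<in>I. f i) x = (\<Sum>i\<in>I. evalp (f i) x)"
  by (induction I rule: infinite_finite_induct) auto
lemma evalp_power [simp]: "evalp (p ^ n) x = evalp p x ^ n"
  by (induction n) auto

lemma dirderiv_add [simp]: "dirderiv (p + q) x w = dirderiv p x w + dirderiv q x w"
  by (simp add: dirderiv_eq_lfun lfun_add)
lemma dirderiv_mult [simp]:
  "dirderiv (p * q) x w = dirderiv p x w * evalp q x + evalp p x * dirderiv q x w"
  unfolding dirderiv_eq_lfun evalp_eq_lfun
  by (rule lfun_mult_deriv) (simp_all add: mval_add dmval_add)
lemma dirderiv_Cst [simp]: "dirderiv (Cst a) x w = 0"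
  by (simp add: dirderiv_eq_lfun)
lemma dirderiv_zero [simp]: "dirderiv 0 x w = 0"
  by (simp add: dirderiv_eq_lfun)
lemma dirderiv_one [simp]: "dirderiv 1 x w = 0"
  using dirderiv_Cst[of 1 x w] by simp
lemma dirderiv_Var [simp]: "dirderiv (Var i) x w = w $ i"
  by (simp only: dirderiv_eq_lfun lfun_single dmval_var mult_1)
lemma dirderiv_uminus [simp]: "dirderiv (- p) x w = - dirderiv p x w"
  using dirderiv_add[of p "- p" x w] by (simp add: eq_neg_iff_add_eq_0 add.commute)
lemma dirderiv_diff [simp]: "dirderiv (p - q) x w = dirderiv p x w - dirderiv q x w"
  using dirderiv_add[of p "- q" x w] by simp

lemma subspace_tangent_space: "vec.subspace (tangent_space X q)"
  by (rule vec.subspaceI)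
     (auto simp: tangent_space_eq dirderiv_def algebra_simps sum.distrib simp flip: sum_distrib_left)

lemma dirderiv_power_eq_0:
  assumes "dirderiv p x w = 0" shows "dirderiv (p ^ n) x w = 0"
  using assms by (induction n) auto

lemma poly_fun_induct [case_names Cst Var add mult]:
  fixes p :: "('v::finite, 'k::comm_ring_1) mpoly"
  assumes "\<And>a. P (Cst a)" "\<And>i. P (Var i)" "\<And>p q. P p \<Longrightarrow> P q \<Longrightarrow> P (p + q)"
    "\<And>p q. P p \<Longrightarrow> P q \<Longrightarrow> P (p * q)"
  shows "P p"
proof (induction p rule: mpoly_induct)
  case zero
  show ?case using assms(1)[of 0] by simp
next
  case (add p m a)
  have "P (Poly_Mapping.single m 1)"
  proof (induction m rule: expo_induct)
    case zero
    then show ?case using assms(1)[of 1] by simp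
  next
    case (step m i)
    have "Poly_Mapping.single (m + Poly_Mapping.single i 1) 1
       = Poly_Mapping.single m (1::'k) * Var i" by (simp add: mult_single)
    then show ?case using assms(4)[OF step assms(2)] by simp
  qed
  moreover have "Poly_Mapping.single m a = Cst a * Poly_Mapping.single m 1"
    by (simp add: mult_single)
  ultimately show ?case using assms(1,3,4) add by metis
qed

subsection \<open>Zariski closure\<close>

definition zclosure :: "('k::comm_ring_1 ^ 'v) set \<Rightarrow> ('k ^ 'v) set" where
  "zclosure T = zero_set (vanishing_ideal T)"

lemma zclosure_iff: "x \<in> zclosure T \<longleftrightarrow> (\<forall>p. (\<forall>y\<in>T. evalp p y = 0) \<longrightarrow> evalp p x = 0)"
  by (auto simp: zclosure_def zero_set_def vanishing_ideal_def)

lemma subset_zclosure: "T \<subseteq> zclosure T"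
  by (auto simp: zclosure_iff)

lemma vanishing_ideal_zclosure [simp]: "vanishing_ideal (zclosure T) = vanishing_ideal T"
  by (auto simp: vanishing_ideal_def zclosure_iff subset_zclosure)

lemma algebraic_zclosure [simp]: "algebraic_set (zclosure T)"
  by (auto simp: algebraic_set_def zclosure_def)

lemma zclosure_minimal: "algebraic_set Z \<Longrightarrow> T \<subseteq> Z \<Longrightarrow> zclosure T \<subseteq> Z"
  by (fastforce simp: algebraic_set_def zero_set_def zclosure_iff)

lemma algebraic_zero_set [simp]: "algebraic_set (zero_set S)"
  by (auto simp: algebraic_set_def)

section \<open>Affine toric surfaces given by monomials with coefficients\<close>

definition lmon :: "int \<times> int \<Rightarrow> 'k::field \<Rightarrow> 'k \<Rightarrow> 'k" where
  "lmon d s t = s powi fst d * t powi snd d"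

definition pt :: "('v \<Rightarrow> 'k::field) \<Rightarrow> ('v \<Rightarrow> int \<times> int) \<Rightarrow> 'k \<Rightarrow> 'k \<Rightarrow> 'k ^ 'v" where
  "pt c \<delta> s t = (\<chi> k. c k * lmon (\<delta> k) s t)"

definition orbit :: "('v \<Rightarrow> 'k::field) \<Rightarrow> ('v \<Rightarrow> int \<times> int) \<Rightarrow> ('k ^ 'v) set" where
  "orbit c \<delta> = {pt c \<delta> s t | s t. s \<noteq> 0 \<and> t \<noteq> 0}"

text \<open>The coefficients are there because the coordinates of the charts of the Nash blowup are multiples
  of Laurent monomials, some of them zero. Curves and points inside a toric surface are of this
  form, too, if the exponents span less than the plane.\<close>

definition toric :: "('v \<Rightarrow> 'k::field) \<Rightarrow> ('v \<Rightarrow> int \<times> int) \<Rightarrow> ('k ^ 'v) set" where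
  "toric c \<delta> = zclosure (orbit c \<delta>)"

text \<open>The exponent of the Laurent monomial to which a monomial restricts on the torus.\<close>

definition expdeg :: "('v::finite \<Rightarrow> int \<times> int) \<Rightarrow> ('v \<Rightarrow>\<^sub>0 nat) \<Rightarrow> int \<times> int" where
  "expdeg \<delta> m = (\<Sum>i\<in>UNIV. int (Poly_Mapping.lookup m i) * fst (\<delta> i),
                 \<Sum>i\<in>UNIV. int (Poly_Mapping.lookup m i) * snd (\<delta> i))"

lemma lmon_add: "s \<noteq> 0 \<Longrightarrow> t \<noteq> 0 \<Longrightarrow> lmon (d + d') s t = lmon d s t * lmon d' s t"
  by (simp add: lmon_def power_int_add)

lemma lmon_0 [simp]: "lmon 0 s t = 1"
  by (simp add: lmon_def)

lemma expdeg_add: "expdeg \<delta> (m + n) = expdeg \<delta> m + expdeg \<delta> n"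
  by (simp add: expdeg_def lookup_add sum.distrib algebra_simps)

lemma expdeg_0 [simp]: "expdeg \<delta> 0 = 0"
  by (simp add: expdeg_def zero_prod_def)

lemma expdeg_single [simp]: "expdeg \<delta> (Poly_Mapping.single i (Suc 0)) = \<delta> i"
proof -
  have "(\<Sum>j\<in>UNIV. int (Poly_Mapping.lookup (Poly_Mapping.single i 1) j) * f j) = f i" for f :: "'a \<Rightarrow> int"
  proof -
    have "(\<Sum>j\<in>UNIV. int (Poly_Mapping.lookup (Poly_Mapping.single i 1) j) * f j)
        = (\<Sum>j\<in>UNIV. if j = i then f i else 0)"
      by (intro sum.cong) (auto simp: lookup_single)
    then show ?thesis by simp
  qed
  then show ?thesis by (simp add: expdeg_def)
qed

lemma mval_pt:
  assumes "s \<noteq> 0" "t \<noteq> 0"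
  shows "mval m (pt c \<delta> s t) = mval m (vec_lambda c) * lmon (expdeg \<delta> m) s t"
proof (induction m rule: expo_induct)
  case (step m i)
  then show ?case using assms by (simp add: mval_add expdeg_add lmon_add) (simp add: pt_def)
qed auto

lemma infinite_nonzero: "infinite (- {0 :: 'k::field_char_0})"
  using infinite_UNIV_char_0[where 'a = 'k] by (simp add: Compl_eq_Diff_UNIV)

lemma poly_eq_0_if_nonzero:
  fixes p :: "'k::field_char_0 poly"
  assumes "\<And>x. x \<noteq> 0 \<Longrightarrow> poly p x = 0"
  shows "p = 0"
proof (rule ccontr)
  assume "p \<noteq> 0"
  then have "finite {x. poly p x = 0}" by (rule poly_roots_finite)
  moreover have "- {0} \<subseteq> {x. poly p x = 0}" using assms by auto
  ultimately show False using infinite_nonzero finite_subset by blast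
qed

text \<open>A power of \<open>t\<close> clears the denominators, and a polynomial with infinitely many zeros is zero.\<close>

lemma laurent_independent_1:
  fixes C :: "int \<Rightarrow> 'k::field_char_0"
  assumes "finite N" and z: "\<And>t. t \<noteq> 0 \<Longrightarrow> (\<Sum>n\<in>N. C n * t powi n) = 0" and "n \<in> N"
  shows "C n = 0"
proof -
  obtain M :: nat where M: "\<And>n. n \<in> N \<Longrightarrow> n + int M \<ge> 0"
  proof
    fix n assume "n \<in> N"
    then have "nat \<bar>n\<bar> \<le> (\<Sum>n\<in>N. nat \<bar>n\<bar>)" using assms(1) by (intro member_le_sum) auto
    then show "n + int (\<Sum>n\<in>N. nat \<bar>n\<bar>) \<ge> 0" by linarith
  qed
  define p where "p = (\<Sum>n\<in>N. monom (C n) (nat (n + int M)))"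
  have "poly p t = 0" if "t \<noteq> 0" for t
  proof -
    have "poly p t = (\<Sum>n\<in>N. C n * t powi n * t ^ M)"
      unfolding p_def poly_sum
    proof (intro sum.cong refl)
      fix n assume "n \<in> N"
      then have "t ^ nat (n + int M) = t powi n * t ^ M"
        using M that by (metis nat_0_le power_int_add power_int_of_nat)
      then show "poly (monom (C n) (nat (n + int M))) t = C n * t powi n * t ^ M"
        by (simp add: poly_monom)
    qed
    then show ?thesis using z[OF that] by (simp flip: sum_distrib_right)
  qed
  then have "p = 0" by (rule poly_eq_0_if_nonzero)
  then have "0 = coeff p (nat (n + int M))" by simp
  also have "\<dots> = (\<Sum>k\<in>N. if k = n then C n else 0)"
    unfolding p_def coeff_sum using M assms(3)
    by (intro sum.cong) (auto simp: eq_nat_nat_iff)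
  also have "\<dots> = C n" using assms by simp
  finally show ?thesis by simp
qed

lemma laurent_independent_2:
  fixes C :: "int \<times> int \<Rightarrow> 'k::field_char_0"
  assumes fin: "finite D"
    and z: "\<And>s t. s \<noteq> 0 \<Longrightarrow> t \<noteq> 0 \<Longrightarrow> (\<Sum>d\<in>D. C d * lmon d s t) = 0" and "d \<in> D"
  shows "C d = 0"
proof -
  let ?D = "{e \<in> D. fst e = fst d}"
  have "(\<Sum>e\<in>?D. C e * t powi snd e) = 0" if t: "t \<noteq> 0" for t
  proof (rule laurent_independent_1[where N = "fst ` D" and C = "\<lambda>n. \<Sum>e | e \<in> D \<and> fst e = n. C e * t powi snd e"])
    fix s :: 'k assume s: "s \<noteq> 0"
    have "(\<Sum>n\<in>fst ` D. (\<Sum>e | e \<in> D \<and> fst e = n. C e * t powi snd e) * s powi n)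
        = (\<Sum>n\<in>fst ` D. \<Sum>e | e \<in> D \<and> fst e = n. C e * lmon e s t)"
      unfolding sum_distrib_right by (intro sum.cong refl) (auto simp: lmon_def)
    also have "\<dots> = (\<Sum>e\<in>D. C e * lmon e s t)"
      by (rule sum.image_gen[OF fin, symmetric])
    finally show "(\<Sum>n\<in>fst ` D. (\<Sum>e | e \<in> D \<and> fst e = n. C e * t powi snd e) * s powi n) = 0"
      using z s t by simp
  qed (use assms in auto)
  note * = this
  have inj: "inj_on snd ?D" by (auto simp: inj_on_def prod_eq_iff)
  have "(\<Sum>j\<in>snd ` ?D. C (fst d, j) * t powi j) = 0" if "t \<noteq> 0" for t
  proof -
    have "(\<Sum>j\<in>snd ` ?D. C (fst d, j) * t powi j) = (\<Sum>e\<in>?D. C (fst d, snd e) * t powi snd e)"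
      using inj by (simp only: sum.reindex o_def)
    also have "\<dots> = (\<Sum>e\<in>?D. C e * t powi snd e)"
      by (rule sum.cong) (simp_all add: prod_eq_iff split_def, metis prod.collapse)
    also have "\<dots> = 0" using * that by blast
    finally show ?thesis .
  qed
  then have "C (fst d, snd d) = 0"
    by (intro laurent_independent_1[where N = "snd ` ?D" and C = "\<lambda>j. C (fst d, j)"]) (use assms in auto)
  then show ?thesis by simp
qed

text \<open>The coefficient at the Laurent monomial with exponent \<open>d\<close> in the pullback of \<open>p\<close> to the torus.\<close>

definition hcoeff :: "('v::finite \<Rightarrow> 'k::field) \<Rightarrow> ('v \<Rightarrow> int \<times> int) \<Rightarrow> int \<times> int \<Rightarrow> ('v, 'k) mpoly \<Rightarrow> 'k" where
  "hcoeff c \<delta> d p = lfun (\<lambda>m. if expdeg \<delta> m = d then mval m (vec_lambda c) else 0) p"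

lemma lfun_graded:
  assumes "\<And>m. m \<in> Poly_Mapping.keys p \<Longrightarrow> \<Phi> m = mval m (vec_lambda c) * \<Psi> (expdeg \<delta> m)"
  shows "lfun \<Phi> p = (\<Sum>d\<in>expdeg \<delta> ` Poly_Mapping.keys p. hcoeff c \<delta> d p * \<Psi> d)"
proof -
  let ?M = "Poly_Mapping.keys p"
  have "lfun \<Phi> p = (\<Sum>d\<in>expdeg \<delta> ` ?M. \<Sum>m | m \<in> ?M \<and> expdeg \<delta> m = d. Poly_Mapping.lookup p m * \<Phi> m)"
    unfolding lfun_def by (rule sum.image_gen) simp
  also have "\<dots> = (\<Sum>d\<in>expdeg \<delta> ` ?M. hcoeff c \<delta> d p * \<Psi> d)"
  proof (rule sum.cong[OF refl])
    fix d
    have "hcoeff c \<delta> d p = (\<Sum>m\<in>?M. if expdeg \<delta> m = d then Poly_Mapping.lookup p m * mval m (vec_lambda c) else 0)"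
      unfolding hcoeff_def lfun_def by (intro sum.cong) auto
    also have "\<dots> = (\<Sum>m | m \<in> ?M \<and> expdeg \<delta> m = d. Poly_Mapping.lookup p m * mval m (vec_lambda c))"
      by (simp add: sum.inter_filter)
    finally show "(\<Sum>m | m \<in> ?M \<and> expdeg \<delta> m = d. Poly_Mapping.lookup p m * \<Phi> m) = hcoeff c \<delta> d p * \<Psi> d"
      by (simp add: sum_distrib_left assms mult_ac)
  qed
  finally show ?thesis .
qed

lemma evalp_pt:
  assumes "s \<noteq> 0" "t \<noteq> 0"
  shows "evalp p (pt c \<delta> s t) = (\<Sum>d\<in>expdeg \<delta> ` Poly_Mapping.keys p. hcoeff c \<delta> d p * lmon d s t)"
  unfolding evalp_eq_lfun by (rule lfun_graded) (simp add: mval_pt assms)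

lemma hcoeff_outside: "d \<notin> expdeg \<delta> ` Poly_Mapping.keys p \<Longrightarrow> hcoeff c \<delta> d p = 0"
  unfolding hcoeff_def lfun_def by (rule sum.neutral) auto

lemma vanishing_ideal_orbit_iff:
  fixes c :: "'v::finite \<Rightarrow> 'k::field_char_0"
  shows "p \<in> vanishing_ideal (orbit c \<delta>) \<longleftrightarrow> (\<forall>d. hcoeff c \<delta> d p = 0)"
proof
  assume p: "p \<in> vanishing_ideal (orbit c \<delta>)"
  show "\<forall>d. hcoeff c \<delta> d p = 0"
  proof
    fix d
    show "hcoeff c \<delta> d p = 0"
    proof (cases "d \<in> expdeg \<delta> ` Poly_Mapping.keys p")
      case True
      show ?thesis
        by (rule laurent_independent_2[where C = "\<lambda>d. hcoeff c \<delta> d p", OF _ _ True])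
           (use p in \<open>auto simp: evalp_pt[symmetric] vanishing_ideal_def orbit_def\<close>)
    qed (rule hcoeff_outside)
  qed
next
  assume "\<forall>d. hcoeff c \<delta> d p = 0"
  then show "p \<in> vanishing_ideal (orbit c \<delta>)"
    by (auto simp: vanishing_ideal_def orbit_def evalp_pt simp del: split_paired_All intro!: sum.neutral)
qed

text \<open>The ideal of the orbit is graded by the exponent, and on each graded piece a functional of this
  shape is a multiple of the evaluation at \<open>s = t = 1\<close>. This is the source of the points and
  tangent vectors below.\<close>

lemma lfun_eq_0_on_ideal:
  fixes c :: "'v::finite \<Rightarrow> 'k::field_char_0"
  assumes "p \<in> vanishing_ideal (orbit c \<delta>)"
    and "\<And>m. \<Phi> m = mval m (vec_lambda c) * \<Psi> (expdeg \<delta> m)"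
  shows "lfun \<Phi> p = 0"
  using assms by (subst lfun_graded[where c = c and \<delta> = \<delta> and \<Psi> = \<Psi>]) (auto simp: vanishing_ideal_orbit_iff simp del: split_paired_All)

subsection \<open>Points and tangent vectors from the semigroup\<close>

inductive_set mon :: "(int \<times> int) set \<Rightarrow> (int \<times> int) set" for G where
  mon_0: "0 \<in> mon G"
| mon_step: "g \<in> G \<Longrightarrow> x \<in> mon G \<Longrightarrow> g + x \<in> mon G"

lemma mon_add: "x \<in> mon G \<Longrightarrow> y \<in> mon G \<Longrightarrow> x + y \<in> mon G"
  by (induction rule: mon.induct) (auto simp: add.assoc intro: mon.intros)

lemma mon_base: "g \<in> G \<Longrightarrow> g \<in> mon G"
  using mon_step[OF _ mon_0] by simp

lemma mon_least: "0 \<in> S \<Longrightarrow> (\<And>x y. x \<in> S \<Longrightarrow> y \<in> S \<Longrightarrow> x + y \<in> S) \<Longrightarrow> G \<subseteq> S \<Longrightarrow> mon G \<subseteq> S"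
proof
  fix x assume S: "0 \<in> S" "\<And>x y. x \<in> S \<Longrightarrow> y \<in> S \<Longrightarrow> x + y \<in> S" "G \<subseteq> S" and "x \<in> mon G"
  from this(4) show "x \<in> S" by (induction rule: mon.induct) (use S in auto)
qed

lemma mon_subset: "G \<subseteq> mon H \<Longrightarrow> mon G \<subseteq> mon H"
  by (rule mon_least) (auto intro: mon_0 mon_add)

definition expos :: "('v \<Rightarrow> 'k::zero) \<Rightarrow> ('v \<Rightarrow> int \<times> int) \<Rightarrow> (int \<times> int) set" where
  "expos c \<delta> = \<delta> ` {k. c k \<noteq> 0}"

text \<open>Homomorphisms from the semigroup of exponents to the multiplicative monoid of the field are points
  of the toric surface, and derivations along such a homomorphism are tangent vectors at it.\<close>

definition character :: "(int \<times> int) set \<Rightarrow> (int \<times> int \<Rightarrow> 'k::comm_ring_1) \<Rightarrow> bool" where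
  "character S e \<longleftrightarrow> e 0 = 1 \<and> (\<forall>x\<in>S. \<forall>y\<in>S. e (x + y) = e x * e y)"

definition derivation :: "(int \<times> int) set \<Rightarrow> (int \<times> int \<Rightarrow> 'k::comm_ring_1) \<Rightarrow> (int \<times> int \<Rightarrow> 'k) \<Rightarrow> bool" where
  "derivation S e E \<longleftrightarrow> E 0 = 0 \<and> (\<forall>x\<in>S. \<forall>y\<in>S. E (x + y) = E x * e y + e x * E y)"

lemma expdeg_in_mon:
  fixes c :: "'v::finite \<Rightarrow> 'k::field"
  shows "mval m (vec_lambda c) \<noteq> 0 \<Longrightarrow> expdeg \<delta> m \<in> mon (expos c \<delta>)"
  by (induction m rule: expo_induct)
     (auto simp: mval_add expdeg_add expos_def intro: mon_0 mon_add mon_base)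

lemma mval_character:
  fixes c :: "'v::finite \<Rightarrow> 'k::field"
  assumes "character (mon (expos c \<delta>)) e"
  shows "mval m (\<chi> k. c k * e (\<delta> k)) = mval m (vec_lambda c) * e (expdeg \<delta> m)"
proof (induction m rule: expo_induct)
  case zero
  then show ?case using assms by (simp add: character_def)
next
  case (step m i)
  show ?case
  proof (cases "mval m (vec_lambda c) = 0 \<or> c i = 0")
    case False
    then have "expdeg \<delta> m \<in> mon (expos c \<delta>)" "\<delta> i \<in> mon (expos c \<delta>)"
      using expdeg_in_mon[of m c \<delta>] mon_base[of "\<delta> i" "expos c \<delta>"] by (auto simp: expos_def)
    then show ?thesis using step assms by (simp add: mval_add expdeg_add character_def)
  qed (use step in \<open>auto simp: mval_add\<close>)
qed

lemma dmval_derivation: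
  fixes c :: "'v::finite \<Rightarrow> 'k::field"
  assumes e: "character (mon (expos c \<delta>)) e" and E: "derivation (mon (expos c \<delta>)) e E"
  shows "dmval m (\<chi> k. c k * e (\<delta> k)) (\<chi> k. c k * E (\<delta> k)) = mval m (vec_lambda c) * E (expdeg \<delta> m)"
proof (induction m rule: expo_induct)
  case zero
  then show ?case using assms by (simp add: derivation_def)
next
  case (step m i)
  show ?case
  proof (cases "mval m (vec_lambda c) = 0 \<or> c i = 0")
    case False
    then have "expdeg \<delta> m \<in> mon (expos c \<delta>)" "\<delta> i \<in> mon (expos c \<delta>)"
      using expdeg_in_mon[of m c \<delta>] mon_base[of "\<delta> i" "expos c \<delta>"] by (auto simp: expos_def)
    then have "E (expdeg \<delta> m + \<delta> i) = E (expdeg \<delta> m) * e (\<delta> i) + e (expdeg \<delta> m) * E (\<delta> i)"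
      using E by (simp add: derivation_def)
    then show ?thesis
      using step by (simp add: mval_add dmval_add expdeg_add mval_character[OF e] algebra_simps)
  qed (use step in \<open>auto simp: mval_add dmval_add mval_character[OF e]\<close>)
qed

lemma character_point_in_toric:
  fixes c :: "'v::finite \<Rightarrow> 'k::field_char_0"
  assumes "character (mon (expos c \<delta>)) e"
  shows "(\<chi> k. c k * e (\<delta> k)) \<in> toric c \<delta>"
  unfolding toric_def zclosure_def zero_set_def
  by (auto simp: evalp_eq_lfun intro!: lfun_eq_0_on_ideal[where \<Psi> = e] mval_character assms)

lemma derivation_in_tangent_space:
  fixes c :: "'v::finite \<Rightarrow> 'k::field_char_0"
  assumes "character (mon (expos c \<delta>)) e" "derivation (mon (expos c \<delta>)) e E"
  shows "(\<chi> k. c k * E (\<delta> k)) \<in> tangent_space (toric c \<delta>) (\<chi> k. c k * e (\<delta> k))"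
  unfolding tangent_space_eq toric_def
  by (auto simp: dirderiv_eq_lfun intro!: lfun_eq_0_on_ideal[where \<Psi> = E] dmval_derivation assms)

section \<open>Irreducibility and dimension\<close>

lemma irreducible_zclosureI:
  assumes "T \<noteq> {}"
    and "\<And>f g. (\<And>x. x \<in> T \<Longrightarrow> evalp f x * evalp g x = 0) \<Longrightarrow> (\<forall>x\<in>T. evalp f x = 0) \<or> (\<forall>x\<in>T. evalp g x = 0)"
  shows "irreducible_algebraic_set (zclosure T)"
  unfolding irreducible_algebraic_set_def
proof (intro conjI allI impI)
  show "zclosure T \<noteq> {}" using assms(1) subset_zclosure by fastforce
  fix A B assume "algebraic_set A \<and> algebraic_set B \<and> zclosure T \<subseteq> A \<union> B"
  then have A: "algebraic_set A" and B: "algebraic_set B" and AB: "T \<subseteq> A \<union> B"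
    using subset_zclosure by blast+
  show "zclosure T \<subseteq> A \<or> zclosure T \<subseteq> B"
  proof (rule ccontr)
    assume "\<not> ?thesis"
    then have "\<not> T \<subseteq> A" "\<not> T \<subseteq> B" using A B zclosure_minimal by blast+
    moreover have "\<exists>f x. (\<forall>x\<in>A. evalp f x = 0) \<and> x \<in> T \<and> evalp f x \<noteq> 0"
      if "algebraic_set A" "\<not> T \<subseteq> A" for A
      using that by (auto simp: algebraic_set_def zero_set_def)
    ultimately obtain f g x y where f: "\<forall>x\<in>A. evalp f x = 0" "x \<in> T" "evalp f x \<noteq> 0"
      and g: "\<forall>x\<in>B. evalp g x = 0" "y \<in> T" "evalp g y \<noteq> 0"
      using A B by metis
    have "evalp f z * evalp g z = 0" if "z \<in> T" for z using that AB f g by auto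
    then show False using assms(2)[of f g] f g by blast
  qed
qed simp

text \<open>On a line in the space of parameters \<open>(s, t)\<close>, polynomial functions on the orbit become
  univariate polynomials after multiplication by a power of \<open>s t\<close>.\<close>

lemma evalp_pt_line:
  fixes c :: "'v::finite \<Rightarrow> 'k::field"
  shows "\<exists>N P. \<forall>z. poly S z \<noteq> 0 \<and> poly T z \<noteq> 0 \<longrightarrow>
      poly P z = (poly S z * poly T z) ^ N * evalp f (pt c \<delta> (poly S z) (poly T z))"
proof (induction f rule: poly_fun_induct)
  case (Cst a)
  show ?case by (rule exI[of _ 0], rule exI[of _ "[:a:]"]) simp
next
  case (Var i)
  define N where "N = nat \<bar>fst (\<delta> i)\<bar> + nat \<bar>snd (\<delta> i)\<bar>"
  have *: "x powi n * x ^ N = x ^ nat (n + int N)" if "x \<noteq> 0" "n + int N \<ge> 0" for x :: 'k and n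
    using that by (metis nat_0_le power_int_add power_int_of_nat)
  show ?case
  proof (rule exI[of _ N], rule exI[of _ "[:c i:] * S ^ nat (fst (\<delta> i) + int N) * T ^ nat (snd (\<delta> i) + int N)"], intro allI impI)
    fix z assume "poly S z \<noteq> 0 \<and> poly T z \<noteq> 0"
    then have "poly S z powi fst (\<delta> i) * poly S z ^ N = poly S z ^ nat (fst (\<delta> i) + int N)"
      "poly T z powi snd (\<delta> i) * poly T z ^ N = poly T z ^ nat (snd (\<delta> i) + int N)"
      by (intro *; simp add: N_def)+
    note this[symmetric]
    then show "poly ([:c i:] * S ^ nat (fst (\<delta> i) + int N) * T ^ nat (snd (\<delta> i) + int N)) z =
         (poly S z * poly T z) ^ N * evalp (Var i) (pt c \<delta> (poly S z) (poly T z))"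
      by (simp add: pt_def lmon_def poly_power power_mult_distrib)
  qed
next
  case (add f g)
  then obtain N P N' P' where
    "\<And>z. poly S z \<noteq> 0 \<and> poly T z \<noteq> 0 \<Longrightarrow> poly P z = (poly S z * poly T z) ^ N * evalp f (pt c \<delta> (poly S z) (poly T z))"
    "\<And>z. poly S z \<noteq> 0 \<and> poly T z \<noteq> 0 \<Longrightarrow> poly P' z = (poly S z * poly T z) ^ N' * evalp g (pt c \<delta> (poly S z) (poly T z))"
    by blast
  then show ?case
    by (intro exI[of _ "N + N'"] exI[of _ "P * (S * T) ^ N' + P' * (S * T) ^ N"])
       (simp add: poly_power power_add algebra_simps)
next
  case (mult f g)
  then obtain N P N' P' where
    "\<And>z. poly S z \<noteq> 0 \<and> poly T z \<noteq> 0 \<Longrightarrow> poly P z = (poly S z * poly T z) ^ N * evalp f (pt c \<delta> (poly S z) (poly T z))"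
    "\<And>z. poly S z \<noteq> 0 \<and> poly T z \<noteq> 0 \<Longrightarrow> poly P' z = (poly S z * poly T z) ^ N' * evalp g (pt c \<delta> (poly S z) (poly T z))"
    by blast
  then show ?case
    by (intro exI[of _ "N + N'"] exI[of _ "P * P'"])
       (simp add: poly_power power_add algebra_simps)
qed

text \<open>If neither \<open>f\<close> nor \<open>g\<close> vanishes on the orbit, join a point where \<open>f\<close> is nonzero to one where \<open>g\<close> is
  nonzero by a line; the product of the two restrictions is a nonzero polynomial.\<close>

lemma irreducible_toric:
  fixes c :: "'v::finite \<Rightarrow> 'k::field_char_0"
  shows "irreducible_algebraic_set (toric c \<delta>)"
  unfolding toric_def
proof (rule irreducible_zclosureI)
  have "pt c \<delta> 1 1 \<in> orbit c \<delta>" by (auto simp: orbit_def intro!: exI[of _ 1])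
  then show "orbit c \<delta> \<noteq> {}" by blast
next
  fix f g :: "('v, 'k) mpoly"
  assume fg: "\<And>x. x \<in> orbit c \<delta> \<Longrightarrow> evalp f x * evalp g x = 0"
  show "(\<forall>x\<in>orbit c \<delta>. evalp f x = 0) \<or> (\<forall>x\<in>orbit c \<delta>. evalp g x = 0)"
  proof (rule ccontr)
    assume "\<not> ?thesis"
    then obtain s0 t0 s1 t1 where nz: "s0 \<noteq> 0" "t0 \<noteq> 0" "s1 \<noteq> 0" "t1 \<noteq> 0"
      and f: "evalp f (pt c \<delta> s0 t0) \<noteq> 0" and g: "evalp g (pt c \<delta> s1 t1) \<noteq> 0"
      unfolding orbit_def by blast
    define S T where "S = [:s0, s1 - s0:]" and "T = [:t0, t1 - t0:]"
    obtain N P where P: "\<And>z. poly S z \<noteq> 0 \<Longrightarrow> poly T z \<noteq> 0 \<Longrightarrow>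
        poly P z = (poly S z * poly T z) ^ N * evalp f (pt c \<delta> (poly S z) (poly T z))"
      using evalp_pt_line by blast
    obtain M Q where Q: "\<And>z. poly S z \<noteq> 0 \<Longrightarrow> poly T z \<noteq> 0 \<Longrightarrow>
        poly Q z = (poly S z * poly T z) ^ M * evalp g (pt c \<delta> (poly S z) (poly T z))"
      using evalp_pt_line by blast
    have "poly P 0 \<noteq> 0" using P[of 0] nz f by (simp add: S_def T_def)
    moreover have "poly Q 1 \<noteq> 0" using Q[of 1] nz g by (simp add: S_def T_def)
    moreover have "poly S 0 \<noteq> 0" "poly T 0 \<noteq> 0" using nz by (simp_all add: S_def T_def)
    ultimately have "P * Q * S * T \<noteq> 0" by auto
    then have "finite {z. poly (P * Q * S * T) z = 0}" by (rule poly_roots_finite)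
    then obtain z where z: "poly (P * Q * S * T) z \<noteq> 0"
      using infinite_UNIV_char_0[where 'a = 'k] by (metis (mono_tags, lifting) UNIV_eq_I mem_Collect_eq)
    then have "evalp f (pt c \<delta> (poly S z) (poly T z)) \<noteq> 0" "evalp g (pt c \<delta> (poly S z) (poly T z)) \<noteq> 0"
      using P[of z] Q[of z] by auto
    moreover have "pt c \<delta> (poly S z) (poly T z) \<in> orbit c \<delta>" using z by (auto simp: orbit_def)
    ultimately show False using fg by fastforce
  qed
qed

lemma irreducible_prime:
  assumes "irreducible_algebraic_set Z" "f * g \<in> vanishing_ideal Z"
  shows "f \<in> vanishing_ideal Z \<or> g \<in> vanishing_ideal (Z :: ('k::field ^ 'v::finite) set)"
proof -
  have "Z \<subseteq> zero_set {f} \<union> zero_set {g}"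
    using assms(2) by (auto simp: vanishing_ideal_def zero_set_def)
  then have "Z \<subseteq> zero_set {f} \<or> Z \<subseteq> zero_set {g}"
    using assms(1) by (auto simp: irreducible_algebraic_set_def)
  then show ?thesis by (auto simp: vanishing_ideal_def zero_set_def)
qed

definition indep_on :: "('k::field ^ 'v::finite) set \<Rightarrow> 'j set \<Rightarrow> ('j \<Rightarrow> ('v, 'k) mpoly) \<Rightarrow> bool" where
  "indep_on Z J h \<longleftrightarrow> (\<forall>\<kappa>. (\<Sum>j\<in>J. Cst (\<kappa> j) * h j) \<in> vanishing_ideal Z \<longrightarrow> (\<forall>j\<in>J. \<kappa> j = 0))"

text \<open>If \<open>f\<close> vanishes on \<open>Z\<close> but not on the larger irreducible set \<open>Z'\<close>, then its powers are new on \<open>Z'\<close>: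
  on \<open>Z\<close> only the terms of a relation without \<open>f\<close> survive, so their coefficients vanish, and then a
  factor \<open>f\<close> can be cancelled on \<open>Z'\<close>. Along a chain of irreducible sets this produces
  algebraically independent functions.\<close>

lemma indep_on_extend:
  assumes ind: "indep_on Z J h" and J: "finite J"
    and Z': "irreducible_algebraic_set Z'" "Z \<subseteq> Z'"
    and f: "f \<in> vanishing_ideal Z" "f \<notin> vanishing_ideal Z'"
  shows "indep_on Z' (J \<times> {..N}) (\<lambda>(j, n). h j * f ^ n)"
proof (induction N)
  case 0
  show ?case unfolding indep_on_def
  proof (intro allI impI)
    fix \<kappa> assume "(\<Sum>j\<in>J \<times> {..0::nat}. Cst (\<kappa> j) * (case j of (j, n) \<Rightarrow> h j * f ^ n)) \<in> vanishing_ideal Z'"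
    moreover have "J \<times> {..0::nat} = (\<lambda>j. (j, 0)) ` J" by auto
    ultimately have "(\<Sum>j\<in>J. Cst (\<kappa> (j, 0)) * h j) \<in> vanishing_ideal Z"
      using Z' by (auto simp: vanishing_ideal_def sum.reindex inj_on_def)
    then show "\<forall>j\<in>J \<times> {..0}. \<kappa> j = 0" using ind[unfolded indep_on_def, rule_format, of "\<lambda>j. \<kappa> (j, 0)"] by auto
  qed
next
  case (Suc N)
  show ?case unfolding indep_on_def
  proof (intro allI impI)
    fix \<kappa> :: "_ \<times> nat \<Rightarrow> _"
    let ?F = "\<Sum>j\<in>J \<times> {..Suc N}. Cst (\<kappa> j) * (case j of (j, n) \<Rightarrow> h j * f ^ n)"
    let ?G = "\<Sum>j\<in>J \<times> {..N}. Cst (\<kappa> (fst j, Suc (snd j))) * (case j of (j, n) \<Rightarrow> h j * f ^ n)"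
    assume F: "?F \<in> vanishing_ideal Z'"
    have eq: "?F = (\<Sum>j\<in>J. Cst (\<kappa> (j, 0)) * h j) + f * ?G"
    proof -
      have "?F = (\<Sum>j\<in>J. \<Sum>n\<le>Suc N. Cst (\<kappa> (j, n)) * (h j * f ^ n))"
        unfolding sum.cartesian_product by (simp add: split_def)
      also have "\<dots> = (\<Sum>j\<in>J. Cst (\<kappa> (j, 0)) * h j + (\<Sum>n\<le>N. Cst (\<kappa> (j, Suc n)) * (h j * f ^ Suc n)))"
        by (simp only: sum.atMost_Suc_shift power_0 mult_1_right)
      also have "\<dots> = (\<Sum>j\<in>J. Cst (\<kappa> (j, 0)) * h j) + (\<Sum>j\<in>J. \<Sum>n\<le>N. f * (Cst (\<kappa> (j, Suc n)) * (h j * f ^ n)))"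
        by (simp add: sum.distrib mult_ac)
      also have "(\<Sum>j\<in>J. \<Sum>n\<le>N. f * (Cst (\<kappa> (j, Suc n)) * (h j * f ^ n))) = f * ?G"
        by (simp add: sum.cartesian_product split_def sum_distrib_left)
      finally show ?thesis .
    qed
    have "(\<Sum>j\<in>J. Cst (\<kappa> (j, 0)) * h j) \<in> vanishing_ideal Z"
      unfolding vanishing_ideal_def
    proof (intro CollectI ballI)
      fix x assume x: "x \<in> Z"
      then have "evalp ?F x = 0" "evalp f x = 0"
        using F f(1) Z'(2) by (auto simp: vanishing_ideal_def simp del: evalp_sum)
      then show "evalp (\<Sum>j\<in>J. Cst (\<kappa> (j, 0)) * h j) x = 0"
        unfolding eq evalp_add evalp_mult by simp
    qed
    then have 0: "\<kappa> (j, 0) = 0" if "j \<in> J" for j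
      using ind[unfolded indep_on_def, rule_format, of "\<lambda>j. \<kappa> (j, 0)"] that by auto
    then have "?F = f * ?G" unfolding eq by simp
    with F have "f * ?G \<in> vanishing_ideal Z'" by (simp only:)
    then have "?G \<in> vanishing_ideal Z'" using irreducible_prime[OF Z'(1)] f(2) by blast
    then have "\<kappa> (j, Suc n) = 0" if "j \<in> J" "n \<le> N" for j n
      using Suc[unfolded indep_on_def, rule_format, of "\<lambda>j. \<kappa> (fst j, Suc (snd j))" "(j, n)"] that by auto
    with 0 show "\<forall>j\<in>J \<times> {..Suc N}. \<kappa> j = 0"
      by (auto simp: not0_implies_Suc) (metis Suc_le_mono not0_implies_Suc)
  qed
qed

text \<open>Gaussian elimination, one unknown and one equation at a time.\<close>

lemma more_unknowns_than_equations:
  fixes M :: "'i \<Rightarrow> 'j \<Rightarrow> 'k::field"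
  assumes "finite I" "finite V" "card I < card V"
  shows "\<exists>\<kappa>. (\<exists>v\<in>V. \<kappa> v \<noteq> 0) \<and> (\<forall>i\<in>I. (\<Sum>v\<in>V. \<kappa> v * M i v) = 0)"
  using assms
proof (induction I arbitrary: V M rule: finite_induct)
  case empty
  then have "V \<noteq> {}" by auto
  then show ?case by (auto intro!: exI[of _ "\<lambda>_. 1"])
next
  case (insert i I)
  show ?case
  proof (cases "\<forall>v\<in>V. M i v = 0")
    case True
    obtain \<kappa> where "\<exists>v\<in>V. \<kappa> v \<noteq> 0" "\<forall>i\<in>I. (\<Sum>v\<in>V. \<kappa> v * M i v) = 0"
      using insert.IH[of V M] insert.prems insert.hyps by auto
    then show ?thesis using True by (intro exI[of _ \<kappa>]) auto
  next
    case False
    then obtain u where u: "u \<in> V" "M i u \<noteq> 0" by blast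
    let ?V = "V - {u}"
    have "card I < card ?V" using insert u by simp
    then obtain \<kappa> where \<kappa>: "\<exists>v\<in>?V. \<kappa> v \<noteq> 0"
      "\<And>j. j \<in> I \<Longrightarrow> (\<Sum>v\<in>?V. \<kappa> v * (M j v - M j u * M i v / M i u)) = 0"
      using insert.IH[of ?V "\<lambda>j v. M j v - M j u * M i v / M i u"] insert.prems by blast
    define \<kappa>u where "\<kappa>u = - (\<Sum>v\<in>?V. \<kappa> v * M i v) / M i u"
    define \<kappa>' where "\<kappa>' = \<kappa>(u := \<kappa>u)"
    have split: "(\<Sum>v\<in>V. \<kappa>' v * M j v) = \<kappa>u * M j u + (\<Sum>v\<in>?V. \<kappa> v * M j v)" for j
      using u(1) insert.prems by (simp add: sum.remove[of V u] \<kappa>'_def)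
    have "(\<Sum>v\<in>V. \<kappa>' v * M j v) = 0" if "j \<in> insert i I" for j
    proof (cases "j = i")
      case True
      then show ?thesis using u by (simp add: split \<kappa>u_def)
    next
      case False
      then have "0 = (\<Sum>v\<in>?V. \<kappa> v * (M j v - M j u * M i v / M i u))" using that \<kappa> by simp
      also have "\<dots> = (\<Sum>v\<in>?V. \<kappa> v * M j v) - (\<Sum>v\<in>?V. \<kappa> v * M i v) * M j u / M i u"
        by (simp add: algebra_simps sum_subtractf sum_distrib_left sum_divide_distrib)
      finally show ?thesis using u by (simp add: split \<kappa>u_def field_simps)
    qed
    moreover have "\<exists>v\<in>V. \<kappa>' v \<noteq> 0" using \<kappa>(1) by (auto simp: \<kappa>'_def)
    ultimately show ?thesis by blast
  qed
qed

text \<open>A bound for the exponents on the torus. It is additive in products, so that products with at most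
  \<open>N\<close> factors from a finite set live in a space of dimension \<open>O(N\<^sup>2)\<close>.\<close>

definition box_bounded :: "('v::finite \<Rightarrow> int \<times> int) \<Rightarrow> nat \<Rightarrow> ('v, 'k::comm_ring_1) mpoly \<Rightarrow> bool" where
  "box_bounded \<delta> D p \<longleftrightarrow> expdeg \<delta> ` Poly_Mapping.keys p \<subseteq> {- int D..int D} \<times> {- int D..int D}"

lemma box_bounded_ex: "\<exists>D. box_bounded \<delta> D p"
proof -
  define D where "D = (\<Sum>m\<in>Poly_Mapping.keys p. nat \<bar>fst (expdeg \<delta> m)\<bar> + nat \<bar>snd (expdeg \<delta> m)\<bar>)"
  have "\<bar>fst (expdeg \<delta> m)\<bar> \<le> int D \<and> \<bar>snd (expdeg \<delta> m)\<bar> \<le> int D" if "m \<in> Poly_Mapping.keys p" for m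
  proof -
    have "nat \<bar>fst (expdeg \<delta> m)\<bar> + nat \<bar>snd (expdeg \<delta> m)\<bar> \<le> D"
      unfolding D_def using that by (intro member_le_sum) auto
    then show ?thesis by linarith
  qed
  then have "box_bounded \<delta> D p"
    unfolding box_bounded_def image_subset_iff mem_Times_iff atLeastAtMost_iff by fastforce
  then show ?thesis ..
qed

lemma box_bounded_mono: "box_bounded \<delta> D p \<Longrightarrow> D \<le> D' \<Longrightarrow> box_bounded \<delta> D' p"
  unfolding box_bounded_def by (fastforce simp: mem_Times_iff)

lemma box_bounded_mult:
  assumes "box_bounded \<delta> D p" "box_bounded \<delta> D' q"
  shows "box_bounded \<delta> (D + D') (p * q)"
  unfolding box_bounded_def
proof
  fix d assume "d \<in> expdeg \<delta> ` Poly_Mapping.keys (p * q)"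
  then obtain m n where "d = expdeg \<delta> m + expdeg \<delta> n" "m \<in> Poly_Mapping.keys p" "n \<in> Poly_Mapping.keys q"
    using keys_mult[of p q] by (auto simp: expdeg_add)
  moreover from this have "expdeg \<delta> m \<in> {- int D..int D} \<times> {- int D..int D}"
    "expdeg \<delta> n \<in> {- int D'..int D'} \<times> {- int D'..int D'}"
    using assms by (auto simp: box_bounded_def)
  ultimately show "d \<in> {- int (D + D')..int (D + D')} \<times> {- int (D + D')..int (D + D')}"
    by (auto simp: mem_Times_iff)
qed

lemma box_bounded_power: "box_bounded \<delta> D p \<Longrightarrow> box_bounded \<delta> (n * D) (p ^ n)"
proof (induction n)
  case 0
  have "Poly_Mapping.keys (1 :: ('a, 'b) mpoly) \<subseteq> {0}"
    by (metis empty_subsetI keys_single single_one subset_refl)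
  then show ?case by (auto simp: box_bounded_def zero_prod_def)
next
  case (Suc n)
  then show ?case using box_bounded_mult[of \<delta> D p "n * D" "p ^ n"] by simp
qed

lemma hcoeff_lincomb:
  fixes c :: "'v::finite \<Rightarrow> 'k::field"
  shows "hcoeff c \<delta> d (\<Sum>j\<in>J. Cst (\<kappa> j) * h j) = (\<Sum>j\<in>J. \<kappa> j * hcoeff c \<delta> d (h j))"
proof -
  have "lfun \<Phi> (Cst a * p) = a * lfun \<Phi> p" for \<Phi> a and p :: "('v, 'k) mpoly"
    by (induction p rule: mpoly_induct) (auto simp: lfun_add distrib_left mult_single algebra_simps)
  then show ?thesis by (simp add: hcoeff_def lfun_sum)
qed

text \<open>A chain of length three would give three algebraically independent functions on the orbit. But
  their \<open>(N + 1)\<^sup>3\<close> monomials of degree at most \<open>N\<close> in each of them lie in a space of dimension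
  \<open>O(N\<^sup>2)\<close>.\<close>

lemma irreducible_chain_toric_le:
  fixes c :: "'v::finite \<Rightarrow> 'k::field_char_0"
  assumes "irreducible_chain (toric c \<delta>) n Z"
  shows "n \<le> 2"
proof (rule ccontr)
  assume n: "\<not> n \<le> 2"
  have irr: "irreducible_algebraic_set (Z i)" and sub: "Z i \<subseteq> toric c \<delta>" if "i \<le> 3" for i
    using assms n that by (auto simp: irreducible_chain_def)
  have "\<exists>f. f \<in> vanishing_ideal (Z i) \<and> f \<notin> vanishing_ideal (Z (Suc i)) \<and> Z i \<subseteq> Z (Suc i)" if "i < 3" for i
  proof -
    note i = that
    have "Z i \<subset> Z (Suc i)" using assms n that by (auto simp: irreducible_chain_def)
    moreover obtain S where "Z i = zero_set S"
      using irr[OF less_imp_le[OF i]] by (auto simp: irreducible_algebraic_set_def algebraic_set_def)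
    ultimately show ?thesis by (auto simp: zero_set_def vanishing_ideal_def)
  qed
  then obtain f where f: "\<And>i. i < 3 \<Longrightarrow> f i \<in> vanishing_ideal (Z i)"
    "\<And>i. i < 3 \<Longrightarrow> f i \<notin> vanishing_ideal (Z (Suc i))" and Z: "\<And>i. i < 3 \<Longrightarrow> Z i \<subseteq> Z (Suc i)"
    by metis
  obtain D0 D1 D2 where "box_bounded \<delta> D0 (f 0)" "box_bounded \<delta> D1 (f 1)" "box_bounded \<delta> D2 (f 2)"
    using box_bounded_ex by metis
  define D where "D = D0 + D1 + D2"
  \<comment> \<open>This makes \<open>(2 N D + 1)\<^sup>2 < (N + 1)\<^sup>3\<close>.\<close>
  define N where "N = (2 * D + 1) ^ 2"
  define J where "J = (({()} \<times> {..N}) \<times> {..N}) \<times> {..N}"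
  define h :: "((unit \<times> nat) \<times> nat) \<times> nat \<Rightarrow> ('v, 'k) mpoly"
    where "h = (\<lambda>(j, n). (\<lambda>(j, n). (\<lambda>(j, n). 1 * f 0 ^ n) j * f 1 ^ n) j * f 2 ^ n)"
  have *: "Z 1 \<subseteq> Z 2" "Z 2 \<subseteq> Z 3" "f 1 \<notin> vanishing_ideal (Z 2)" "f 2 \<notin> vanishing_ideal (Z 3)"
    using Z[of 1] Z[of 2] f(2)[of 1] f(2)[of 2] by (simp_all add: numeral_2_eq_2 numeral_3_eq_3)
  have "indep_on (Z 0) {()} (\<lambda>_. 1)"
    using irr[of 0] by (auto simp: indep_on_def vanishing_ideal_def irreducible_algebraic_set_def)
  then have "indep_on (Z 1) ({()} \<times> {..N}) (\<lambda>(j, n). 1 * f 0 ^ n)"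
    by (rule indep_on_extend) (use f[of 0] Z[of 0] irr[of 1] in auto)
  then have "indep_on (Z 2) (({()} \<times> {..N}) \<times> {..N}) (\<lambda>(j, n). (\<lambda>(j, n). 1 * f 0 ^ n) j * f 1 ^ n)"
    by (rule indep_on_extend) (use f(1)[of 1] * irr[of 2] in auto)
  then have ind: "indep_on (Z 3) J h" unfolding J_def h_def
    by (rule indep_on_extend) (use f(1)[of 2] * irr[of 3] in auto)
  let ?B = "{- int (N * D)..int (N * D)} \<times> {- int (N * D)..int (N * D)}"
  have bd: "box_bounded \<delta> (N * D) (h j)" if "j \<in> J" for j
  proof -
    note jJ = that
    obtain a b d where j: "j = ((((), a), b), d)" "a \<le> N" "b \<le> N" "d \<le> N"
      using jJ by (auto simp: J_def)
    have "box_bounded \<delta> (a * D0 + b * D1 + d * D2) (f 0 ^ a * f 1 ^ b * f 2 ^ d)"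
      by (intro box_bounded_mult box_bounded_power) fact+
    moreover have "a * D0 + b * D1 + d * D2 \<le> N * D"
      using j by (simp add: D_def distrib_left add_mono mult_le_mono1)
    ultimately show ?thesis using box_bounded_mono j by (simp add: h_def)
  qed
  have cB: "card ?B = (2 * (N * D) + 1) ^ 2"
    by (simp add: card_cartesian_product power2_eq_square algebra_simps nat_add_distrib nat_mult_distrib)
  have cJ: "card J = (N + 1) ^ 3"
    by (simp add: J_def card_cartesian_product power3_eq_cube)
  have "2 * (N * D) + 1 \<le> (2 * D + 1) * (N + 1)" by (simp add: algebra_simps)
  then have "card ?B \<le> ((2 * D + 1) * (N + 1)) ^ 2" unfolding cB by (rule power_mono) simp
  also have "\<dots> = N * (N + 1) ^ 2" unfolding power_mult_distrib N_def ..
  also have "\<dots> < card J" unfolding cJ by (simp add: power2_eq_square power3_eq_cube)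
  finally have "card ?B < card J" .
  then obtain \<kappa> where \<kappa>: "\<exists>j\<in>J. \<kappa> j \<noteq> 0" "\<And>d. d \<in> ?B \<Longrightarrow> (\<Sum>j\<in>J. \<kappa> j * hcoeff c \<delta> d (h j)) = 0"
    using more_unknowns_than_equations[of ?B J "\<lambda>d j. hcoeff c \<delta> d (h j)"] by (auto simp: J_def)
  let ?P = "\<Sum>j\<in>J. Cst (\<kappa> j) * h j"
  have "hcoeff c \<delta> d ?P = 0" for d
  proof (cases "d \<in> ?B")
    case False
    then have "hcoeff c \<delta> d (h j) = 0" if "j \<in> J" for j
      using bd[OF that] by (intro hcoeff_outside) (auto simp: box_bounded_def)
    then show ?thesis by (simp add: hcoeff_lincomb)
  qed (simp add: hcoeff_lincomb \<kappa>)
  then have "?P \<in> vanishing_ideal (toric c \<delta>)"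
    by (simp add: toric_def vanishing_ideal_orbit_iff)
  then have "?P \<in> vanishing_ideal (Z 3)" using sub[of 3] unfolding vanishing_ideal_def by blast
  then show False using ind \<kappa>(1) by (auto simp: indep_on_def)
qed

lemma local_dim_toric_le:
  fixes c :: "'v::finite \<Rightarrow> 'k::field_char_0"
  shows "local_dim (toric c \<delta>) q \<le> 2"
proof -
  let ?S = "{n. \<exists>Z. irreducible_chain (toric c \<delta>) n Z \<and> q \<in> Z 0}"
  have "n \<le> 2" if "n \<in> ?S" for n using that irreducible_chain_toric_le by auto
  then show ?thesis unfolding local_dim_def
    by (metis (no_types, lifting) Sup_nat_empty cSup_least zero_le)
qed

lemma local_dim_toric_eq:
  fixes c :: "'v::finite \<Rightarrow> 'k::field_char_0"
  assumes "irreducible_chain (toric c \<delta>) 2 Z" "q \<in> Z 0"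
  shows "local_dim (toric c \<delta>) q = 2"
  unfolding local_dim_def using assms irreducible_chain_toric_le[of c \<delta>]
  by (intro cSup_eq_maximum) auto

lemma alg_dim_toric_eq:
  fixes c :: "'v::finite \<Rightarrow> 'k::field_char_0"
  assumes "irreducible_chain (toric c \<delta>) 2 Z"
  shows "alg_dim (toric c \<delta>) = 2"
  unfolding alg_dim_def using assms irreducible_chain_toric_le[of c \<delta>]
  by (intro cSup_eq_maximum) auto

section \<open>Smooth and singular points of toric surfaces\<close>

definition cr :: "int \<times> int \<Rightarrow> int \<times> int \<Rightarrow> int" where
  "cr x y = fst x * snd y - snd x * fst y"

lemma cr_add: "cr (x + y) z = cr x z + cr y z" "cr z (x + y) = cr z x + cr z y"
  and cr_diff: "cr (x - y) z = cr x z - cr y z" "cr z (x - y) = cr z x - cr z y"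
  and cr_self [simp]: "cr x x = 0" and cr_0 [simp]: "cr 0 x = 0" "cr x 0 = 0"
  by (simp_all add: cr_def algebra_simps)

text \<open>The law of exponents survives at \<open>0\<close> as long as no exponent is negative; so characters may vanish
  on the boundary of the torus.\<close>

lemma power_int_add_nonneg:
  fixes x :: "'k::field"
  assumes "x \<noteq> 0 \<or> (0 \<le> a \<and> 0 \<le> b)"
  shows "x powi (a + b) = x powi a * x powi b"
  using assms by (cases "x = 0") (auto simp: power_int_add power_int_0_left_if)

lemma power_int_diff_one_mult:
  fixes x :: "'k::field"
  assumes "x \<noteq> 0 \<or> (0 \<le> a \<and> 0 \<le> b)"
  shows "of_int (a + b) * x powi (a + b - 1) = of_int a * x powi (a - 1) * x powi b + x powi a * (of_int b * x powi (b - 1))"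
proof -
  have 1: "of_int a * x powi (a + b - 1) = of_int a * x powi (a - 1) * x powi b"
    using assms power_int_add_nonneg[of x "a - 1" b] by (cases "a = 0") (auto simp: algebra_simps)
  have 2: "of_int b * x powi (a + b - 1) = of_int b * x powi a * x powi (b - 1)"
    using assms power_int_add_nonneg[of x a "b - 1"] by (cases "b = 0") (auto simp: algebra_simps)
  show ?thesis unfolding of_int_add distrib_right 1 2 by (simp only: mult_ac)
qed

lemma independent_by_coordinates:
  fixes W :: "'j \<Rightarrow> 'k::field ^ 'v::finite"
  assumes "finite J" and diag: "\<And>i. i \<in> J \<Longrightarrow> W i $ \<kappa> i \<noteq> 0"
    and off: "\<And>i j. i \<in> J \<Longrightarrow> j \<in> J \<Longrightarrow> i \<noteq> j \<Longrightarrow> W i $ \<kappa> j = 0"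
  shows "vec.independent (W ` J)" and "card (W ` J) = card J"
proof -
  have inj: "inj_on W J" using diag off by (metis inj_onI)
  then show "card (W ` J) = card J" by (rule card_image)
  show "vec.independent (W ` J)"
  proof (rule vec.independent_if_scalars_zero)
    fix f x assume s: "(\<Sum>x\<in>W ` J. f x *s x) = 0" and "x \<in> W ` J"
    then obtain j where j: "j \<in> J" "x = W j" by blast
    have "(\<Sum>i\<in>J. f (W i) *s W i) = 0" using s inj by (simp add: sum.reindex)
    then have "(\<Sum>i\<in>J. f (W i) *s W i) $ \<kappa> j = 0" by simp
    then have "0 = (\<Sum>i\<in>J. f (W i) * W i $ \<kappa> j)" by simp
    also have "\<dots> = (\<Sum>i\<in>J. if i = j then f (W j) * W j $ \<kappa> j else 0)"
      using off j by (intro sum.cong) auto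
    also have "\<dots> = f (W j) * W j $ \<kappa> j" using assms(1) j by simp
    finally show "f x = 0" using diag j by simp
  qed (use assms in simp)
qed

text \<open>Suppose that the exponents of the coordinates \<open>u, v\<close> form a basis of the lattice. At a point where
  \<open>q\<^sub>u \<noteq> 0\<close> or all exponents have nonnegative first coordinate in this basis, and likewise for \<open>v\<close>,
  the surface is the graph of \<open>q\<^sub>k = c\<^sub>k s\<^sup>A t\<^sup>B\<close> with \<open>s = q\<^sub>u / c\<^sub>u\<close> and \<open>t = q\<^sub>v / c\<^sub>v\<close>, hence
  smooth. Such pairs \<open>(s, t)\<close> are called admissible.\<close>

locale frame =
  fixes c :: "'v::finite \<Rightarrow> 'k::field_char_0" and \<delta> :: "'v \<Rightarrow> int \<times> int" and u v :: 'v and \<epsilon> :: int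
  assumes det: "cr (\<delta> u) (\<delta> v) = \<epsilon>" and eps: "\<epsilon> * \<epsilon> = 1" and cu: "c u \<noteq> 0" and cv: "c v \<noteq> 0"
begin

definition A where "A d = \<epsilon> * cr d (\<delta> v)"
definition B where "B d = \<epsilon> * cr (\<delta> u) d"

lemma AB_add: "A (x + y) = A x + A y" "B (x + y) = B x + B y"
  by (simp_all add: A_def B_def cr_add algebra_simps)

lemma AB_0 [simp]: "A 0 = 0" "B 0 = 0"
  by (simp_all add: A_def B_def)

lemma AB_uv [simp]: "A (\<delta> u) = 1" "A (\<delta> v) = 0" "B (\<delta> u) = 0" "B (\<delta> v) = 1"
  using det eps by (simp_all add: A_def B_def)

lemma AB_expand: "fst d = A d * fst (\<delta> u) + B d * fst (\<delta> v)" "snd d = A d * snd (\<delta> u) + B d * snd (\<delta> v)"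
proof -
  have "A d * fst (\<delta> u) + B d * fst (\<delta> v) = \<epsilon> * cr (\<delta> u) (\<delta> v) * fst d"
    "A d * snd (\<delta> u) + B d * snd (\<delta> v) = \<epsilon> * cr (\<delta> u) (\<delta> v) * snd d"
    by (simp_all add: A_def B_def cr_def algebra_simps)
  then show "fst d = A d * fst (\<delta> u) + B d * fst (\<delta> v)" "snd d = A d * snd (\<delta> u) + B d * snd (\<delta> v)"
    using det eps by simp_all
qed

definition admissible :: "'k \<Rightarrow> 'k \<Rightarrow> bool" where
  "admissible s t \<longleftrightarrow> (s = 0 \<longrightarrow> (\<forall>k. c k \<noteq> 0 \<longrightarrow> 0 \<le> A (\<delta> k))) \<and> (t = 0 \<longrightarrow> (\<forall>k. c k \<noteq> 0 \<longrightarrow> 0 \<le> B (\<delta> k)))"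

definition chr :: "'k \<Rightarrow> 'k \<Rightarrow> int \<times> int \<Rightarrow> 'k" where
  "chr s t d = s powi A d * t powi B d"

definition chr_s :: "'k \<Rightarrow> 'k \<Rightarrow> int \<times> int \<Rightarrow> 'k" where
  "chr_s s t d = of_int (A d) * s powi (A d - 1) * t powi B d"

definition chr_t :: "'k \<Rightarrow> 'k \<Rightarrow> int \<times> int \<Rightarrow> 'k" where
  "chr_t s t d = of_int (B d) * s powi A d * t powi (B d - 1)"

definition gpt :: "'k \<Rightarrow> 'k \<Rightarrow> 'k ^ 'v" where "gpt s t = (\<chi> k. c k * chr s t (\<delta> k))"
definition gpt_s :: "'k \<Rightarrow> 'k \<Rightarrow> 'k ^ 'v" where "gpt_s s t = (\<chi> k. c k * chr_s s t (\<delta> k))"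
definition gpt_t :: "'k \<Rightarrow> 'k \<Rightarrow> 'k ^ 'v" where "gpt_t s t = (\<chi> k. c k * chr_t s t (\<delta> k))"

lemma admissible_mon:
  assumes "admissible s t" "d \<in> mon (expos c \<delta>)"
  shows "s = 0 \<Longrightarrow> 0 \<le> A d" "t = 0 \<Longrightarrow> 0 \<le> B d"
  using assms(2,1) by (induction rule: mon.induct) (auto simp: AB_add admissible_def expos_def)

lemma character_chr:
  assumes "admissible s t" shows "character (mon (expos c \<delta>)) (chr s t)"
  unfolding character_def
proof (intro conjI ballI)
  fix x y assume xy: "x \<in> mon (expos c \<delta>)" "y \<in> mon (expos c \<delta>)"
  have "s powi (A x + A y) = s powi A x * s powi A y" "t powi (B x + B y) = t powi B x * t powi B y"
    using admissible_mon[OF assms xy(1)] admissible_mon[OF assms xy(2)]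
    by (auto intro!: power_int_add_nonneg)
  then show "chr s t (x + y) = chr s t x * chr s t y" by (simp add: chr_def AB_add)
qed (simp add: chr_def)

lemma derivation_chr:
  assumes "admissible s t"
  shows "derivation (mon (expos c \<delta>)) (chr s t) (chr_s s t)" "derivation (mon (expos c \<delta>)) (chr s t) (chr_t s t)"
proof -
  have p: "s powi (A x + A y) = s powi A x * s powi A y" "t powi (B x + B y) = t powi B x * t powi B y"
    "of_int (A x + A y) * s powi (A x + A y - 1) = of_int (A x) * s powi (A x - 1) * s powi A y + s powi A x * (of_int (A y) * s powi (A y - 1))"
    "of_int (B x + B y) * t powi (B x + B y - 1) = of_int (B x) * t powi (B x - 1) * t powi B y + t powi B x * (of_int (B y) * t powi (B y - 1))"
    if "x \<in> mon (expos c \<delta>)" "y \<in> mon (expos c \<delta>)" for x y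
    using admissible_mon[OF assms that(1)] admissible_mon[OF assms that(2)]
    by (blast intro!: power_int_add_nonneg power_int_diff_one_mult)+
  show "derivation (mon (expos c \<delta>)) (chr s t) (chr_s s t)"
    unfolding derivation_def
  proof (intro conjI ballI)
    fix x y assume xy: "x \<in> mon (expos c \<delta>)" "y \<in> mon (expos c \<delta>)"
    have "chr_s s t (x + y) = (of_int (A x + A y) * s powi (A x + A y - 1)) * t powi (B x + B y)"
      by (simp add: chr_s_def AB_add)
    then show "chr_s s t (x + y) = chr_s s t x * chr s t y + chr s t x * chr_s s t y"
      unfolding p[OF xy] by (simp add: chr_s_def chr_def algebra_simps)
  qed (simp add: chr_s_def)
  show "derivation (mon (expos c \<delta>)) (chr s t) (chr_t s t)"
    unfolding derivation_def
  proof (intro conjI ballI)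
    fix x y assume xy: "x \<in> mon (expos c \<delta>)" "y \<in> mon (expos c \<delta>)"
    have "chr_t s t (x + y) = s powi (A x + A y) * (of_int (B x + B y) * t powi (B x + B y - 1))"
      by (simp add: chr_t_def AB_add)
    then show "chr_t s t (x + y) = chr_t s t x * chr s t y + chr s t x * chr_t s t y"
      unfolding p[OF xy] by (simp add: chr_t_def chr_def algebra_simps)
  qed (simp add: chr_t_def)
qed

lemma gpt_in_toric: "admissible s t \<Longrightarrow> gpt s t \<in> toric c \<delta>"
  unfolding gpt_def by (intro character_point_in_toric character_chr)

lemma gpt_tangent:
  assumes "admissible s t"
  shows "gpt_s s t \<in> tangent_space (toric c \<delta>) (gpt s t)" "gpt_t s t \<in> tangent_space (toric c \<delta>) (gpt s t)"
  unfolding gpt_def gpt_s_def gpt_t_def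
  by (intro derivation_in_tangent_space character_chr derivation_chr assms)+

lemma gpt_uv [simp]: "gpt s t $ u = c u * s" "gpt s t $ v = c v * t"
  "gpt_s s t $ u = c u" "gpt_s s t $ v = 0" "gpt_t s t $ u = 0" "gpt_t s t $ v = c v"
  by (simp_all add: gpt_def gpt_s_def gpt_t_def chr_def chr_s_def chr_t_def)

lemma lmon_frame:
  assumes "x \<noteq> 0" "y \<noteq> 0"
  shows "lmon d x y = lmon (\<delta> u) x y powi A d * lmon (\<delta> v) x y powi B d"
proof -
  have "lmon d x y = x powi (fst (\<delta> u) * A d + fst (\<delta> v) * B d) * y powi (snd (\<delta> u) * A d + snd (\<delta> v) * B d)"
    unfolding lmon_def by (subst (1) AB_expand(1), subst (1) AB_expand(2)) (simp add: mult.commute)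
  also have "\<dots> = (x powi fst (\<delta> u)) powi A d * (x powi fst (\<delta> v)) powi B d *
       ((y powi snd (\<delta> u)) powi A d * (y powi snd (\<delta> v)) powi B d)"
    using assms by (simp add: power_int_add power_int_mult)
  also have "\<dots> = lmon (\<delta> u) x y powi A d * lmon (\<delta> v) x y powi B d"
    by (simp add: lmon_def power_int_mult_distrib)
  finally show ?thesis .
qed

text \<open>The binomial equation that expresses the coordinate \<open>k\<close> through \<open>u\<close> and \<open>v\<close>, with the negative powers
  on the side of \<open>k\<close>.\<close>

definition rel :: "'v \<Rightarrow> ('v, 'k) mpoly" where
  "rel k = Cst (1 / c k) * Var k * ((Cst (1 / c u) * Var u) ^ nat (- A (\<delta> k)) * (Cst (1 / c v) * Var v) ^ nat (- B (\<delta> k)))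
     - (Cst (1 / c u) * Var u) ^ nat (A (\<delta> k)) * (Cst (1 / c v) * Var v) ^ nat (B (\<delta> k))"

lemma power_int_split: "x \<noteq> 0 \<Longrightarrow> x powi a * x ^ nat (- a) = (x :: 'k) ^ nat a"
  by (cases "a \<ge> 0") (auto simp: power_int_def power_inverse field_simps)

lemma rel_vanishes:
  assumes "c k \<noteq> 0" shows "rel k \<in> vanishing_ideal (toric c \<delta>)"
proof -
  have "evalp (rel k) (pt c \<delta> x y) = 0" if "x \<noteq> 0" "y \<noteq> 0" for x y
  proof -
    let ?U = "lmon (\<delta> u) x y" and ?V = "lmon (\<delta> v) x y"
    have UV: "?U \<noteq> 0" "?V \<noteq> 0" using that by (simp_all add: lmon_def)
    have "evalp (rel k) (pt c \<delta> x y) =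
        lmon (\<delta> k) x y * (?U ^ nat (- A (\<delta> k)) * ?V ^ nat (- B (\<delta> k))) - ?U ^ nat (A (\<delta> k)) * ?V ^ nat (B (\<delta> k))"
      using assms cu cv by (simp add: rel_def pt_def)
    also have "lmon (\<delta> k) x y = ?U powi A (\<delta> k) * ?V powi B (\<delta> k)" using that by (rule lmon_frame)
    finally show ?thesis
      using power_int_split[OF UV(1), of "A (\<delta> k)"] power_int_split[OF UV(2), of "B (\<delta> k)"]
      by (simp add: mult_ac)
  qed
  then show ?thesis
    unfolding toric_def vanishing_ideal_zclosure by (auto simp: vanishing_ideal_def orbit_def)
qed

lemma Var_vanishes: "c k = 0 \<Longrightarrow> Var k \<in> vanishing_ideal (toric c \<delta>)"
  unfolding toric_def vanishing_ideal_zclosure by (auto simp: vanishing_ideal_def orbit_def pt_def)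

lemma admissible_nonzero:
  assumes "admissible s t" "c k \<noteq> 0"
  shows "s ^ nat (- A (\<delta> k)) \<noteq> 0" "t ^ nat (- B (\<delta> k)) \<noteq> 0"
  using assms by (auto simp: admissible_def)

lemma point_eq_gpt:
  assumes q: "q \<in> toric c \<delta>" and ad: "admissible (q $ u / c u) (q $ v / c v)"
  shows "q = gpt (q $ u / c u) (q $ v / c v)"
proof (rule vec_eq_iff[THEN iffD2], rule allI)
  fix k
  let ?s = "q $ u / c u" and ?t = "q $ v / c v"
  show "q $ k = gpt ?s ?t $ k"
  proof (cases "c k = 0")
    case True
    then show ?thesis using Var_vanishes[OF True] q by (auto simp: vanishing_ideal_def gpt_def)
  next
    case False
    have "evalp (rel k) q = 0" using rel_vanishes[OF False] q by (auto simp: vanishing_ideal_def)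
    then have "q $ k / c k * (?s ^ nat (- A (\<delta> k)) * ?t ^ nat (- B (\<delta> k))) = ?s ^ nat (A (\<delta> k)) * ?t ^ nat (B (\<delta> k))"
      by (simp add: rel_def)
    moreover have "?s ^ nat (A (\<delta> k)) = ?s powi A (\<delta> k) * ?s ^ nat (- A (\<delta> k))"
      using ad False by (cases "?s = 0") (auto simp: power_int_split admissible_def power_int_nonneg_exp)
    moreover have "?t ^ nat (B (\<delta> k)) = ?t powi B (\<delta> k) * ?t ^ nat (- B (\<delta> k))"
      using ad False by (cases "?t = 0") (auto simp: power_int_split admissible_def power_int_nonneg_exp)
    ultimately have "q $ k / c k * (?s ^ nat (- A (\<delta> k)) * ?t ^ nat (- B (\<delta> k)))
       = chr ?s ?t (\<delta> k) * (?s ^ nat (- A (\<delta> k)) * ?t ^ nat (- B (\<delta> k)))"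
      by (simp only: chr_def mult_ac)
    then have "q $ k / c k = chr ?s ?t (\<delta> k)"
      using admissible_nonzero[OF ad False] by (metis mult_right_cancel no_zero_divisors)
    then show ?thesis using False by (simp add: gpt_def field_simps)
  qed
qed

text \<open>If the components of \<open>w\<close> at \<open>u\<close> and \<open>v\<close> vanish, the derivative of the binomial equation along \<open>w\<close> is
  the component at \<open>k\<close> times a factor that is nonzero at an admissible point.\<close>

lemma tangent_determined:
  assumes q: "q \<in> toric c \<delta>" and ad: "admissible (q $ u / c u) (q $ v / c v)"
    and w: "w \<in> tangent_space (toric c \<delta>) q" "w $ u = 0" "w $ v = 0"
  shows "w = 0"
proof (rule vec_eq_iff[THEN iffD2], rule allI)
  fix k
  have D: "dirderiv p q w = 0" if "p \<in> vanishing_ideal (toric c \<delta>)" for p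
    using w(1) that by (simp add: tangent_space_eq)
  have uv: "dirderiv ((Cst (1 / c u) * Var u) ^ n) q w = 0" "dirderiv ((Cst (1 / c v) * Var v) ^ n) q w = 0" for n
    by (intro dirderiv_power_eq_0, simp add: w)+
  show "w $ k = 0 $ k"
  proof (cases "c k = 0")
    case True
    then show ?thesis using D[OF Var_vanishes] by simp
  next
    case False
    have "dirderiv (rel k) q w = 0" by (rule D[OF rel_vanishes[OF False]])
    then have "w $ k / c k * ((q $ u / c u) ^ nat (- A (\<delta> k)) * (q $ v / c v) ^ nat (- B (\<delta> k))) = 0"
      unfolding rel_def dirderiv_diff dirderiv_mult uv by simp
    then show ?thesis using admissible_nonzero[OF ad False] False by (metis divide_eq_0_iff mult_eq_0_iff zero_index)
  qed
qed

lemma tangent_space_frame: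
  assumes q: "q \<in> toric c \<delta>" and ad: "admissible (q $ u / c u) (q $ v / c v)"
  shows "tangent_space (toric c \<delta>) q = vec.span {gpt_s (q $ u / c u) (q $ v / c v), gpt_t (q $ u / c u) (q $ v / c v)}"
proof -
  let ?s = "q $ u / c u" and ?t = "q $ v / c v"
  let ?S = "gpt_s ?s ?t" and ?T = "gpt_t ?s ?t"
  have T: "?S \<in> tangent_space (toric c \<delta>) q" "?T \<in> tangent_space (toric c \<delta>) q"
    using gpt_tangent[OF ad] point_eq_gpt[OF q ad] by simp_all
  show ?thesis
  proof
    show "tangent_space (toric c \<delta>) q \<subseteq> vec.span {?S, ?T}"
    proof
      fix w assume w: "w \<in> tangent_space (toric c \<delta>) q"
      define z where "z = (w $ u / c u) *s ?S + (w $ v / c v) *s ?T"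
      have "w - z \<in> tangent_space (toric c \<delta>) q"
        unfolding z_def by (intro vec.subspace_diff vec.subspace_add vec.subspace_scale subspace_tangent_space w T)
      then have "w - z = 0"
        by (rule tangent_determined[OF q ad]) (use cu cv in \<open>simp_all add: z_def\<close>)
      then have "w = z" by simp
      moreover have "z \<in> vec.span {?S, ?T}"
        by (simp add: z_def vec.span_add vec.span_scale vec.span_base)
      ultimately show "w \<in> vec.span {?S, ?T}" by simp
    qed
    show "vec.span {?S, ?T} \<subseteq> tangent_space (toric c \<delta>) q"
      by (rule vec.span_minimal[OF _ subspace_tangent_space]) (use T in auto)
  qed
qed

lemma dim_span_frame: "vec.dim {gpt_s s t, gpt_t s t} = 2"
proof -
  let ?W = "\<lambda>b. if b then gpt_s s t else gpt_t s t" and ?k = "\<lambda>b. if b then u else v"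
  have "vec.independent (?W ` UNIV)" "card (?W ` UNIV) = card (UNIV :: bool set)"
    using cu cv by (intro independent_by_coordinates[where \<kappa> = ?k]; auto)+
  moreover have "?W ` UNIV = {gpt_s s t, gpt_t s t}" by (auto simp: UNIV_bool)
  ultimately show ?thesis by (simp add: vec.dim_eq_card_independent)
qed

text \<open>The chain consists of the point, the curve where the first parameter is constant, and the surface.
  The point and the curve are irreducible because they are toric with fewer exponents.\<close>

lemma chain_frame:
  assumes q: "q \<in> toric c \<delta>" and ad: "admissible (q $ u / c u) (q $ v / c v)"
  shows "\<exists>Z. irreducible_chain (toric c \<delta>) 2 Z \<and> q \<in> Z 0"
proof -
  define s t where "s = q $ u / c u" and "t = q $ v / c v"
  have ad: "admissible s t" and q_eq: "q = gpt s t"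
    using ad point_eq_gpt[OF q ad] by (simp_all add: s_def t_def)
  \<comment> \<open>The curve \<open>s = const\<close> is toric with exponents on a line.\<close>
  define c' where "c' = (\<lambda>k. c k * s powi A (\<delta> k))"
  define \<delta>' where "\<delta>' = (\<lambda>k. (0 :: int, B (\<delta> k)))"
  define Z0 where "Z0 = toric (\<lambda>k. q $ k) (\<lambda>_. 0)"
  define Z1 where "Z1 = toric c' \<delta>'"
  have Z0: "Z0 = {q}"
  proof -
    have "orbit (\<lambda>k. q $ k) (\<lambda>_. 0) = {q}"
      unfolding orbit_def pt_def by (auto simp: vec_eq_iff intro: exI[of _ 1])
    moreover have "y = q" if "y \<in> zclosure {q}" for y
    proof (rule vec_eq_iff[THEN iffD2], rule allI)
      fix k
      have "evalp (Var k - Cst (q $ k)) q = 0" by simp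
      then have "evalp (Var k - Cst (q $ k)) y = 0" using that unfolding zclosure_iff by blast
      then show "y $ k = q $ k" by simp
    qed
    ultimately show ?thesis using subset_zclosure[of "{q}"] by (auto simp: Z0_def toric_def)
  qed
  have pts: "gpt s y \<in> Z1" if "y = 0 \<Longrightarrow> admissible s 0" for y
  proof -
    have nn: "0 \<le> snd d" if "d \<in> mon (expos c' \<delta>')" "y = 0" for d
      using that(1) \<open>y = 0 \<Longrightarrow> admissible s 0\<close>[OF that(2)]
      by (induction rule: mon.induct) (auto simp: expos_def c'_def \<delta>'_def admissible_def)
    have "character (mon (expos c' \<delta>')) (\<lambda>d. y powi snd d)"
      unfolding character_def using nn by (auto intro!: power_int_add_nonneg)
    then have "(\<chi> k. c' k * y powi snd (\<delta>' k)) \<in> Z1"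
      unfolding Z1_def by (rule character_point_in_toric)
    moreover have "(\<chi> k. c' k * y powi snd (\<delta>' k)) = gpt s y"
      by (simp add: vec_eq_iff gpt_def chr_def c'_def \<delta>'_def)
    ultimately show ?thesis by simp
  qed
  have qZ1: "q \<in> Z1" unfolding q_eq by (rule pts) (use ad in simp)
  have "Z1 \<subseteq> toric c \<delta>" unfolding Z1_def toric_def
  proof (rule zclosure_minimal)
    show "orbit c' \<delta>' \<subseteq> zclosure (orbit c \<delta>)"
    proof
      fix x assume "x \<in> orbit c' \<delta>'"
      then obtain a b where "b \<noteq> 0" "x = pt c' \<delta>' a b" by (auto simp: orbit_def)
      then have "x = gpt s b" "admissible s b"
        using ad by (simp_all add: vec_eq_iff pt_def gpt_def chr_def c'_def \<delta>'_def lmon_def admissible_def)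
      then show "x \<in> zclosure (orbit c \<delta>)" using gpt_in_toric by (simp add: toric_def)
    qed
  qed simp
  moreover have "Z1 \<noteq> toric c \<delta>"
  proof
    assume eq: "Z1 = toric c \<delta>"
    have "x $ u = c u * s" if "x \<in> Z1" for x
    proof -
      have "evalp (Var u - Cst (c u * s)) y = 0" if "y \<in> orbit c' \<delta>'" for y
        using that by (auto simp: orbit_def pt_def c'_def \<delta>'_def lmon_def)
      then have "evalp (Var u - Cst (c u * s)) x = 0"
        using \<open>x \<in> Z1\<close> unfolding Z1_def toric_def zclosure_iff by blast
      then show ?thesis by simp
    qed
    moreover have "gpt 1 1 \<in> Z1" "gpt 2 1 \<in> Z1"
      unfolding eq by (auto intro!: gpt_in_toric simp: admissible_def)
    ultimately have "c u * 1 = c u * s" "c u * 2 = c u * s" by (metis gpt_uv(1))+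
    then have "(1::'k) = 2" using cu by simp
    then show False by simp
  qed
  moreover have "Z0 \<noteq> Z1"
  proof
    assume eq: "Z0 = Z1"
    have "gpt s 1 \<in> Z1" "gpt s 2 \<in> Z1" by (auto intro!: pts)
    then have "gpt s 1 = gpt s 2" unfolding eq[symmetric] Z0 by simp
    then have "c v * 1 = c v * 2" by (metis gpt_uv(2))
    then have "(1::'k) = 2" using cv by simp
    then show False by simp
  qed
  ultimately have "Z0 \<subset> Z1" "Z1 \<subset> toric c \<delta>" using qZ1 Z0 by auto
  moreover have "irreducible_algebraic_set Z0" "irreducible_algebraic_set Z1" "irreducible_algebraic_set (toric c \<delta>)"
    by (simp_all add: Z0_def Z1_def irreducible_toric)
  ultimately have "irreducible_chain (toric c \<delta>) 2 (\<lambda>i. if i = 0 then Z0 else if i = 1 then Z1 else toric c \<delta>)"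
    unfolding irreducible_chain_def by (auto simp: less_2_cases_iff)
  then show ?thesis using Z0 by (intro exI) auto
qed

lemma nonsingular_frame:
  assumes q: "q \<in> toric c \<delta>" and ad: "admissible (q $ u / c u) (q $ v / c v)"
  shows "q \<notin> Sing (toric c \<delta>)"
proof -
  obtain Z where "irreducible_chain (toric c \<delta>) 2 Z" "q \<in> Z 0" using chain_frame[OF assms] by blast
  then have "local_dim (toric c \<delta>) q = 2" by (rule local_dim_toric_eq)
  then show ?thesis by (simp add: Sing_def tangent_space_frame[OF assms] dim_span_frame)
qed

end

lemma mon_monomial:
  fixes c :: "'v::finite \<Rightarrow> 'k::field"
  assumes "x \<in> mon (expos c \<delta>)"
  shows "\<exists>m. expdeg \<delta> m = x \<and> mval m (vec_lambda c) \<noteq> 0"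
  using assms
proof (induction rule: mon.induct)
  case mon_0
  show ?case by (rule exI[of _ 0]) simp
next
  case (mon_step g x)
  then obtain m k where "expdeg \<delta> m = x" "mval m (vec_lambda c) \<noteq> 0" "g = \<delta> k" "c k \<noteq> 0"
    by (auto simp: expos_def)
  then show ?case
    by (intro exI[of _ "Poly_Mapping.single k (Suc 0) + m"]) (simp add: expdeg_add mval_add)
qed

text \<open>Some monomial restricts to a multiple of the inverse of the coordinate \<open>k\<close> on the torus.\<close>

lemma unit_nonvanishing:
  fixes c :: "'v::finite \<Rightarrow> 'k::field_char_0"
  assumes k: "c k \<noteq> 0" and un: "- \<delta> k \<in> mon (expos c \<delta>)" and q: "q \<in> toric c \<delta>"
  shows "q $ k \<noteq> 0"
proof -
  obtain m where m: "expdeg \<delta> m = - \<delta> k" "mval m (vec_lambda c) \<noteq> 0" using mon_monomial[OF un] by blast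
  let ?p = "Poly_Mapping.single m 1 * Var k - Cst (mval m (vec_lambda c) * c k)"
  have "evalp ?p (pt c \<delta> s t) = 0" if "s \<noteq> 0" "t \<noteq> 0" for s t
  proof -
    have "evalp (Poly_Mapping.single m 1) (pt c \<delta> s t) = mval m (vec_lambda c) * lmon (- \<delta> k) s t"
      using mval_pt[OF that, of m c \<delta>] by (simp add: evalp_eq_lfun m)
    moreover have "lmon (- \<delta> k) s t * lmon (\<delta> k) s t = 1"
      using lmon_add[OF that, of "- \<delta> k" "\<delta> k"] by simp
    ultimately show ?thesis by (simp add: pt_def mult_ac)
  qed
  then have "evalp ?p q = 0" using q unfolding toric_def zclosure_iff orbit_def by blast
  then show ?thesis using m k by auto
qed

text \<open>The two alternatives for \<open>u\<close> and for \<open>v\<close> cover the semigroups \<open>\<nat>\<^sup>2\<close>, \<open>\<nat> \<times> \<int>\<close> and \<open>\<int>\<^sup>2\<close>; in each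
  of them every point is admissible.\<close>

lemma toric_smooth:
  fixes c :: "'v::finite \<Rightarrow> 'k::field_char_0"
  assumes frame: "cr (\<delta> u) (\<delta> v) = \<epsilon>" "\<epsilon> * \<epsilon> = 1" "c u \<noteq> 0" "c v \<noteq> 0"
    and u: "(\<forall>k. c k \<noteq> 0 \<longrightarrow> 0 \<le> \<epsilon> * cr (\<delta> k) (\<delta> v)) \<or> - \<delta> u \<in> mon (expos c \<delta>)"
    and v: "(\<forall>k. c k \<noteq> 0 \<longrightarrow> 0 \<le> \<epsilon> * cr (\<delta> u) (\<delta> k)) \<or> - \<delta> v \<in> mon (expos c \<delta>)"
  shows "Sing (toric c \<delta>) = {}"
proof -
  interpret frame c \<delta> u v \<epsilon> by unfold_locales (use frame in auto)
  have "q \<notin> Sing (toric c \<delta>)" if q: "q \<in> toric c \<delta>" for q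
  proof (rule nonsingular_frame[OF q])
    have "q $ u = 0 \<Longrightarrow> \<forall>k. c k \<noteq> 0 \<longrightarrow> 0 \<le> A (\<delta> k)" "q $ v = 0 \<Longrightarrow> \<forall>k. c k \<noteq> 0 \<longrightarrow> 0 \<le> B (\<delta> k)"
      using u v unit_nonvanishing[OF frame(3) _ q] unit_nonvanishing[OF frame(4) _ q] unfolding A_def B_def by blast+
    then show "admissible (q $ u / c u) (q $ v / c v)" using frame(3,4) by (simp add: admissible_def)
  qed
  then show ?thesis by (auto simp: Sing_def)
qed

definition atom :: "(int \<times> int) set \<Rightarrow> int \<times> int \<Rightarrow> bool" where
  "atom S d \<longleftrightarrow> d \<in> S \<and> d \<noteq> 0 \<and> (\<forall>x\<in>S. \<forall>y\<in>S. x + y = d \<longrightarrow> x = 0 \<or> y = 0)"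

lemma atom_is_generator:
  assumes "atom (mon G) d" shows "d \<in> G"
proof -
  have "d \<in> mon G" using assms by (simp add: atom_def)
  then show ?thesis using assms
  proof (induction rule: mon.induct)
    case (mon_step g x)
    then have "g = 0 \<or> x = 0" using mon_base by (auto simp: atom_def)
    then show ?case using mon_step by auto
  qed (simp add: atom_def)
qed

lemma mon_positive:
  fixes lev :: "int \<times> int \<Rightarrow> int"
  assumes add: "\<And>x y. lev (x + y) = lev x + lev y" and pos: "\<And>g. g \<in> G \<Longrightarrow> g \<noteq> 0 \<Longrightarrow> 0 < lev g"
    and "x \<in> mon G" "x \<noteq> 0"
  shows "0 < lev x"
proof -
  have "lev 0 = 0" using add[of 0 0] by simp
  have "x = 0 \<or> 0 < lev x" using assms(3)
  proof (induction rule: mon.induct)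
    case (mon_step g x)
    then show ?case using pos[of g] \<open>lev 0 = 0\<close> by (cases "g = 0"; cases "x = 0") (auto simp: add)
  qed simp
  then show ?thesis using assms(4) by simp
qed

text \<open>An element of least level outside the submonoid generated by \<open>E\<close> cannot be decomposed.\<close>

lemma ex_further_atom:
  fixes lev :: "int \<times> int \<Rightarrow> int"
  assumes add: "\<And>x y. lev (x + y) = lev x + lev y" and pos: "\<And>g. g \<in> G \<Longrightarrow> g \<noteq> 0 \<Longrightarrow> 0 < lev g"
    and z: "z \<in> mon G" "z \<notin> mon E"
  shows "\<exists>d. atom (mon G) d \<and> d \<notin> mon E"
  using z
proof (induction "nat (lev z)" arbitrary: z rule: less_induct)
  case less
  show ?case
  proof (cases "atom (mon G) z")
    case False
    have "z \<noteq> 0" using less.prems mon_0 by metis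
    then obtain x y where xy: "x \<in> mon G" "y \<in> mon G" "z = x + y" "x \<noteq> 0" "y \<noteq> 0"
      using False less.prems by (auto simp: atom_def)
    then have "0 < lev x" "0 < lev y" using mon_positive[OF add pos] by blast+
    then have "nat (lev x) < nat (lev z)" "nat (lev y) < nat (lev z)" using add xy(3) by simp_all
    moreover have "x \<notin> mon E \<or> y \<notin> mon E" using xy(3) less.prems mon_add by blast
    ultimately show ?thesis using less.hyps xy by blast
  qed (use less.prems in blast)
qed

text \<open>The positive functional shows that the character that is \<open>0\<close> on all nonzero exponents exists. Along
  it, the indicator function of an irreducible element is a derivation. Distinct irreducible elements
  occur as exponents of distinct coordinates, so their tangent vectors are independent, and three of
  them exceed the dimension.\<close>

lemma toric_singular:
  fixes c :: "'v::finite \<Rightarrow> 'k::field_char_0" and lev :: "int \<times> int \<Rightarrow> int"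
  assumes add: "\<And>x y. lev (x + y) = lev x + lev y" and pos: "\<And>g. g \<in> expos c \<delta> \<Longrightarrow> g \<noteq> 0 \<Longrightarrow> 0 < lev g"
    and D: "finite D" "card D = 3" "\<And>d. d \<in> D \<Longrightarrow> atom (mon (expos c \<delta>)) d"
    and q: "q = (\<chi> k. if \<delta> k = 0 then c k else 0)"
  shows "q \<in> Sing (toric c \<delta>)"
proof -
  let ?S = "mon (expos c \<delta>)"
  define e :: "int \<times> int \<Rightarrow> 'k" where "e = (\<lambda>d. if d = 0 then 1 else 0)"
  define E :: "int \<times> int \<Rightarrow> int \<times> int \<Rightarrow> 'k" where "E = (\<lambda>d x. if x = d then 1 else 0)"
  have p: "0 < lev x" if "x \<in> ?S" "x \<noteq> 0" for x using mon_positive[OF add pos] that by blast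
  have l0: "lev 0 = 0" using add[of 0 0] by simp
  have nz: "x + y \<noteq> 0" if "x \<in> ?S" "y \<in> ?S" "x \<noteq> 0" for x y
  proof
    assume "x + y = 0"
    then have "lev x + lev y = 0" using add[of x y] l0 by simp
    then show False using p[OF that(1,3)] p[OF that(2)] l0 by fastforce
  qed
  have ch: "character ?S e"
    unfolding character_def e_def using nz by (auto simp: add.commute)
  have der: "derivation ?S e (E d)" if "d \<in> D" for d
  proof -
    have d: "atom ?S d" using D that by blast
    show ?thesis unfolding derivation_def
    proof (intro conjI ballI)
      fix x y assume xy: "x \<in> ?S" "y \<in> ?S"
      show "E d (x + y) = E d x * e y + e x * E d y"
      proof (cases "x = 0 \<or> y = 0")
        case False
        then have "x + y \<noteq> d" using d xy by (auto simp: atom_def)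
        then show ?thesis using False by (simp add: E_def e_def)
      qed (use d in \<open>auto simp: E_def e_def atom_def\<close>)
    qed (use d in \<open>auto simp: E_def atom_def\<close>)
  qed
  define W :: "int \<times> int \<Rightarrow> 'k ^ 'v" where "W = (\<lambda>d. \<chi> k. c k * E d (\<delta> k))"
  have q_eq: "q = (\<chi> k. c k * e (\<delta> k))" by (simp add: q e_def vec_eq_iff)
  have qX: "q \<in> toric c \<delta>" unfolding q_eq by (rule character_point_in_toric[OF ch])
  have WT: "W ` D \<subseteq> tangent_space (toric c \<delta>) q"
    unfolding q_eq W_def using derivation_in_tangent_space[OF ch der] by blast
  have "\<exists>k. c k \<noteq> 0 \<and> \<delta> k = d" if "d \<in> D" for d
    using atom_is_generator[OF D(3)[OF that]] by (auto simp: expos_def)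
  then obtain \<kappa> where \<kappa>: "\<And>d. d \<in> D \<Longrightarrow> c (\<kappa> d) \<noteq> 0 \<and> \<delta> (\<kappa> d) = d" by metis
  have "vec.independent (W ` D)" "card (W ` D) = card D"
  proof -
    have "W i $ \<kappa> i \<noteq> 0" "j \<in> D \<Longrightarrow> i \<noteq> j \<Longrightarrow> W i $ \<kappa> j = 0" if "i \<in> D" for i j
      using \<kappa>[OF that] \<kappa>[of j] by (auto simp: W_def E_def)
    then show "vec.independent (W ` D)" "card (W ` D) = card D"
      using independent_by_coordinates[of D W \<kappa>] D(1) by blast+
  qed
  then have "3 \<le> vec.dim (tangent_space (toric c \<delta>) q)"
    using vec.independent_card_le_dim[OF WT] D by simp
  then show ?thesis using local_dim_toric_le[of c \<delta> q] qX by (auto simp: Sing_def)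
qed

section \<open>Charts of the Grassmannian of planes\<close>

lemma span_pair_iff: "w \<in> vec.span {a, b} \<longleftrightarrow> (\<exists>x y. w = x *s a + y *s (b :: 'k::field ^ 'n::finite))"
proof -
  have "w \<in> vec.span {a, b} \<longleftrightarrow> (\<exists>x y. w - x *s a = y *s b)"
    by (auto simp: vec.span_insert vec.span_singleton)
  also have "\<dots> \<longleftrightarrow> (\<exists>x y. w = x *s a + y *s b)"
    by (simp add: diff_eq_eq add.commute)
  finally show ?thesis .
qed

type_synonym ('k, 'n) chart_space = "'k ^ ('n + 'n \<times> 'n)"

definition basept :: "('k::field, 'n::finite) chart_space \<Rightarrow> 'k ^ 'n" where
  "basept p = (\<chi> k. p $ Inl k)"

definition prow :: "'n \<Rightarrow> ('k::field, 'n::finite) chart_space \<Rightarrow> 'k ^ 'n" where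
  "prow i p = (\<chi> k. p $ Inr (i, k))"

text \<open>The points of \<open>chart {i, j}\<close> are pairs of a base point and a plane; the plane is recorded by the two
  rows that form the unit matrix in the columns \<open>i, j\<close>.\<close>

definition normal_form :: "'n \<Rightarrow> 'n \<Rightarrow> ('k::field, 'n::finite) chart_space \<Rightarrow> bool" where
  "normal_form i j p \<longleftrightarrow> prow i p $ i = 1 \<and> prow i p $ j = 0 \<and> prow j p $ i = 0 \<and> prow j p $ j = 1
     \<and> (\<forall>l. l \<noteq> i \<longrightarrow> l \<noteq> j \<longrightarrow> prow l p = 0)"

definition plane :: "'n \<Rightarrow> 'n \<Rightarrow> ('k::field, 'n::finite) chart_space \<Rightarrow> ('k ^ 'n) set" where
  "plane i j p = vec.span {prow i p, prow j p}"

lemma chart_pair: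
  assumes "i \<noteq> j"
  shows "p \<in> chart {i, j} Z \<longleftrightarrow> normal_form i j p \<and> (basept p, plane i j p) \<in> Z"
  using assms
  by (auto simp: chart_def normal_form_def basept_def plane_def prow_def vec_eq_iff insert_commute)

lemma chart_point_eqI:
  assumes "basept p = basept p'" "\<And>l. prow l p = prow l p'"
  shows "p = p'"
proof -
  have "p $ \<kappa> = p' $ \<kappa>" for \<kappa>
    using assms(1) assms(2)[of "fst (projr \<kappa>)"] by (cases \<kappa>) (auto simp: basept_def prow_def vec_eq_iff)
  then show ?thesis by (simp add: vec_eq_iff)
qed

lemma plane_Grassmannian:
  assumes "i \<noteq> j" "normal_form i j p" shows "plane i j p \<in> Grassmannian 2"
proof -
  let ?W = "\<lambda>b. if b then prow i p else prow j p" and ?k = "\<lambda>b. if b then i else j"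
  have "vec.independent (?W ` UNIV)" "card (?W ` UNIV) = card (UNIV :: bool set)"
    using assms by (intro independent_by_coordinates[where \<kappa> = ?k]; auto simp: normal_form_def)+
  moreover have "?W ` UNIV = {prow i p, prow j p}" by (auto simp: UNIV_bool)
  ultimately show ?thesis by (simp add: plane_def Grassmannian_def vec.dim_eq_card_independent)
qed

text \<open>Change of chart, from rows \<open>a, b\<close> to rows \<open>i, j\<close>, by Cramer's rule.\<close>

definition minor :: "'n \<Rightarrow> 'n \<Rightarrow> 'n \<Rightarrow> 'n \<Rightarrow> ('k::field, 'n::finite) chart_space \<Rightarrow> 'k" where
  "minor a b i j p = prow a p $ i * prow b p $ j - prow a p $ j * prow b p $ i"

definition rechart :: "'n \<Rightarrow> 'n \<Rightarrow> 'n \<Rightarrow> 'n \<Rightarrow> ('k::field, 'n::finite) chart_space \<Rightarrow> ('k, 'n) chart_space" where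
  "rechart a b i j p = (\<chi> \<kappa>. case \<kappa> of Inl k \<Rightarrow> p $ Inl k
     | Inr (l, k) \<Rightarrow> if l = i then (prow b p $ j * prow a p $ k - prow a p $ j * prow b p $ k) / minor a b i j p
        else if l = j then (prow a p $ i * prow b p $ k - prow b p $ i * prow a p $ k) / minor a b i j p
        else 0)"

lemma base_rechart [simp]: "basept (rechart a b i j p) = basept p"
  by (simp add: basept_def rechart_def)

lemma prow_rechart:
  assumes "i \<noteq> j"
  shows "prow i (rechart a b i j p) = (prow b p $ j / minor a b i j p) *s prow a p + (- prow a p $ j / minor a b i j p) *s prow b p"
    and "prow j (rechart a b i j p) = (- prow b p $ i / minor a b i j p) *s prow a p + (prow a p $ i / minor a b i j p) *s prow b p"
    and "l \<noteq> i \<Longrightarrow> l \<noteq> j \<Longrightarrow> prow l (rechart a b i j p) = 0"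
  using assms by (simp_all add: vec_eq_iff prow_def rechart_def diff_divide_distrib)

lemma normal_form_rechart:
  assumes "i \<noteq> j" "minor a b i j p \<noteq> 0"
  shows "normal_form i j (rechart a b i j p)"
proof -
  have m: "prow b p $ j * prow a p $ i - prow a p $ j * prow b p $ i = minor a b i j p"
    by (simp add: minor_def algebra_simps)
  then show ?thesis
    using assms unfolding normal_form_def prow_rechart[OF assms(1)]
    by (simp add: prow_rechart[OF assms(1)] diff_divide_distrib[symmetric]) (simp add: minor_def algebra_simps)
qed

lemma plane_rechart:
  assumes ij: "i \<noteq> j" and m: "minor a b i j p \<noteq> 0"
  shows "plane i j (rechart a b i j p) = plane a b p"
proof -
  let ?r = "rechart a b i j p"
  have "prow a p = prow a p $ i *s prow i ?r + prow a p $ j *s prow j ?r"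
    "prow b p = prow b p $ i *s prow i ?r + prow b p $ j *s prow j ?r"
    using m unfolding prow_rechart[OF ij] by (simp_all add: vec_eq_iff field_simps) (simp_all add: minor_def algebra_simps)
  then have "prow a p \<in> plane i j ?r" "prow b p \<in> plane i j ?r"
    unfolding plane_def span_pair_iff by blast+
  moreover have "prow i ?r \<in> plane a b p" "prow j ?r \<in> plane a b p"
    unfolding plane_def span_pair_iff using prow_rechart[OF ij] by blast+
  ultimately show ?thesis by (simp add: plane_def vec.span_eq)
qed

text \<open>Each pair of rows is a combination of the other one. Read in the columns \<open>i, j\<close>, where the rows of
  \<open>p'\<close> form the unit matrix, this says that the transition matrix inverts the minor.\<close>

lemma rechart_unique:
  assumes ij: "i \<noteq> j" and nf: "normal_form i j p'" and eq: "basept p' = basept p" "plane i j p' = plane a b p"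
  shows "minor a b i j p \<noteq> 0 \<and> p' = rechart a b i j p"
proof -
  have coord: "w = w $ i *s prow i p' + w $ j *s prow j p'" if "w \<in> plane i j p'" for w
  proof -
    note w = that
    obtain x y where w: "w = x *s prow i p' + y *s prow j p'" using w by (auto simp: plane_def span_pair_iff)
    then have "w $ i = x" "w $ j = y" using nf by (simp_all add: normal_form_def)
    with w show ?thesis by simp
  qed
  have "prow a p \<in> plane a b p" "prow b p \<in> plane a b p" by (simp_all add: plane_def vec.span_base)
  then have a: "prow a p = prow a p $ i *s prow i p' + prow a p $ j *s prow j p'"
    and b: "prow b p = prow b p $ i *s prow i p' + prow b p $ j *s prow j p'"
    using coord eq by blast+
  have "prow i p' \<in> plane i j p'" "prow j p' \<in> plane i j p'" by (simp_all add: plane_def vec.span_base)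
  then obtain x y x' y' where i: "prow i p' = x *s prow a p + y *s prow b p" and j: "prow j p' = x' *s prow a p + y' *s prow b p"
    unfolding eq by (auto simp: plane_def span_pair_iff)
  have "x * prow a p $ i + y * prow b p $ i = 1" "x * prow a p $ j + y * prow b p $ j = 0"
    "x' * prow a p $ i + y' * prow b p $ i = 0" "x' * prow a p $ j + y' * prow b p $ j = 1"
    using nf i j by (simp_all add: normal_form_def)
  then have "(x * y' - x' * y) * minor a b i j p = 1"
    unfolding minor_def by algebra
  then have m: "minor a b i j p \<noteq> 0" by auto
  have "minor a b i j p * prow i p' $ k = prow b p $ j * prow a p $ k - prow a p $ j * prow b p $ k"
    "minor a b i j p * prow j p' $ k = prow a p $ i * prow b p $ k - prow b p $ i * prow a p $ k" for k
  proof -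
    have "prow a p $ k = prow a p $ i * prow i p' $ k + prow a p $ j * prow j p' $ k"
      "prow b p $ k = prow b p $ i * prow i p' $ k + prow b p $ j * prow j p' $ k"
      by (metis a vector_add_component vector_smult_component, metis b vector_add_component vector_smult_component)
    then show "minor a b i j p * prow i p' $ k = prow b p $ j * prow a p $ k - prow a p $ j * prow b p $ k"
      "minor a b i j p * prow j p' $ k = prow a p $ i * prow b p $ k - prow b p $ i * prow a p $ k"
      unfolding minor_def by algebra+
  qed
  then have "prow i p' = prow i (rechart a b i j p)" "prow j p' = prow j (rechart a b i j p)"
    using m unfolding prow_rechart[OF ij] by (simp_all add: vec_eq_iff field_simps)
  moreover have "prow l p' = prow l (rechart a b i j p)" if "l \<noteq> i" "l \<noteq> j" for l
    using nf that prow_rechart(3)[OF ij that] by (simp add: normal_form_def)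
  ultimately have "p' = rechart a b i j p"
    using eq by (intro chart_point_eqI) (auto, metis)
  with m show ?thesis by blast
qed

lemma normal_form_unique:
  assumes "i \<noteq> j" "normal_form i j p" "normal_form i j p'" "basept p = basept p'" "plane i j p = plane i j p'"
  shows "p = p'"
  using rechart_unique[of i j p p i j] rechart_unique[of i j p' p i j] assms by auto

subsection \<open>Algebraic conditions\<close>

lemma algebraic_setI:
  assumes "\<And>f. f \<in> I \<Longrightarrow> \<exists>g. \<forall>x. evalp g x = 0 \<longleftrightarrow> Q f x"
  shows "algebraic_set {x. \<forall>f\<in>I. Q f x}"
proof -
  obtain g where "\<And>f x. f \<in> I \<Longrightarrow> evalp (g f) x = 0 \<longleftrightarrow> Q f x" using assms by metis
  then have "{x. \<forall>f\<in>I. Q f x} = zero_set (g ` I)" by (auto simp: zero_set_def)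
  then show ?thesis by simp
qed

lemma algebraic_set_Int: "algebraic_set A \<Longrightarrow> algebraic_set B \<Longrightarrow> algebraic_set (A \<inter> B)"
proof -
  assume "algebraic_set A" "algebraic_set B"
  then obtain S T where "A = zero_set S" "B = zero_set T" by (auto simp: algebraic_set_def)
  then have "A \<inter> B = zero_set (S \<union> T)" by (auto simp: zero_set_def)
  then show ?thesis by simp
qed

lemma algebraic_normal_form: "algebraic_set {p :: ('k::field, 'n::finite) chart_space. normal_form i j p}"
proof -
  have "{p :: ('k, 'n) chart_space. normal_form i j p} = zero_set ({Var (Inr (i, i)) - Cst 1, Var (Inr (i, j)), Var (Inr (j, i)), Var (Inr (j, j)) - Cst 1}
      \<union> {Var (Inr (l, k)) | l k. l \<noteq> i \<and> l \<noteq> j})"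
    by (auto simp: zero_set_def normal_form_def prow_def vec_eq_iff simp del: single_one) (metis evalp_Var)
  then show ?thesis by (simp only: algebraic_zero_set)
qed

lemma algebraic_base:
  fixes X :: "('k::field ^ 'n::finite) set"
  assumes "algebraic_set X" shows "algebraic_set {p. basept p \<in> X}"
proof -
  obtain S where S: "X = zero_set S" using assms by (auto simp: algebraic_set_def)
  have "\<exists>g. \<forall>p. evalp g p = evalp f (basept p)" for f :: "('n, 'k) mpoly"
  proof (induction f rule: poly_fun_induct)
    case (Cst a)
    show ?case by (rule exI[of _ "Cst a"]) simp
  next
    case (Var i)
    show ?case by (rule exI[of _ "Var (Inl i)"]) (simp add: basept_def)
  next
    case (add p q)
    then show ?case by (metis evalp_add)
  next
    case (mult p q)
    then show ?case by (metis evalp_mult)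
  qed
  then have "algebraic_set {p. \<forall>f\<in>S. evalp f (basept p) = 0}" by (intro algebraic_setI) metis
  then show ?thesis by (simp add: S zero_set_def)
qed

lemma evalp_rechart:
  fixes f :: "('n::finite + 'n \<times> 'n, 'k::field) mpoly"
  shows "\<exists>N g. \<forall>p. minor a b i j p \<noteq> 0 \<longrightarrow> evalp g p = minor a b i j p ^ N * evalp f (rechart a b i j p)"
proof (induction f rule: poly_fun_induct)
  case (Cst x)
  show ?case by (rule exI[of _ 0], rule exI[of _ "Cst x"]) simp
next
  case (Var \<kappa>)
  show ?case
  proof (cases \<kappa>)
    case (Inl k)
    show ?thesis by (rule exI[of _ 0], rule exI[of _ "Var \<kappa>"]) (simp add: Inl rechart_def)
  next
    case (Inr lk)
    obtain l k where lk: "lk = (l, k)" by fastforce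
    let ?V = "\<lambda>l k. Var (Inr (l, k)) :: ('n + 'n \<times> 'n, 'k) mpoly"
    let ?g = "if l = i then ?V b j * ?V a k - ?V a j * ?V b k
      else if l = j then ?V a i * ?V b k - ?V b i * ?V a k else 0"
    show ?thesis by (rule exI[of _ 1], rule exI[of _ ?g]) (simp add: Inr lk rechart_def prow_def)
  qed
next
  case (add f f')
  then obtain N g N' g' where
    "\<And>p. minor a b i j p \<noteq> 0 \<Longrightarrow> evalp g p = minor a b i j p ^ N * evalp f (rechart a b i j p)"
    "\<And>p. minor a b i j p \<noteq> 0 \<Longrightarrow> evalp g' p = minor a b i j p ^ N' * evalp f' (rechart a b i j p)" by blast
  moreover define M where "M = Var (Inr (a, i)) * Var (Inr (b, j)) - Var (Inr (a, j)) * (Var (Inr (b, i)) :: ('n + 'n \<times> 'n, 'k) mpoly)"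
  moreover have "evalp M p = minor a b i j p" for p by (simp add: M_def minor_def prow_def)
  ultimately show ?case
    by (intro exI[of _ "N + N'"] exI[of _ "g * M ^ N' + g' * M ^ N"]) (simp add: power_add algebra_simps)
next
  case (mult f f')
  then obtain N g N' g' where
    "\<And>p. minor a b i j p \<noteq> 0 \<Longrightarrow> evalp g p = minor a b i j p ^ N * evalp f (rechart a b i j p)"
    "\<And>p. minor a b i j p \<noteq> 0 \<Longrightarrow> evalp g' p = minor a b i j p ^ N' * evalp f' (rechart a b i j p)" by blast
  then show ?case
    by (intro exI[of _ "N + N'"] exI[of _ "g * g'"]) (simp add: power_add algebra_simps)
qed

text \<open>After multiplication by a power of the minor the pulled back equations are polynomial; one further
  factor makes them void where the minor vanishes and the second chart is not defined.\<close>

lemma algebraic_rechart: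
  fixes Y :: "('k::field, 'n::finite) chart_space set"
  assumes "algebraic_set Y"
  shows "algebraic_set {p. minor a b i j p \<noteq> 0 \<longrightarrow> rechart a b i j p \<in> Y}"
proof -
  obtain S where S: "Y = zero_set S" using assms by (auto simp: algebraic_set_def)
  have "\<exists>g. \<forall>p. evalp g p = 0 \<longleftrightarrow> (minor a b i j p \<noteq> 0 \<longrightarrow> evalp f (rechart a b i j p) = 0)" for f :: "('n + 'n \<times> 'n, 'k) mpoly"
  proof -
    obtain N g where g: "\<And>p. minor a b i j p \<noteq> 0 \<Longrightarrow> evalp g p = minor a b i j p ^ N * evalp f (rechart a b i j p)"
      using evalp_rechart by blast
    let ?M = "Var (Inr (a, i)) * Var (Inr (b, j)) - Var (Inr (a, j)) * (Var (Inr (b, i)) :: ('n + 'n \<times> 'n, 'k) mpoly)"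
    have "evalp ?M p = minor a b i j p" for p by (simp add: minor_def prow_def)
    then have M: "evalp (?M * g) p = minor a b i j p * evalp g p" for p by (simp only: evalp_mult)
    show ?thesis
    proof (intro exI[of _ "?M * g"] allI)
      fix p
      show "evalp (?M * g) p = 0 \<longleftrightarrow> (minor a b i j p \<noteq> 0 \<longrightarrow> evalp f (rechart a b i j p) = 0)"
        unfolding M using g[of p] by (cases "minor a b i j p = 0") auto
    qed
  qed
  then have "algebraic_set {p. \<forall>f\<in>S. minor a b i j p \<noteq> 0 \<longrightarrow> evalp f (rechart a b i j p) = 0}"
    by (intro algebraic_setI) blast
  moreover have "{p. \<forall>f\<in>S. minor a b i j p \<noteq> 0 \<longrightarrow> evalp f (rechart a b i j p) = 0} = {p. minor a b i j p \<noteq> 0 \<longrightarrow> rechart a b i j p \<in> Y}"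
    by (auto simp: S zero_set_def)
  ultimately show ?thesis by simp
qed

text \<open>The largest family of planes over \<open>X\<close> whose trace on the chart with rows \<open>i, j\<close> lies in \<open>Y\<close>: a bound
  for the Nash blowup on one chart that imposes nothing outside of it.\<close>

definition extend_chart :: "('k::field ^ 'n::finite) set \<Rightarrow> 'n \<Rightarrow> 'n \<Rightarrow> ('k, 'n) chart_space set \<Rightarrow> (('k ^ 'n) \<times> ('k ^ 'n) set) set" where
  "extend_chart X i j Y = {(x, W). x \<in> X \<and> W \<in> Grassmannian 2 \<and>
     (\<forall>p. normal_form i j p \<and> basept p = x \<and> plane i j p = W \<longrightarrow> p \<in> Y)}"

lemma closed_extend_chart:
  assumes X: "algebraic_set X" and Y: "algebraic_set Y" and ij: "i \<noteq> j"
  shows "closed_in_prod 2 (extend_chart X i j Y)"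
  unfolding closed_in_prod_def
proof (intro conjI allI impI)
  fix J :: "'b set" assume "card J = 2"
  then obtain a b where J: "J = {a, b}" "a \<noteq> b" by (auto simp: card_2_iff)
  have "p \<in> chart J (extend_chart X i j Y) \<longleftrightarrow>
      normal_form a b p \<and> basept p \<in> X \<and> (minor a b i j p \<noteq> 0 \<longrightarrow> rechart a b i j p \<in> Y)" for p
  proof -
    have "(\<forall>p'. normal_form i j p' \<and> basept p' = basept p \<and> plane i j p' = plane a b p \<longrightarrow> p' \<in> Y)
        \<longleftrightarrow> (minor a b i j p \<noteq> 0 \<longrightarrow> rechart a b i j p \<in> Y)" (is "?L \<longleftrightarrow> ?R")
    proof
      assume ?L
      then show ?R
        using normal_form_rechart[OF ij, of a b p] plane_rechart[OF ij, of a b p] base_rechart[of a b i j p] by blast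
    next
      assume ?R
      then show ?L using rechart_unique[OF ij, of _ p a b] by blast
    qed
    then show ?thesis
      using plane_Grassmannian[OF J(2), of p] unfolding J(1) chart_pair[OF J(2)] extend_chart_def by blast
  qed
  then have "chart J (extend_chart X i j Y) =
      {p. normal_form a b p} \<inter> ({p. basept p \<in> X} \<inter> {p. minor a b i j p \<noteq> 0 \<longrightarrow> rechart a b i j p \<in> Y})"
    by blast
  then show "algebraic_set (chart J (extend_chart X i j Y))"
    by (simp add: algebraic_set_Int algebraic_normal_form algebraic_base[OF X] algebraic_rechart[OF Y])
qed (auto simp: extend_chart_def)

section \<open>Charts of the Nash blowup\<close>

text \<open>At the torus point \<open>t\<close>, the plane spanned by the vectors \<open>(\<langle>\<delta>\<^sub>k, w\<rangle> t\<^bsup>\<delta>\<^sub>k\<^esup>)\<^sub>k\<close> for linear \<open>w\<close> has in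
  the chart with rows \<open>i, j\<close> the entries
  \<open>det (\<delta>\<^sub>k, \<delta>\<^sub>j) / det (\<delta>\<^sub>i, \<delta>\<^sub>j) t\<^bsup>\<delta>\<^sub>k - \<delta>\<^sub>i\<^esup>\<close> and
  \<open>det (\<delta>\<^sub>i, \<delta>\<^sub>k) / det (\<delta>\<^sub>i, \<delta>\<^sub>j) t\<^bsup>\<delta>\<^sub>k - \<delta>\<^sub>j\<^esup>\<close>, by Cramer's rule.\<close>

definition nash_coeff :: "('n \<Rightarrow> int \<times> int) \<Rightarrow> 'n \<Rightarrow> 'n \<Rightarrow> 'n + 'n \<times> 'n \<Rightarrow> 'k::field" where
  "nash_coeff \<delta> i j \<kappa> = (case \<kappa> of Inl k \<Rightarrow> 1
     | Inr (l, k) \<Rightarrow> if l = i then of_int (cr (\<delta> k) (\<delta> j)) / of_int (cr (\<delta> i) (\<delta> j))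
        else if l = j then of_int (cr (\<delta> i) (\<delta> k)) / of_int (cr (\<delta> i) (\<delta> j)) else 0)"

definition nash_expo :: "('n \<Rightarrow> int \<times> int) \<Rightarrow> 'n + 'n \<times> 'n \<Rightarrow> int \<times> int" where
  "nash_expo \<delta> \<kappa> = (case \<kappa> of Inl k \<Rightarrow> \<delta> k | Inr (l, k) \<Rightarrow> \<delta> k - \<delta> l)"

definition nash_chart :: "('n::finite \<Rightarrow> int \<times> int) \<Rightarrow> 'n \<Rightarrow> 'n \<Rightarrow> ('k::field, 'n) chart_space set" where
  "nash_chart \<delta> i j = (if cr (\<delta> i) (\<delta> j) = 0 then {} else toric (nash_coeff \<delta> i j) (nash_expo \<delta>))"

lemma algebraic_nash_chart [simp]: "algebraic_set (nash_chart \<delta> i j)"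
proof -
  have "{} = zero_set {1 :: ('n::finite + 'n \<times> 'n, 'k::field) mpoly}" by (simp add: zero_set_def)
  then show ?thesis by (metis nash_chart_def algebraic_zero_set algebraic_zclosure toric_def)
qed

text \<open>The points of a normal toric surface form the torus, two boundary curves and a fixed point. The
  frame at a boundary ray of the cone covers the torus and one of the curves; the fixed point is the
  common zero of \<open>u1\<close> and \<open>u2\<close>.\<close>

locale toric_surface_frames =
  fixes \<delta> :: "'n::finite \<Rightarrow> int \<times> int" and X :: "('k::field_char_0 ^ 'n) set"
    and u1 v1 u2 v2 :: 'n and \<epsilon>1 \<epsilon>2 :: int
  assumes X: "X = toric (\<lambda>_. 1) \<delta>"
    and frame1: "cr (\<delta> u1) (\<delta> v1) = \<epsilon>1" "\<epsilon>1 * \<epsilon>1 = 1" "\<And>k. 0 \<le> \<epsilon>1 * cr (\<delta> u1) (\<delta> k)"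
    and frame2: "cr (\<delta> u2) (\<delta> v2) = \<epsilon>2" "\<epsilon>2 * \<epsilon>2 = 1" "\<And>k. 0 \<le> \<epsilon>2 * cr (\<delta> u2) (\<delta> k)"
    and singular: "\<And>q. q \<in> X \<Longrightarrow> q $ u1 = 0 \<Longrightarrow> q $ u2 = 0 \<Longrightarrow> q \<in> Sing X"
begin

abbreviation tpt :: "'k \<Rightarrow> 'k \<Rightarrow> 'k ^ 'n" where "tpt \<equiv> pt (\<lambda>_. 1) \<delta>"
abbreviation npt :: "'n \<Rightarrow> 'n \<Rightarrow> 'k \<Rightarrow> 'k \<Rightarrow> ('k, 'n) chart_space" where "npt i j \<equiv> pt (nash_coeff \<delta> i j) (nash_expo \<delta>)"

sublocale F1: frame "\<lambda>_. 1 :: 'k" \<delta> u1 v1 \<epsilon>1 by unfold_locales (use frame1 in auto)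
sublocale F2: frame "\<lambda>_. 1 :: 'k" \<delta> u2 v2 \<epsilon>2 by unfold_locales (use frame2 in auto)

lemma alg_dim_X: "alg_dim X = 2"
proof -
  let ?q = "F1.gpt 1 1"
  have "F1.admissible 1 1" by (simp add: F1.admissible_def)
  then have "?q \<in> toric (\<lambda>_. 1) \<delta>" "F1.admissible (?q $ u1 / 1) (?q $ v1 / 1)"
    using F1.gpt_in_toric by simp_all
  then show ?thesis unfolding X using F1.chain_frame alg_dim_toric_eq by metis
qed

lemma tpt_in_X: "x \<noteq> 0 \<Longrightarrow> y \<noteq> 0 \<Longrightarrow> tpt x y \<in> X"
  unfolding X toric_def using subset_zclosure by (fastforce simp: orbit_def)

lemma tpt_nonzero: "x \<noteq> 0 \<Longrightarrow> y \<noteq> 0 \<Longrightarrow> tpt x y $ k \<noteq> 0"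
  by (simp add: pt_def lmon_def)

lemma admissible_tpt: "x \<noteq> 0 \<Longrightarrow> y \<noteq> 0 \<Longrightarrow> F1.admissible (tpt x y $ u1 / 1) (tpt x y $ v1 / 1)"
  using tpt_nonzero by (simp add: F1.admissible_def)

lemma tpt_nonsingular: "x \<noteq> 0 \<Longrightarrow> y \<noteq> 0 \<Longrightarrow> tpt x y \<notin> Sing X"
  using F1.nonsingular_frame[OF _ admissible_tpt] tpt_in_X by (simp add: X)

lemma dim_tangent_tpt: "x \<noteq> 0 \<Longrightarrow> y \<noteq> 0 \<Longrightarrow> vec.dim (tangent_space X (tpt x y)) = 2"
  using F1.tangent_space_frame[OF _ admissible_tpt] tpt_in_X by (simp add: X F1.dim_span_frame)

text \<open>For fixed \<open>z\<close>, the map \<open>d \<mapsto> det (d, z) t\<^sup>d\<close> is a derivation along the character \<open>d \<mapsto> t\<^sup>d\<close>.\<close>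

lemma tangent_tpt:
  assumes "x \<noteq> 0" "y \<noteq> 0"
  shows "(\<chi> k. of_int (cr (\<delta> k) z) * lmon (\<delta> k) x y) \<in> tangent_space X (tpt x y)"
proof -
  have "(\<chi> k. 1 * (of_int (cr (\<delta> k) z) * lmon (\<delta> k) x y)) \<in> tangent_space (toric (\<lambda>_. 1) \<delta>) (\<chi> k. 1 * lmon (\<delta> k) x y)"
    using assms
    by (intro derivation_in_tangent_space[where e = "\<lambda>d. lmon d x y" and E = "\<lambda>d. of_int (cr d z) * lmon d x y"])
       (auto simp: character_def derivation_def lmon_add cr_add algebra_simps)
  then show ?thesis by (simp add: X pt_def)
qed

lemma npt_chart:
  assumes D: "cr (\<delta> i) (\<delta> j) \<noteq> 0" and xy: "x \<noteq> 0" "y \<noteq> 0"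
  shows "basept (npt i j x y) = tpt x y" "normal_form i j (npt i j x y)"
    "plane i j (npt i j x y) = tangent_space X (tpt x y)"
proof -
  let ?p = "npt i j x y"
  let ?D = "of_int (cr (\<delta> i) (\<delta> j)) :: 'k"
  have ij: "i \<noteq> j" using D by auto
  have D': "?D \<noteq> 0" using D by simp
  show "basept ?p = tpt x y" by (simp add: basept_def pt_def nash_coeff_def nash_expo_def)
  have cr_swap: "cr (\<delta> j) (\<delta> i) = - cr (\<delta> i) (\<delta> j)" by (simp add: cr_def)
  show nf: "normal_form i j ?p"
    using ij D' by (simp add: normal_form_def prow_def pt_def nash_coeff_def nash_expo_def vec_eq_iff)
  have lm: "lmon (\<delta> k - \<delta> l) x y = lmon (\<delta> k) x y / lmon (\<delta> l) x y" for k l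
    using xy lmon_add[OF xy, of "\<delta> k - \<delta> l" "\<delta> l"] by (simp add: field_simps lmon_def)
  have r: "prow i ?p = (1 / (?D * lmon (\<delta> i) x y)) *s (\<chi> k. of_int (cr (\<delta> k) (\<delta> j)) * lmon (\<delta> k) x y)"
    "prow j ?p = (- 1 / (?D * lmon (\<delta> j) x y)) *s (\<chi> k. of_int (cr (\<delta> k) (\<delta> i)) * lmon (\<delta> k) x y)"
    using ij by (simp_all add: vec_eq_iff prow_def pt_def nash_coeff_def nash_expo_def lm)
      (auto simp: cr_def minus_divide_left algebra_simps)
  have "prow i ?p \<in> tangent_space X (tpt x y)" "prow j ?p \<in> tangent_space X (tpt x y)"
    unfolding r by (rule vec.subspace_scale[OF subspace_tangent_space] tangent_tpt xy)+
  then have "plane i j ?p \<subseteq> tangent_space X (tpt x y)"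
    unfolding plane_def by (intro vec.span_minimal subspace_tangent_space) simp
  moreover have "vec.dim (plane i j ?p) = 2" "vec.subspace (plane i j ?p)"
    using plane_Grassmannian[OF ij nf] by (simp_all add: Grassmannian_def)
  ultimately show "plane i j ?p = tangent_space X (tpt x y)"
    using dim_tangent_tpt[OF xy] by (intro vec.subspace_dim_equal subspace_tangent_space) simp_all
qed

text \<open>The Pluecker coordinate of the tangent plane at \<open>i, j\<close> is a multiple of \<open>det (\<delta>\<^sub>i, \<delta>\<^sub>j)\<close>.\<close>

lemma no_chart_tpt:
  assumes D: "cr (\<delta> i) (\<delta> j) = 0" and xy: "x \<noteq> 0" "y \<noteq> 0" and nf: "normal_form i j p"
  shows "plane i j p \<noteq> tangent_space X (tpt x y)"
proof
  assume eq: "plane i j p = tangent_space X (tpt x y)"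
  let ?q = "tpt x y"
  define s t where "s = ?q $ u1" and "t = ?q $ v1"
  have st: "s \<noteq> 0" "t \<noteq> 0" using tpt_nonzero[OF xy] by (auto simp: s_def t_def)
  have T: "tangent_space X ?q = vec.span {F1.gpt_s s t, F1.gpt_t s t}"
    using F1.tangent_space_frame[OF _ admissible_tpt[OF xy]] tpt_in_X[OF xy] by (simp add: X s_def t_def)
  have "prow i p \<in> plane i j p" "prow j p \<in> plane i j p" by (simp_all add: plane_def vec.span_base)
  then obtain a b a' b' where r: "prow i p = a *s F1.gpt_s s t + b *s F1.gpt_t s t" "prow j p = a' *s F1.gpt_s s t + b' *s F1.gpt_t s t"
    unfolding eq T span_pair_iff by blast
  have minor: "F1.gpt_s s t $ i * F1.gpt_t s t $ j - F1.gpt_s s t $ j * F1.gpt_t s t $ i = 0"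
  proof -
    have e: "of_int (F1.A (\<delta> i) * F1.B (\<delta> j) - F1.A (\<delta> j) * F1.B (\<delta> i)) = (0 :: 'k)"
    proof -
      have "F1.A (\<delta> i) * F1.B (\<delta> j) - F1.A (\<delta> j) * F1.B (\<delta> i) = (\<epsilon>1 * \<epsilon>1) * (cr (\<delta> u1) (\<delta> v1) * cr (\<delta> i) (\<delta> j))"
        unfolding F1.A_def F1.B_def cr_def by (simp add: algebra_simps)
      then show ?thesis using D by simp
    qed
    have m: "F1.gpt_s s t $ k = of_int (F1.A (\<delta> k)) * (s powi F1.A (\<delta> k) * t powi F1.B (\<delta> k)) / s"
      "F1.gpt_t s t $ k = of_int (F1.B (\<delta> k)) * (s powi F1.A (\<delta> k) * t powi F1.B (\<delta> k)) / t" for k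
      using st by (simp_all add: F1.gpt_s_def F1.gpt_t_def F1.chr_s_def F1.chr_t_def power_int_diff)
    show ?thesis unfolding m using e by (simp add: field_simps)
  qed
  have "prow i p $ i * prow j p $ j - prow i p $ j * prow j p $ i
      = (a * b' - a' * b) * (F1.gpt_s s t $ i * F1.gpt_t s t $ j - F1.gpt_s s t $ j * F1.gpt_t s t $ i)"
    unfolding r by (simp add: algebra_simps)
  then show False using nf unfolding minor by (simp add: normal_form_def)
qed

definition torus_gauss :: "(('k ^ 'n) \<times> ('k ^ 'n) set) set" where
  "torus_gauss = {(tpt x y, tangent_space X (tpt x y)) | x y. x \<noteq> 0 \<and> y \<noteq> 0}"

lemma nash_chart_subset_chart:
  assumes Z: "closed_in_prod 2 Z" "torus_gauss \<subseteq> Z" and ij: "i \<noteq> j"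
  shows "nash_chart \<delta> i j \<subseteq> chart {i, j} Z"
proof (cases "cr (\<delta> i) (\<delta> j) = 0")
  case False
  have "algebraic_set (chart {i, j} Z)" using Z(1) ij by (simp add: closed_in_prod_def)
  moreover have "orbit (nash_coeff \<delta> i j) (nash_expo \<delta>) \<subseteq> chart {i, j} Z"
    using npt_chart[OF False] Z(2) by (fastforce simp: orbit_def chart_pair[OF ij] torus_gauss_def)
  ultimately show ?thesis using zclosure_minimal False by (auto simp: nash_chart_def toric_def)
qed (simp add: nash_chart_def)

text \<open>On a boundary curve the parameter \<open>t\<close> is \<open>0\<close>, but \<open>(s, t)\<close> still defines a character on the semigroup
  of the chart with rows \<open>u, v\<close>: an exponent \<open>\<delta>\<^sub>k - \<delta>\<^sub>v\<close> occurs there only if \<open>\<delta>\<^sub>k\<close> is not a multiple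
  of \<open>\<delta>\<^sub>u\<close>, and then the power of \<open>t\<close> in it is nonnegative. The rows at this point are the partial
  derivatives of the graph.\<close>

lemma boundary_point:
  assumes f: "frame (\<lambda>_. 1 :: 'k) \<delta> u v \<epsilon>" and nn: "\<And>k. 0 \<le> \<epsilon> * cr (\<delta> u) (\<delta> k)" and q: "q \<in> X" "q $ u \<noteq> 0"
  shows "\<exists>p \<in> nash_chart \<delta> u v. basept p = q \<and> plane u v p = tangent_space X q"
proof -
  interpret frame "\<lambda>_. 1 :: 'k" \<delta> u v \<epsilon> by (rule f)
  have uv: "u \<noteq> v" using det eps by auto
  have e1: "of_int x / of_int \<epsilon> = (of_int (\<epsilon> * x) :: 'k)" for x
  proof -
    have "(of_int \<epsilon> * of_int \<epsilon> :: 'k) = 1" using eps by (metis of_int_1 of_int_mult)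
    moreover from this have "of_int \<epsilon> \<noteq> (0 :: 'k)" by auto
    ultimately show ?thesis by (simp add: field_simps)
  qed
  let ?c = "nash_coeff \<delta> u v :: _ \<Rightarrow> 'k"
  define s t where "s = q $ u" and "t = q $ v"
  have s: "s \<noteq> 0" using q by (simp add: s_def)
  have ad: "admissible (q $ u / 1) (q $ v / 1)"
    using nn q by (simp add: admissible_def B_def)
  have q_eq: "q = gpt s t" and T: "tangent_space X q = vec.span {gpt_s s t, gpt_t s t}"
    using point_eq_gpt[OF _ ad] tangent_space_frame[OF _ ad] q by (simp_all add: X s_def t_def)
  have "0 \<le> B (nash_expo \<delta> \<kappa>)" if \<kappa>: "?c \<kappa> \<noteq> 0" for \<kappa>
  proof (cases \<kappa>)
    case (Inl k)
    then show ?thesis using nn by (simp add: nash_expo_def B_def)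
  next
    case (Inr lk)
    obtain l k where lk: "lk = (l, k)" by fastforce
    have B_diff: "B (\<delta> k - \<delta> l) = B (\<delta> k) - B (\<delta> l)" by (simp add: B_def cr_diff algebra_simps)
    consider "l = u" | "l = v" "l \<noteq> u" using \<kappa> by (auto simp: Inr lk nash_coeff_def split: if_splits)
    then show ?thesis
    proof cases
      case 1
      then show ?thesis using nn B_diff by (simp add: Inr lk nash_expo_def) (simp add: B_def)
    next
      case 2
      then have "B (\<delta> k) \<noteq> 0" using \<kappa> eps by (auto simp: Inr lk nash_coeff_def B_def)
      moreover have "0 \<le> B (\<delta> k)" using nn by (simp add: B_def)
      ultimately show ?thesis using 2 B_diff by (simp add: Inr lk nash_expo_def)
    qed
  qed
  note B_nonneg = this
  have nn': "0 \<le> B d" if "d \<in> mon (expos ?c (nash_expo \<delta>))" for d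
    using that by (induction rule: mon.induct) (auto simp: AB_add expos_def B_nonneg)
  have "character (mon (expos ?c (nash_expo \<delta>))) (chr s t)"
    unfolding character_def chr_def using nn' s by (auto simp: AB_add power_int_add power_int_add_nonneg)
  then have "(\<chi> \<kappa>. ?c \<kappa> * chr s t (nash_expo \<delta> \<kappa>)) \<in> toric ?c (nash_expo \<delta>)" (is "?p \<in> _")
    by (rule character_point_in_toric)
  moreover have "cr (\<delta> u) (\<delta> v) \<noteq> 0" using det eps by auto
  ultimately have "?p \<in> nash_chart \<delta> u v" by (simp add: nash_chart_def)
  moreover have "basept ?p = q"
    by (simp add: q_eq vec_eq_iff basept_def gpt_def nash_coeff_def nash_expo_def)
  moreover have AB_diff: "A (x - y) = A x - A y" "B (x - y) = B x - B y" for x y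
    by (simp_all add: A_def B_def cr_diff algebra_simps)
  have "prow u ?p = gpt_s s t"
    by (simp add: vec_eq_iff prow_def gpt_s_def chr_s_def chr_def nash_coeff_def nash_expo_def det e1 AB_diff) (simp add: A_def)
  moreover have "prow v ?p = gpt_t s t"
    using uv by (simp add: vec_eq_iff prow_def gpt_t_def chr_t_def chr_def nash_coeff_def nash_expo_def det e1 AB_diff) (simp add: B_def)
  ultimately show ?thesis by (intro bexI[of _ ?p]) (simp_all add: plane_def T)
qed

text \<open>So the closure of the Gauss map on the torus contains the tangent planes at all smooth points.\<close>

lemma gauss_in_closed:
  assumes Z: "closed_in_prod 2 Z" "torus_gauss \<subseteq> Z" and q: "q \<in> X - Sing X"
  shows "(q, tangent_space X q) \<in> Z"
proof -
  have *: "(q, tangent_space X q) \<in> Z"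
    if fr: "frame (\<lambda>_. 1 :: 'k) \<delta> u v \<epsilon>" and nn: "\<And>k. 0 \<le> \<epsilon> * cr (\<delta> u) (\<delta> k)" and qu: "q $ u \<noteq> 0" for u v \<epsilon>
  proof -
    obtain p where p: "p \<in> nash_chart \<delta> u v" "basept p = q" "plane u v p = tangent_space X q"
      using boundary_point[OF fr nn _ qu] q by blast
    have uv: "u \<noteq> v" using frame.det[OF fr] frame.eps[OF fr] by auto
    have "p \<in> chart {u, v} Z" using nash_chart_subset_chart[OF Z uv] p(1) by blast
    then show ?thesis using p chart_pair[OF uv] by metis
  qed
  have "q $ u1 \<noteq> 0 \<or> q $ u2 \<noteq> 0" using singular q by blast
  then show ?thesis
    using *[OF F1.frame_axioms frame1(3)] *[OF F2.frame_axioms frame2(3)] by blast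
qed

lemma torus_gauss_extend_chart:
  assumes "i \<noteq> j" shows "torus_gauss \<subseteq> extend_chart X i j (nash_chart \<delta> i j)"
proof
  fix z assume "z \<in> torus_gauss"
  then obtain x y where z: "z = (tpt x y, tangent_space X (tpt x y))" and xy: "x \<noteq> 0" "y \<noteq> 0"
    by (auto simp: torus_gauss_def)
  have "p \<in> nash_chart \<delta> i j"
    if p: "normal_form i j p" "basept p = tpt x y" "plane i j p = tangent_space X (tpt x y)" for p
  proof (cases "cr (\<delta> i) (\<delta> j) = 0")
    case True
    then show ?thesis using no_chart_tpt[OF True xy p(1)] p(3) by blast
  next
    case False
    then have "p = npt i j x y"
      using npt_chart[OF False xy] p by (intro normal_form_unique[OF assms]) auto
    moreover have "npt i j x y \<in> orbit (nash_coeff \<delta> i j) (nash_expo \<delta>)" using xy by (auto simp: orbit_def)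
    ultimately show ?thesis using False subset_zclosure by (auto simp: nash_chart_def toric_def)
  qed
  moreover have "tangent_space X (tpt x y) \<in> Grassmannian 2"
    using subspace_tangent_space dim_tangent_tpt[OF xy] by (simp add: Grassmannian_def)
  ultimately show "z \<in> extend_chart X i j (nash_chart \<delta> i j)"
    using tpt_in_X[OF xy] by (auto simp: z extend_chart_def)
qed

text \<open>Every closed set with the tangent planes along the torus contains, in the given chart, the closure
  of the corresponding monomial orbit. Conversely \<open>extend_chart\<close> is a closed set that contains the
  Gauss image and is no larger than this closure in the given chart.\<close>

lemma chart_nash_blowup:
  assumes ij: "i \<noteq> j"
  shows "chart {i, j} (nash_blowup X) = nash_chart \<delta> i j"
proof -
  let ?G = "(\<lambda>q. (q, tangent_space X q)) ` (X - Sing X)"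
  let ?C = "\<lambda>Z. closed_in_prod 2 Z \<and> Z \<subseteq> X \<times> Grassmannian 2"
  let ?E = "extend_chart X i j (nash_chart \<delta> i j)"
  have N: "nash_blowup X = ?C hull ?G" by (simp add: nash_blowup_def alg_dim_X)
  have GT: "torus_gauss \<subseteq> ?G"
    using tpt_in_X tpt_nonsingular by (auto simp: torus_gauss_def)
  have "closed_in_prod 2 ?E"
    by (rule closed_extend_chart[OF _ _ ij]) (simp_all add: X toric_def)
  moreover have "?G \<subseteq> ?E" using gauss_in_closed[OF \<open>closed_in_prod 2 ?E\<close> torus_gauss_extend_chart[OF ij]] by blast
  moreover have "?E \<subseteq> X \<times> Grassmannian 2" by (auto simp: extend_chart_def)
  ultimately have NE: "nash_blowup X \<subseteq> ?E" and CE: "?C ?E" "?G \<subseteq> ?E" unfolding N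
    by (simp_all add: hull_minimal)
  show ?thesis
  proof
    show "chart {i, j} (nash_blowup X) \<subseteq> nash_chart \<delta> i j"
    proof
      fix p assume "p \<in> chart {i, j} (nash_blowup X)"
      then have "normal_form i j p" "(basept p, plane i j p) \<in> ?E" using NE by (auto simp: chart_pair[OF ij])
      then show "p \<in> nash_chart \<delta> i j" by (auto simp: extend_chart_def)
    qed
    show "nash_chart \<delta> i j \<subseteq> chart {i, j} (nash_blowup X)"
    proof
      fix p :: "('k, 'n) chart_space" assume p: "p \<in> nash_chart \<delta> i j"
      have *: "p \<in> chart {i, j} Z" if "?C Z" "?G \<subseteq> Z" for Z
        using nash_chart_subset_chart[of Z, OF _ _ ij] that GT p by blast
      then have "normal_form i j p" using CE by (auto simp: chart_pair[OF ij])
      moreover have "(basept p, plane i j p) \<in> nash_blowup X"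
        unfolding N hull_def using * by (auto simp: chart_pair[OF ij])
      ultimately show "p \<in> chart {i, j} (nash_blowup X)" by (simp add: chart_pair[OF ij])
    qed
  qed
qed

lemma nash_blowup_smooth_iff:
  "nash_blowup_smooth X \<longleftrightarrow>
     (\<forall>i j. cr (\<delta> i) (\<delta> j) \<noteq> 0 \<longrightarrow> Sing (toric (nash_coeff \<delta> i j :: _ \<Rightarrow> 'k) (nash_expo \<delta>)) = {})"
proof -
  have "nash_blowup_smooth X \<longleftrightarrow> (\<forall>i j. i \<noteq> j \<longrightarrow> Sing (nash_chart \<delta> i j :: ('k, 'n) chart_space set) = {})"
  proof -
    have "(\<forall>J. card J = 2 \<longrightarrow> P J) \<longleftrightarrow> (\<forall>i j. i \<noteq> j \<longrightarrow> P {i, j})" for P :: "'n set \<Rightarrow> bool"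
      by (auto simp: card_2_iff)
    then show ?thesis
      unfolding nash_blowup_smooth_def smooth_in_prod_def alg_dim_X by (simp add: chart_nash_blowup)
  qed
  also have "\<dots> \<longleftrightarrow> (\<forall>i j. cr (\<delta> i) (\<delta> j) \<noteq> 0 \<longrightarrow> Sing (toric (nash_coeff \<delta> i j :: _ \<Rightarrow> 'k) (nash_expo \<delta>)) = {})"
  proof -
    have "Sing ({} :: ('k, 'n) chart_space set) = {}" by (simp add: Sing_def)
    then have "(i \<noteq> j \<longrightarrow> Sing (nash_chart \<delta> i j :: ('k, 'n) chart_space set) = {}) \<longleftrightarrow>
        (cr (\<delta> i) (\<delta> j) \<noteq> 0 \<longrightarrow> Sing (toric (nash_coeff \<delta> i j :: _ \<Rightarrow> 'k) (nash_expo \<delta>)) = {})" for i j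
      by (cases "i = j"; cases "cr (\<delta> i) (\<delta> j) = 0") (simp_all add: nash_chart_def)
    then show ?thesis by simp
  qed
  finally show ?thesis .
qed

end

section \<open>Units of the chart semigroup\<close>

lemma mon_mono: "G \<subseteq> H \<Longrightarrow> mon G \<subseteq> mon H"
  by (rule mon_subset) (auto intro: mon_base)

lemma mon_multiple: "x \<in> mon G \<Longrightarrow> (int n * fst x, int n * snd x) \<in> mon G"
proof (induction n)
  case 0
  then show ?case using mon_0[of G] by (simp add: zero_prod_def)
next
  case (Suc n)
  then show ?case using mon_add[of x G "(int n * fst x, int n * snd x)"]
    by (simp add: algebra_simps plus_prod_def)
qed

lemma mon_split_cr:
  assumes "y \<in> mon G" "cr y z \<noteq> 0"
  shows "\<exists>l\<in>G. \<exists>x\<in>mon G. y = l + x \<and> cr l z \<noteq> 0"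
  using assms
proof (induction rule: mon.induct)
  case (mon_step g x)
  show ?case
  proof (cases "cr g z = 0")
    case True
    then obtain l x' where "l \<in> G" "x' \<in> mon G" "x = l + x'" "cr l z \<noteq> 0"
      using mon_step by (auto simp: cr_add)
    then show ?thesis using mon_step.hyps mon.mon_step[of g G x'] by (metis add.left_commute)
  qed (use mon_step in blast)
qed simp

lemma mon_split_nonzero:
  assumes "y \<in> mon G" "y \<noteq> 0"
  shows "\<exists>l\<in>G. \<exists>x\<in>mon G. y = l + x"
  using assms by (cases rule: mon.cases) auto

text \<open>Either no exponent has negative \<open>v\<close>-coordinate, and the semigroup is \<open>\<int> u + \<nat> v\<close>; or such an
  exponent, moved along \<open>u\<close>, shows that \<open>v\<close> is invertible, too.\<close>

lemma toric_smooth_unit: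
  fixes c :: "'v::finite \<Rightarrow> 'k::field_char_0"
  assumes uv: "u \<in> expos c \<delta>" "v \<in> expos c \<delta>" and det: "cr u v = \<epsilon>" "\<epsilon> * \<epsilon> = 1"
    and un: "- u \<in> mon (expos c \<delta>)"
  shows "Sing (toric c \<delta>) = {}"
proof -
  let ?S = "mon (expos c \<delta>)"
  obtain iu iv where iu: "u = \<delta> iu" "c iu \<noteq> 0" and iv: "v = \<delta> iv" "c iv \<noteq> 0"
    using uv by (auto simp: expos_def)
  have "(\<forall>k. c k \<noteq> 0 \<longrightarrow> 0 \<le> \<epsilon> * cr u (\<delta> k)) \<or> - v \<in> ?S"
  proof (rule disjCI)
    assume "- v \<notin> ?S"
    show "\<forall>k. c k \<noteq> 0 \<longrightarrow> 0 \<le> \<epsilon> * cr u (\<delta> k)"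
    proof (intro allI impI, rule ccontr)
      fix k assume k: "c k \<noteq> 0" and neg: "\<not> 0 \<le> \<epsilon> * cr u (\<delta> k)"
      define d where "d = \<delta> k"
      define A B where "A = \<epsilon> * cr d v" and "B = \<epsilon> * cr u d"
      have d: "d \<in> ?S" using k by (auto simp: d_def expos_def intro: mon_base)
      have "A * fst u + B * fst v = \<epsilon> * cr u v * fst d" "A * snd u + B * snd v = \<epsilon> * cr u v * snd d"
        by (simp_all add: A_def B_def cr_def algebra_simps)
      then have exp: "fst d = A * fst u + B * fst v" "snd d = A * snd u + B * snd v"
        using det by simp_all
      have B: "B < 0" using neg by (simp add: B_def d_def)
      \<comment> \<open>\<open>- v = d + (- B - 1) v - A u\<close>, and \<open>u\<close> is invertible.\<close>
      have "(int (nat (- B - 1)) * fst v, int (nat (- B - 1)) * snd v) \<in> ?S"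
        by (rule mon_multiple) (use uv in \<open>auto intro: mon_base\<close>)
      moreover have "(int (nat A) * fst (- u), int (nat A) * snd (- u)) \<in> ?S"
        by (rule mon_multiple) (rule un)
      moreover have "(int (nat (- A)) * fst u, int (nat (- A)) * snd u) \<in> ?S"
        by (rule mon_multiple) (use uv in \<open>auto intro: mon_base\<close>)
      ultimately have "d + ((int (nat (- B - 1)) * fst v, int (nat (- B - 1)) * snd v)
          + ((int (nat A) * fst (- u), int (nat A) * snd (- u)) + (int (nat (- A)) * fst u, int (nat (- A)) * snd u))) \<in> ?S"
        by (intro mon_add d)
      moreover have "d + ((int (nat (- B - 1)) * fst v, int (nat (- B - 1)) * snd v)
          + ((int (nat A) * fst (- u), int (nat A) * snd (- u)) + (int (nat (- A)) * fst u, int (nat (- A)) * snd u))) = - v"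
        using B exp by (cases "A \<ge> 0") (simp_all add: prod_eq_iff algebra_simps)
      ultimately show False using \<open>- v \<notin> ?S\<close> by simp
    qed
  qed
  then show ?thesis
    using un det iu iv by (intro toric_smooth[of \<delta> iu iv \<epsilon> c]) auto
qed

section \<open>Hirzebruch--Jung sequences\<close>

definition lin :: "(int \<times> int \<Rightarrow> int) \<Rightarrow> bool" where
  "lin f \<longleftrightarrow> (\<exists>p q. \<forall>d. f d = p * fst d + q * snd d)"

lemma linE:
  assumes "lin f" obtains p q where "f = (\<lambda>d. p * fst d + q * snd d)"
  using assms by (metis lin_def ext)

lemma lin_add: "lin f \<Longrightarrow> f (x + y) = f x + f y"
  and lin_diff: "lin f \<Longrightarrow> f (x - y) = f x - f y"
  and lin_0: "lin f \<Longrightarrow> f 0 = 0"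
  by (auto elim!: linE simp: algebra_simps)

lemma lin_cr_comb: "lin (\<lambda>d. e * (x * cr d z + y * cr z' d))"
  unfolding lin_def cr_def
  by (intro exI[of _ "e * (x * snd z - y * snd z')"] exI[of _ "e * (y * fst z' - x * fst z)"]) (simp add: algebra_simps)

lemma lin_cr: "lin (\<lambda>d. e * cr d z)" "lin (\<lambda>d. e * cr z d)"
  using lin_cr_comb[of e 1 z 0 0] lin_cr_comb[of e 0 0 1 z] by simp_all

lemma lin_mon_nonneg: "lin f \<Longrightarrow> (\<And>g. g \<in> G \<Longrightarrow> 0 \<le> f g) \<Longrightarrow> x \<in> mon G \<Longrightarrow> 0 \<le> f x"
proof -
  assume f: "lin f" "\<And>g. g \<in> G \<Longrightarrow> 0 \<le> f g" and "x \<in> mon G"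
  from this(3) show ?thesis by (induction rule: mon.induct) (use f in \<open>auto simp: lin_add lin_0\<close>)
qed

lemma atom_of_level_one:
  assumes f: "lin f" and pos: "\<And>g. g \<in> G \<Longrightarrow> g \<noteq> 0 \<Longrightarrow> 0 < f g" and d: "d \<in> mon G" "f d = 1"
  shows "atom (mon G) d"
  unfolding atom_def
proof (intro conjI ballI impI)
  show "d \<noteq> 0" using d lin_0[OF f] by auto
  fix x y assume "x \<in> mon G" "y \<in> mon G" "x + y = d"
  moreover from this have "f x + f y = 1" using lin_add[OF f, of x y] d by simp
  moreover have "0 < f x" if "x \<in> mon G" "x \<noteq> 0" for x
    by (rule mon_positive[where lev = f, OF lin_add[OF f] pos that])
  ultimately show "x = 0 \<or> y = 0" by (smt (verit))
qed fact

text \<open>The sign \<open>\<epsilon>\<close> is \<open>1\<close> or \<open>-1\<close>, so that the reversed sequence is of the same kind and statements about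
  the left neighbours follow from those about the right ones.\<close>

locale hirzebruch =
  fixes \<epsilon> :: int and m :: nat and b :: "nat \<Rightarrow> int" and g :: "nat \<Rightarrow> int \<times> int"
  assumes eps: "\<epsilon> * \<epsilon> = 1" and m: "1 \<le> m"
    and det: "k \<le> m \<Longrightarrow> cr (g k) (g (Suc k)) = \<epsilon>"
    and rec_fst: "k < m \<Longrightarrow> fst (g (Suc (Suc k))) = b (Suc k) * fst (g (Suc k)) - fst (g k)"
    and rec_snd: "k < m \<Longrightarrow> snd (g (Suc (Suc k))) = b (Suc k) * snd (g (Suc k)) - snd (g k)"
    and b2: "k < m \<Longrightarrow> 2 \<le> b (Suc k)"
begin

lemma rev: "hirzebruch (- \<epsilon>) m (\<lambda>k. b (Suc m - k)) (\<lambda>k. g (Suc m - k))"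
proof
  fix k assume "k \<le> m"
  then have "cr (g (m - k)) (g (Suc (m - k))) = \<epsilon>" by (intro det) simp
  moreover have "cr (g (Suc (m - k))) (g (m - k)) = - cr (g (m - k)) (g (Suc (m - k)))"
    by (simp add: cr_def)
  ultimately show "cr (g (Suc m - k)) (g (Suc m - Suc k)) = - \<epsilon>"
    using \<open>k \<le> m\<close> by (simp add: Suc_diff_le)
next
  fix k assume k: "k < m"
  then have e: "Suc m - Suc (Suc k) = m - Suc k" "Suc m - Suc k = Suc (m - Suc k)" "Suc m - k = Suc (Suc (m - Suc k))"
    by auto
  have "m - Suc k < m" using k by simp
  from rec_fst[OF this] rec_snd[OF this] b2[OF this]
  show "fst (g (Suc m - Suc (Suc k))) = b (Suc m - Suc k) * fst (g (Suc m - Suc k)) - fst (g (Suc m - k))"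
    "snd (g (Suc m - Suc (Suc k))) = b (Suc m - Suc k) * snd (g (Suc m - Suc k)) - snd (g (Suc m - k))"
    "2 \<le> b (Suc m - Suc k)"
    unfolding e by simp_all
qed (use eps m in auto)

lemma lin_rec:
  assumes "lin f" "k < m"
  shows "f (g (Suc (Suc k))) = b (Suc k) * f (g (Suc k)) - f (g k)"
proof -
  obtain p q where f: "f = (\<lambda>d. p * fst d + q * snd d)" using assms by (auto elim: linE)
  show ?thesis unfolding f rec_fst[OF assms(2)] rec_snd[OF assms(2)] by (simp add: algebra_simps)
qed

text \<open>Because of \<open>b \<ge> 2\<close>, a linear functional that starts to grow along the sequence continues to do so.
  Bounds on all generators thus reduce to bounds on the nearest ones.\<close>

lemma convex_step:
  assumes f: "lin f" and k: "k < m" and le: "f (g k) \<le> f (g (Suc k))" "0 \<le> f (g (Suc k))"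
  shows "f (g (Suc k)) \<le> f (g (Suc (Suc k)))"
proof -
  have "2 * f (g (Suc k)) \<le> b (Suc k) * f (g (Suc k))"
    using b2[OF k] le by (intro mult_right_mono) auto
  then show ?thesis using lin_rec[OF f k] le by simp
qed

lemma convex_up:
  assumes f: "lin f" and k: "f (g k) \<le> f (g (Suc k))" "0 \<le> f (g (Suc k))" and l: "Suc k \<le> l" "l \<le> Suc m"
  shows "f (g (Suc k)) \<le> f (g l)"
proof -
  have "f (g (l - 1)) \<le> f (g l) \<and> f (g (Suc k)) \<le> f (g l)"
    using l
  proof (induction l rule: dec_induct)
    case base
    then show ?case using k by simp
  next
    case (step l)
    then have "f (g (l - 1)) \<le> f (g l)" "f (g (Suc k)) \<le> f (g l)" by auto
    moreover obtain l' where l': "l = Suc l'" using step(1) by (cases l) auto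
    ultimately have "f (g l) \<le> f (g (Suc l))"
      using convex_step[OF f, of l'] step.prems k by auto
    then show ?case using step by auto
  qed
  then show ?thesis by simp
qed

lemma right_bound:
  assumes f: "lin f" and s: "s < m \<Longrightarrow> M \<le> f (g (Suc (Suc s)))" "f (g (Suc s)) \<le> M" "0 \<le> M"
    and k: "Suc (Suc s) \<le> k" "k \<le> Suc m"
  shows "M \<le> f (g k)"
proof -
  have "s < m" using k by simp
  then have "M \<le> f (g (Suc (Suc s)))" by (rule s(1))
  moreover from this have "f (g (Suc (Suc s))) \<le> f (g k)"
    using s(2,3) by (intro convex_up[OF f _ _ k]) auto
  ultimately show ?thesis by simp
qed

lemma left_bound:
  assumes f: "lin f" and s: "0 < s \<Longrightarrow> M \<le> f (g (s - 1))" "f (g s) \<le> M" "0 \<le> M" "s \<le> m"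
    and k: "k < s"
  shows "M \<le> f (g k)"
proof -
  interpret R: hirzebruch "- \<epsilon>" m "\<lambda>k. b (Suc m - k)" "\<lambda>k. g (Suc m - k)" by (rule rev)
  have e: "Suc m - Suc (Suc (m - s)) = s - 1" "Suc m - Suc (m - s) = s" using s(4) by auto
  have "M \<le> f (g (Suc m - (Suc m - k)))"
  proof (rule R.right_bound[OF f, where s = "m - s"])
    show "M \<le> f (g (Suc m - Suc (Suc (m - s))))" unfolding e using s(1) k by simp
    show "f (g (Suc m - Suc (m - s))) \<le> M" unfolding e by (rule s(2))
    show "Suc (Suc (m - s)) \<le> Suc m - k" using s(4) k by linarith
  qed (use s in auto)
  then show ?thesis using s k by simp
qed

text \<open>The linear functional with the values \<open>x, y\<close> at the basis \<open>g s, g (s + 1)\<close>.\<close>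

definition val :: "nat \<Rightarrow> int \<Rightarrow> int \<Rightarrow> int \<times> int \<Rightarrow> int" where
  "val s x y = (\<lambda>d. \<epsilon> * (x * cr d (g (Suc s)) + y * cr (g s) d))"

lemma lin_val [simp]: "lin (val s x y)"
  unfolding val_def by (rule lin_cr_comb)

lemma val_base [simp]:
  assumes "s \<le> m" shows "val s x y (g s) = x" "val s x y (g (Suc s)) = y"
  using det[OF assms] eps by (simp_all add: val_def algebra_simps)

lemma val_right [simp]: "s < m \<Longrightarrow> val s x y (g (Suc (Suc s))) = b (Suc s) * y - x"
  using lin_rec[OF lin_val, of s s x y] by simp

lemma val_left [simp]:
  assumes "0 < s" "s \<le> m" shows "val s x y (g (s - Suc 0)) = b s * x - y"
proof -
  obtain s' where "s = Suc s'" using assms(1) by (cases s) auto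
  then show ?thesis using lin_rec[OF lin_val, of s' s x y] assms by simp
qed

lemma val_determines: "s \<le> m \<Longrightarrow> val s 1 0 d = 0 \<Longrightarrow> val s 0 1 d = 0 \<Longrightarrow> d = 0"
proof -
  assume s: "s \<le> m" and z: "val s 1 0 d = 0" "val s 0 1 d = 0"
  have "\<epsilon> \<noteq> 0" using eps by auto
  then have z': "cr d (g (Suc s)) = 0" "cr (g s) d = 0" using z by (simp_all add: val_def)
  have "fst d * cr (g s) (g (Suc s)) = cr d (g (Suc s)) * fst (g s) + cr (g s) d * fst (g (Suc s))"
    "snd d * cr (g s) (g (Suc s)) = cr d (g (Suc s)) * snd (g s) + cr (g s) d * snd (g (Suc s))"
    by (simp_all add: cr_def algebra_simps)
  then show "d = 0" using z' det[OF s] \<open>\<epsilon> \<noteq> 0\<close> by (simp add: prod_eq_iff)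
qed

lemma val_sum: "val s (x + x') (y + y') d = val s x y d + val s x' y' d"
  by (simp add: val_def algebra_simps)

lemma cr_pos:
  assumes "a < c" "c \<le> Suc m" shows "0 < \<epsilon> * cr (g a) (g c)"
proof -
  have "\<epsilon> * cr (g a) (g (Suc a)) \<le> \<epsilon> * cr (g a) (g c)"
    using assms det[of a] eps by (intro convex_up[OF lin_cr(2)]) auto
  then show ?thesis using det[of a] assms eps by simp
qed

lemma cr_nonzero: "a \<noteq> c \<Longrightarrow> a \<le> Suc m \<Longrightarrow> c \<le> Suc m \<Longrightarrow> cr (g a) (g c) \<noteq> 0"
proof (cases "a < c")
  case False
  assume "a \<noteq> c" "a \<le> Suc m"
  then have "0 < \<epsilon> * cr (g c) (g a)" using False by (intro cr_pos) auto
  then show ?thesis by (auto simp: cr_def algebra_simps)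
qed (use cr_pos[of a c] in auto)

lemma b_ge_2: "0 < k \<Longrightarrow> k \<le> m \<Longrightarrow> 2 \<le> b k"
  using b2[of "k - 1"] by simp

abbreviation gens :: "(int \<times> int) set" where "gens \<equiv> g ` {..Suc m}"

lemma level_positive:
  assumes "s \<le> m" "k \<le> Suc m" shows "1 \<le> val s 1 1 (g k)"
proof -
  consider "k < s" | "k = s" | "k = Suc s" | "Suc (Suc s) \<le> k" by linarith
  then show ?thesis
  proof cases
    case 1
    show ?thesis by (rule left_bound[of _ s]) (use 1 assms b_ge_2[of s] in auto)
  next
    case 4
    show ?thesis by (rule right_bound[of _ s]) (use 4 assms b2[of s] in auto)
  qed (use assms in auto)
qed

text \<open>The functional with value \<open>1\<close> at two adjacent generators is at least \<open>1\<close> at all of them.\<close>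

lemma atom_gens:
  assumes k: "k \<le> Suc m" shows "atom (mon gens) (g k)"
proof (rule atom_of_level_one[where f = "val (min k m) 1 1"])
  show "0 < val (min k m) 1 1 x" if "x \<in> gens" for x
    using that level_positive[of "min k m"] by fastforce
  show "val (min k m) 1 1 (g k) = 1" using k by (cases "k \<le> m") (auto simp: min_def le_Suc_eq)
qed (use k in \<open>auto intro!: mon_base\<close>)

text \<open>The difference \<open>g (k + 1) - g k\<close> exceeds its predecessor by \<open>(b k - 2) g k\<close>.\<close>

lemma increments:
  assumes "s \<le> l" "l \<le> m"
  shows "\<exists>y\<in>mon gens. g (Suc l) - g l = g (Suc s) - g s + y"
  using assms
proof (induction l rule: dec_induct)
  case base
  show ?case using mon_0 by force
next
  case (step l)
  then obtain y where y: "y \<in> mon gens" "g (Suc l) - g l = g (Suc s) - g s + y" by auto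
  have l: "l < m" using step by simp
  let ?n = "nat (b (Suc l) - 2)"
  have "(int ?n * fst (g (Suc l)), int ?n * snd (g (Suc l))) \<in> mon gens" (is "?z \<in> _")
    using l by (intro mon_multiple mon_base) auto
  then have "?z + y \<in> mon gens" using y by (intro mon_add)
  moreover have "g (Suc (Suc l)) - g (Suc l) = g (Suc s) - g s + (?z + y)"
    using y(2) b2[OF l] rec_fst[OF l] rec_snd[OF l] by (simp add: prod_eq_iff algebra_simps)
  ultimately show ?case by blast
qed

text \<open>The exponents of the chart that belongs to \<open>g s\<close> and \<open>g t\<close>. The differences \<open>g t - g s\<close> and
  \<open>g s - g t\<close> are excluded because their coefficients in the chart vanish.\<close>

definition rset :: "nat \<Rightarrow> nat \<Rightarrow> (int \<times> int) set" where
  "rset s t = gens \<union> {g k - g s | k. k \<le> Suc m \<and> k \<noteq> t} \<union> {g k - g t | k. k \<le> Suc m \<and> k \<noteq> s}"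

lemma rset_cases:
  assumes "x \<in> rset s (Suc s)" "s \<le> m"
  obtains "x = 0" | "x = g s" | "x = g (Suc s)"
  | (right) k where "Suc (Suc s) \<le> k" "k \<le> Suc m" "x \<in> {g k, g k - g s, g k - g (Suc s)}"
  | (left) k where "k < s" "x \<in> {g k, g k - g s, g k - g (Suc s)}"
proof -
  obtain k where k: "k \<le> Suc m" "x = g k \<or> (x = g k - g s \<and> k \<noteq> Suc s) \<or> (x = g k - g (Suc s) \<and> k \<noteq> s)"
    using assms by (auto simp: rset_def)
  consider "k < s" | "k = s" | "k = Suc s" | "Suc (Suc s) \<le> k" by linarith
  then show ?thesis
    by cases (use k that in auto)
qed

lemma rset_nonneg:
  assumes f: "lin f" and s: "s \<le> m"
    and M: "0 \<le> f (g s)" "0 \<le> f (g (Suc s))" "f (g s) \<le> M" "f (g (Suc s)) \<le> M"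
    and R: "s < m \<Longrightarrow> M \<le> f (g (Suc (Suc s)))" and L: "0 < s \<Longrightarrow> M \<le> f (g (s - 1))"
    and x: "x \<in> rset s (Suc s)"
  shows "0 \<le> f x"
  using x s
proof (cases rule: rset_cases)
  case (right k)
  have "M \<le> f (g k)" by (rule right_bound[OF f, of s]) (use right M R in auto)
  then show ?thesis using right M by (auto simp: lin_diff[OF f])
next
  case (left k)
  have "M \<le> f (g k)" by (rule left_bound[OF f, of s]) (use left M L s in auto)
  then show ?thesis using left M by (auto simp: lin_diff[OF f])
qed (use M in \<open>auto simp: lin_0[OF f]\<close>)

lemma rset_positive:
  assumes f: "lin f" and s: "s \<le> m"
    and M: "0 < f (g s)" "0 < f (g (Suc s))" "f (g s) < M" "f (g (Suc s)) < M"
    and R: "s < m \<Longrightarrow> M \<le> f (g (Suc (Suc s)))" and L: "0 < s \<Longrightarrow> M \<le> f (g (s - 1))"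
    and x: "x \<in> rset s (Suc s)" "x \<noteq> 0"
  shows "0 < f x"
  using x(1) s
proof (cases rule: rset_cases)
  case (right k)
  have "M \<le> f (g k)" by (rule right_bound[OF f, of s]) (use right M R in auto)
  then show ?thesis using right M by (auto simp: lin_diff[OF f])
next
  case (left k)
  have "M \<le> f (g k)" by (rule left_bound[OF f, of s]) (use left M L s in auto)
  then show ?thesis using left M by (auto simp: lin_diff[OF f])
qed (use M x in auto)

lemma rset_rev:
  assumes "s \<le> m"
  shows "hirzebruch.rset m (\<lambda>k. g (Suc m - k)) (m - s) (Suc (m - s)) = rset s (Suc s)"
proof -
  interpret R: hirzebruch "- \<epsilon>" m "\<lambda>k. b (Suc m - k)" "\<lambda>k. g (Suc m - k)" by (rule rev)
  have e: "Suc m - (m - s) = Suc s" "Suc m - Suc (m - s) = s" using assms by auto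
  have reflect: "{h (Suc m - k) | k. k \<le> Suc m \<and> k \<noteq> t} = {h k | k. k \<le> Suc m \<and> k \<noteq> Suc m - t}"
    if t: "t \<le> Suc m" for h :: "nat \<Rightarrow> int \<times> int" and t
  proof (intro equalityI subsetI)
    fix x assume "x \<in> {h (Suc m - k) | k. k \<le> Suc m \<and> k \<noteq> t}"
    then obtain k where "k \<le> Suc m" "k \<noteq> t" "x = h (Suc m - k)" by blast
    then show "x \<in> {h k | k. k \<le> Suc m \<and> k \<noteq> Suc m - t}"
      using t by (intro CollectI exI[of _ "Suc m - k"]) auto
  next
    fix x assume "x \<in> {h k | k. k \<le> Suc m \<and> k \<noteq> Suc m - t}"
    then obtain k where "k \<le> Suc m" "k \<noteq> Suc m - t" "x = h k" by blast
    then show "x \<in> {h (Suc m - k) | k. k \<le> Suc m \<and> k \<noteq> t}"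
      using t by (intro CollectI exI[of _ "Suc m - k"]) auto
  qed
  have "(\<lambda>k. Suc m - k) ` {..Suc m} = {..Suc m}"
  proof
    show "{..Suc m} \<subseteq> (\<lambda>k. Suc m - k) ` {..Suc m}"
      by (rule subsetI, rule_tac x = "Suc m - x" in image_eqI) auto
  qed auto
  then have 1: "(\<lambda>k. g (Suc m - k)) ` {..Suc m} = gens"
    by (metis (no_types, lifting) image_cong image_image)
  have 2: "{g (Suc m - k) - y | k. k \<le> Suc m \<and> k \<noteq> Suc (m - s)} = {g k - y | k. k \<le> Suc m \<and> k \<noteq> s}"
    "{g (Suc m - k) - y | k. k \<le> Suc m \<and> k \<noteq> m - s} = {g k - y | k. k \<le> Suc m \<and> k \<noteq> Suc s}" for y
    using reflect[of "Suc (m - s)" "\<lambda>k. g k - y"] reflect[of "m - s" "\<lambda>k. g k - y"] assms unfolding e by simp_all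
  show ?thesis unfolding R.rset_def rset_def 1 e 2 by blast
qed

subsection \<open>Adjacent pairs of generators\<close>

lemma smooth_adjacent_basis:
  fixes c :: "'v::finite \<Rightarrow> 'k::field_char_0"
  assumes E: "rset s (Suc s) \<subseteq> expos c \<delta>" "expos c \<delta> \<subseteq> mon (rset s (Suc s))"
    and uv: "u \<in> rset s (Suc s)" "v \<in> rset s (Suc s)" "cr u v = \<epsilon>"
    and nonneg: "\<And>x. x \<in> rset s (Suc s) \<Longrightarrow> 0 \<le> \<epsilon> * cr x v \<and> 0 \<le> \<epsilon> * cr u x"
  shows "Sing (toric c \<delta>) = {}"
proof -
  have "u \<in> expos c \<delta>" "v \<in> expos c \<delta>" using E(1) uv by blast+
  then obtain iu iv where iu: "\<delta> iu = u" "c iu \<noteq> 0" and iv: "\<delta> iv = v" "c iv \<noteq> 0"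
    unfolding expos_def by (metis (mono_tags, lifting) imageE mem_Collect_eq)
  have "0 \<le> \<epsilon> * cr (\<delta> k) v" "0 \<le> \<epsilon> * cr u (\<delta> k)" if "c k \<noteq> 0" for k
  proof -
    have k: "\<delta> k \<in> mon (rset s (Suc s))" using that E(2) by (auto simp: expos_def)
    show "0 \<le> \<epsilon> * cr (\<delta> k) v" by (rule lin_mon_nonneg[OF lin_cr(1) _ k]) (use nonneg in blast)
    show "0 \<le> \<epsilon> * cr u (\<delta> k)" by (rule lin_mon_nonneg[OF lin_cr(2) _ k]) (use nonneg in blast)
  qed
  then show ?thesis using iu iv uv(3) eps by (intro toric_smooth[of \<delta> iu iv \<epsilon> c]) auto
qed

text \<open>In the basis \<open>g s, g (s + 1)\<close>, the exponents \<open>g (s - 1) - g s = (1, -1)\<close> and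
  \<open>g (s + 2) - g s = (-2, 3)\<close> form a basis that generates the whole semigroup of the chart; the dual
  functionals are \<open>3 x + 2 y\<close> and \<open>x + y\<close>.\<close>

lemma smooth_adjacent_2_3:
  fixes c :: "'v::finite \<Rightarrow> 'k::field_char_0"
  assumes s: "0 < s" "s < m" "b s = 2" "b (Suc s) = 3"
    and E: "rset s (Suc s) \<subseteq> expos c \<delta>" "expos c \<delta> \<subseteq> mon (rset s (Suc s))"
  shows "Sing (toric c \<delta>) = {}"
proof -
  let ?u = "g (s - 1) - g s" and ?v = "g (Suc (Suc s)) - g s"
  obtain s' where s': "s = Suc s'" using s by (cases s) auto
  have u: "?u = g s - g (Suc s)"
    using rec_fst[of s'] rec_snd[of s'] s by (simp add: s' prod_eq_iff)
  have cr_u: "cr ?u d = cr (g s) d - cr (g (Suc s)) d" for d unfolding u by (rule cr_diff)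
  have cr_v: "cr d ?v = 3 * cr d (g (Suc s)) - 2 * cr d (g s)" for d
    unfolding cr_def fst_diff snd_diff rec_fst[OF s(2)] rec_snd[OF s(2)] s(4) by (simp add: algebra_simps)
  have cr_swap: "cr x y = - cr y x" for x y by (simp add: cr_def)
  have coords: "\<epsilon> * cr d ?v = val s 3 2 d" "\<epsilon> * cr ?u d = val s 1 1 d" for d
    unfolding val_def cr_v cr_u by (simp_all add: cr_def algebra_simps)
  show ?thesis
  proof (rule smooth_adjacent_basis[OF E])
    show "?u \<in> rset s (Suc s)" "?v \<in> rset s (Suc s)" using s by (auto simp: rset_def)
    show "cr ?u ?v = \<epsilon>" unfolding cr_u cr_v using det[of s] s cr_swap[of "g (Suc s)" "g s"] by simp
    fix x assume x: "x \<in> rset s (Suc s)"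
    have "0 \<le> val s 3 2 x" by (rule rset_nonneg[where s = s and M = 3]) (use s x in auto)
    moreover have "0 \<le> val s 1 1 x" by (rule rset_nonneg[where s = s and M = 1]) (use s x in auto)
    ultimately show "0 \<le> \<epsilon> * cr x ?v \<and> 0 \<le> \<epsilon> * cr ?u x" unfolding coords by blast
  qed
qed

text \<open>Without left neighbours, \<open>(1, 0)\<close> and \<open>(-1, 1)\<close> generate the semigroup of the chart, and the dual
  functionals are \<open>x + y\<close> and \<open>y\<close>.\<close>

lemma smooth_adjacent_end_2:
  fixes c :: "'v::finite \<Rightarrow> 'k::field_char_0"
  assumes b1: "b (Suc 0) = 2"
    and E: "rset 0 (Suc 0) \<subseteq> expos c \<delta>" "expos c \<delta> \<subseteq> mon (rset 0 (Suc 0))"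
  shows "Sing (toric c \<delta>) = {}"
proof -
  let ?u = "g 0" and ?v = "g (Suc (Suc 0)) - g (Suc 0)"
  have m0: "0 < m" using m by simp
  have cr_v: "cr d ?v = cr d (g (Suc 0)) - cr d (g 0)" for d
    unfolding cr_def fst_diff snd_diff rec_fst[OF m0] rec_snd[OF m0] b1 by (simp add: algebra_simps)
  have coords: "\<epsilon> * cr d ?v = val 0 1 1 d" "\<epsilon> * cr ?u d = val 0 0 1 d" for d
    unfolding val_def cr_v by (simp_all add: cr_def algebra_simps)
  show ?thesis
  proof (rule smooth_adjacent_basis[OF E])
    show "?u \<in> rset 0 (Suc 0)" "?v \<in> rset 0 (Suc 0)" using m by (auto simp: rset_def)
    show "cr ?u ?v = \<epsilon>" unfolding cr_v using det[of 0] by simp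
    fix x assume x: "x \<in> rset 0 (Suc 0)"
    have "0 \<le> val 0 1 1 x" by (rule rset_nonneg[where s = 0 and M = 1]) (use b1 x in auto)
    moreover have "0 \<le> val 0 0 1 x" by (rule rset_nonneg[where s = 0 and M = 1]) (use b1 x in auto)
    ultimately show "0 \<le> \<epsilon> * cr x ?v \<and> 0 \<le> \<epsilon> * cr ?u x" unfolding coords by blast
  qed
qed

text \<open>Here \<open>g (s - 1)\<close>, \<open>g s\<close>, \<open>g (s + 1)\<close>, \<open>g (s + 2)\<close> are equally spaced on a line, so the exponents
  \<open>g (s - 1) - g s\<close> and \<open>g (s + 2) - g (s + 1)\<close> are inverse to each other.\<close>

lemma smooth_adjacent_2_2:
  fixes c :: "'v::finite \<Rightarrow> 'k::field_char_0"
  assumes s: "0 < s" "s < m" "b s = 2" "b (Suc s) = 2" and E: "rset s (Suc s) \<subseteq> expos c \<delta>"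
  shows "Sing (toric c \<delta>) = {}"
proof -
  obtain s' where s': "s = Suc s'" using s by (cases s) auto
  have u: "g (s - 1) - g s = - (g (Suc s) - g s)"
    using rec_fst[of s'] rec_snd[of s'] s by (simp add: s' prod_eq_iff)
  have v: "g (Suc (Suc s)) - g (Suc s) = g (Suc s) - g s"
    using rec_fst[of s] rec_snd[of s] s by (simp add: prod_eq_iff)
  have "g (s - 1) - g s \<in> rset s (Suc s)" "g (Suc (Suc s)) - g (Suc s) \<in> rset s (Suc s)" "g s \<in> rset s (Suc s)"
    using s by (auto simp: rset_def)
  then have "g (Suc s) - g s \<in> expos c \<delta>" "g s \<in> expos c \<delta>" "- (g (Suc s) - g s) \<in> mon (expos c \<delta>)"
    using E unfolding u v by (auto intro: mon_base)
  moreover have "cr (g (Suc s) - g s) (g s) = - \<epsilon>"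
    using det[of s] s by (simp add: cr_def algebra_simps)
  ultimately show ?thesis using eps by (intro toric_smooth_unit[where \<epsilon> = "- \<epsilon>"]) auto
qed

text \<open>The exponent \<open>g (s + 1) - g s\<close> is invertible: as the increments of the sequence only grow by elements
  of the cone, its inverse is \<open>g (t - 1) - g t\<close> plus an element of the cone.\<close>

lemma smooth_distant:
  fixes c :: "'v::finite \<Rightarrow> 'k::field_char_0"
  assumes st: "Suc s < t" "t \<le> Suc m" and E: "rset s t \<subseteq> expos c \<delta>"
  shows "Sing (toric c \<delta>) = {}"
proof -
  obtain l where l: "t = Suc l" "s < l" "l \<le> m" using st by (cases t) auto
  obtain y where y: "y \<in> mon gens" "g t - g l = g (Suc s) - g s + y"
    using increments[of s l] l by auto
  have "gens \<subseteq> rset s t" by (auto simp: rset_def)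
  then have gE: "mon gens \<subseteq> mon (expos c \<delta>)" using E by (intro mon_mono) auto
  have "g (Suc s) - g s \<in> rset s t" "g l - g t \<in> rset s t" "g s \<in> rset s t"
    using l st by (auto simp: rset_def)
  then have *: "g (Suc s) - g s \<in> expos c \<delta>" "g s \<in> expos c \<delta>" "g l - g t \<in> mon (expos c \<delta>)"
    using E by (auto intro: mon_base)
  have "(g l - g t) + y \<in> mon (expos c \<delta>)" using * y gE by (intro mon_add) auto
  moreover have "(g l - g t) + y = - (g (Suc s) - g s)"
    using y(2) by (simp add: prod_eq_iff)
  ultimately have "- (g (Suc s) - g s) \<in> mon (expos c \<delta>)" by simp
  moreover have "cr (g (Suc s) - g s) (g s) = - \<epsilon>"
    using det[of s] l by (simp add: cr_def algebra_simps)
  ultimately show ?thesis using eps * by (intro toric_smooth_unit[where \<epsilon> = "- \<epsilon>"]) auto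
qed

text \<open>A generator contained in \<open>x\<close> is invertible, and it forms a basis with a neighbour.\<close>

lemma smooth_negative_element:
  fixes c :: "'v::finite \<Rightarrow> 'k::field_char_0"
  assumes E: "gens \<subseteq> expos c \<delta>" and x: "x \<in> mon gens" "x \<noteq> 0" "- x \<in> mon (expos c \<delta>)"
  shows "Sing (toric c \<delta>) = {}"
proof -
  obtain k y where k: "k \<le> Suc m" and y: "y \<in> mon gens" "x = g k + y" using mon_split_nonzero[OF x(1,2)] by auto
  have "y + (- x) \<in> mon (expos c \<delta>)" using y x E mon_mono by (intro mon_add) auto
  then have un: "- g k \<in> mon (expos c \<delta>)" using y by simp
  show ?thesis
  proof (cases "k \<le> m")
    case True
    then show ?thesis using E un det[OF True] eps by (intro toric_smooth_unit[of "g k" _ _ "g (Suc k)" \<epsilon>]) auto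
  next
    case False
    then have "k = Suc m" using k by simp
    moreover have "cr (g (Suc m)) (g m) = - \<epsilon>" using det[of m] by (simp add: cr_def algebra_simps)
    ultimately show ?thesis using E un eps by (intro toric_smooth_unit[of "g k" _ _ "g m" "- \<epsilon>"]) auto
  qed
qed

text \<open>The functional \<open>h\<close> certifies that \<open>d1\<close> and \<open>d2\<close> do not generate \<open>z\<close>; so there is a third atom.\<close>

lemma singular_from_two_atoms:
  fixes c :: "'v::finite \<Rightarrow> 'k::field_char_0"
  assumes E: "rset s (Suc s) \<subseteq> expos c \<delta>" "expos c \<delta> \<subseteq> mon (rset s (Suc s))"
    and f: "lin f" "\<And>x. x \<in> rset s (Suc s) \<Longrightarrow> x \<noteq> 0 \<Longrightarrow> 0 < f x"
    and a: "atom (mon (rset s (Suc s))) d1" "atom (mon (rset s (Suc s))) d2" "d1 \<noteq> d2"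
    and h: "lin h" "0 \<le> h d1" "0 \<le> h d2" "z \<in> rset s (Suc s)" "h z < 0"
  shows "Sing (toric c \<delta>) \<noteq> {}"
proof -
  let ?S = "mon (rset s (Suc s))"
  have S: "mon (expos c \<delta>) = ?S" using E mon_mono mon_subset by blast
  have "z \<notin> mon {d1, d2}" using lin_mon_nonneg[OF h(1), of "{d1, d2}" z] h by auto
  then obtain d3 where d3: "atom ?S d3" "d3 \<notin> mon {d1, d2}"
    using ex_further_atom[where lev = f, OF lin_add[OF f(1)] f(2)] mon_base[OF h(4)] by blast
  have "d3 \<noteq> d1" "d3 \<noteq> d2" using d3(2) mon_base[of d1 "{d1, d2}"] mon_base[of d2 "{d1, d2}"] by blast+
  then have "card {d1, d2, d3} = 3" using a(3) by simp
  moreover have "0 < f x" if "x \<in> expos c \<delta>" "x \<noteq> 0" for x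
    using mon_positive[where lev = f, OF lin_add[OF f(1)] f(2)] that E(2) by blast
  ultimately have "(\<chi> k. if \<delta> k = 0 then c k else 0) \<in> Sing (toric c \<delta>)"
    using a d3 by (intro toric_singular[where lev = f and D = "{d1, d2, d3}", OF lin_add[OF f(1)]]) (auto simp: S)
  then show ?thesis by blast
qed

text \<open>All exponents except \<open>0\<close> have level at least \<open>1\<close> for the functional \<open>x + y\<close> in the basis
  \<open>g s, g (s + 1)\<close>, so both basis elements are irreducible. They do not generate
  \<open>g (s + 2) - g s = (-2, b (s + 1))\<close>, nor \<open>g (s - 1) - g (s + 1) = (b s, -2)\<close>; one of the two exists.\<close>

lemma singular_adjacent_no_2:
  fixes c :: "'v::finite \<Rightarrow> 'k::field_char_0"
  assumes s: "s \<le> m" "0 < s \<Longrightarrow> 3 \<le> b s" "s < m \<Longrightarrow> 3 \<le> b (Suc s)"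
    and E: "rset s (Suc s) \<subseteq> expos c \<delta>" "expos c \<delta> \<subseteq> mon (rset s (Suc s))"
  shows "Sing (toric c \<delta>) \<noteq> {}"
proof -
  have pos: "0 < val s 1 1 x" if "x \<in> rset s (Suc s)" "x \<noteq> 0" for x
    by (rule rset_positive[where s = s and M = 2]) (use that s in auto)
  have "g s \<in> rset s (Suc s)" "g (Suc s) \<in> rset s (Suc s)" using s by (auto simp: rset_def)
  then have at: "atom (mon (rset s (Suc s))) (g s)" "atom (mon (rset s (Suc s))) (g (Suc s))"
    using s pos by (auto intro!: atom_of_level_one[where f = "val s 1 1"] mon_base)
  have ne: "g s \<noteq> g (Suc s)" using cr_nonzero[of s "Suc s"] s by auto
  show ?thesis
  proof (cases "s < m")
    case True
    then have "g (Suc (Suc s)) - g s \<in> rset s (Suc s)" by (auto simp: rset_def)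
    then show ?thesis using s True
      by (intro singular_from_two_atoms[OF E _ pos at ne, where h = "val s 1 0"]) (auto simp: lin_diff[OF lin_val])
  next
    case False
    then have sm: "s = m" "0 < s" using s m by auto
    then have "g (s - Suc 0) - g (Suc s) \<in> rset s (Suc s)" by (auto simp: rset_def)
    then show ?thesis using s sm
      by (intro singular_from_two_atoms[OF E _ pos at ne, where h = "val s 0 1"]) (auto simp: lin_diff[OF lin_val])
  qed
qed

text \<open>In the basis \<open>g s, g (s + 1)\<close>, three irreducible elements are \<open>(1, -1) = g (s - 1) - g s\<close>,
  \<open>(0, 1) = g (s + 1)\<close> and one that is needed for \<open>(-2, b (s + 1))\<close>. Irreducibility of the first two
  holds because an exponent with \<open>h = x + y \<le> 1\<close> has \<open>x \<ge> 0\<close>: the generators to the right of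
  \<open>g (s + 1)\<close> have \<open>h \<ge> b (s + 1) - 1 \<ge> 3\<close>, hence \<open>h \<ge> 2\<close> after subtraction of \<open>g s\<close> or
  \<open>g (s + 1)\<close>.\<close>

lemma singular_adjacent_2_4:
  fixes c :: "'v::finite \<Rightarrow> 'k::field_char_0"
  assumes s: "0 < s" "s < m" "b s = 2" "4 \<le> b (Suc s)"
    and E: "rset s (Suc s) \<subseteq> expos c \<delta>" "expos c \<delta> \<subseteq> mon (rset s (Suc s))"
  shows "Sing (toric c \<delta>) \<noteq> {}"
proof -
  let ?S = "mon (rset s (Suc s))"
  have sm: "s \<le> m" using s by simp
  have pos: "0 < val s 3 2 x" if "x \<in> rset s (Suc s)" "x \<noteq> 0" for x
    by (rule rset_positive[where s = s and M = 4]) (use that s in auto)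
  define h where "h = val s 1 1"
  define x where "x = val s 1 0"
  have lh: "lin h" and lx: "lin x" by (simp_all add: h_def x_def)
  have zero: "d = 0" if "h d = 0" "x d = 0" for d
    using val_determines[OF sm, of d] that val_sum[of s 1 0 0 1 d] by (simp add: h_def x_def)
  have P: "0 \<le> h d \<and> (h d \<le> 1 \<longrightarrow> 0 \<le> x d)" if "d \<in> rset s (Suc s)" for d
    using that sm
  proof (cases rule: rset_cases)
    case (right k)
    have "3 \<le> h (g k)" unfolding h_def by (rule right_bound[of _ s]) (use s right in auto)
    then show ?thesis using right s by (auto simp: lin_diff[OF lh]) (auto simp: h_def)
  next
    case (left k)
    have "1 \<le> h (g k)" unfolding h_def by (rule left_bound[of _ s]) (use s left in auto)
    moreover have "2 \<le> x (g k)" unfolding x_def by (rule left_bound[of _ s]) (use s left in auto)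
    ultimately show ?thesis using left s by (auto simp: lin_diff[OF lh] lin_diff[OF lx]) (auto simp: h_def x_def)
  qed (use s in \<open>auto simp: lin_0[OF lh] lin_0[OF lx]\<close>, auto simp: h_def x_def)
  have PS: "0 \<le> h d \<and> (h d \<le> 1 \<longrightarrow> 0 \<le> x d)" if "d \<in> ?S" for d
    using that
  proof (induction rule: mon.induct)
    case (mon_step e d)
    then show ?case using P[of e] by (auto simp: lin_add[OF lh] lin_add[OF lx])
  qed (simp add: lin_0[OF lh] lin_0[OF lx])
  let ?d1 = "g (s - 1) - g s" and ?d2 = "g (Suc s)"
  have d1: "h ?d1 = 0" "x ?d1 = 1" and d2: "h ?d2 = 1" "x ?d2 = 0"
    using s by (simp_all add: lin_diff[OF lh] lin_diff[OF lx]) (simp_all add: h_def x_def)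
  have in1: "?d1 \<in> rset s (Suc s)" and in2: "?d2 \<in> rset s (Suc s)" using s by (auto simp: rset_def)
  have atom: "atom ?S d" if d: "d \<in> rset s (Suc s)" "h d \<le> 1" "h d + x d = 1" for d
    unfolding atom_def
  proof (intro conjI ballI impI)
    show "d \<noteq> 0" using d lin_0[OF lh] lin_0[OF lx] by auto
    fix p q assume pq: "p \<in> ?S" "q \<in> ?S" "p + q = d"
    then have sum: "h p + h q = h d" "x p + x q = x d"
      using lin_add[OF lh, of p q] lin_add[OF lx, of p q] by simp_all
    have "0 \<le> h p" "0 \<le> h q" "0 \<le> x p" "0 \<le> x q" using PS[OF pq(1)] PS[OF pq(2)] sum d(2) by auto
    then have "(h p = 0 \<and> x p = 0) \<or> (h q = 0 \<and> x q = 0)" using sum d(3) by linarith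
    then show "p = 0 \<or> q = 0" using zero by blast
  qed (use d(1) in \<open>auto intro: mon_base\<close>)
  have at1: "atom ?S ?d1" and at2: "atom ?S ?d2" using atom in1 in2 d1 d2 by simp_all
  have z: "g (Suc (Suc s)) - g s \<in> rset s (Suc s)" using s by (auto simp: rset_def)
  have "x (g (Suc (Suc s)) - g s) < 0" using s by (simp add: lin_diff[OF lx]) (simp add: x_def)
  then show ?thesis
    using d1 d2 by (intro singular_from_two_atoms[OF E _ pos at1 at2 _ lx _ _ z]) auto
qed

definition good :: "nat \<Rightarrow> bool" where
  "good s \<longleftrightarrow> (s = 0 \<and> b (Suc 0) = 2) \<or> (s = m \<and> b m = 2) \<or>
     (0 < s \<and> s < m \<and> (b s, b (Suc s)) \<in> {(2, 2), (2, 3), (3, 2)})"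

lemma smooth_adjacent_iff:
  fixes c :: "'v::finite \<Rightarrow> 'k::field_char_0"
  assumes s: "s \<le> m"
    and E: "rset s (Suc s) \<subseteq> expos c \<delta>" "expos c \<delta> \<subseteq> mon (rset s (Suc s))"
  shows "Sing (toric c \<delta>) = {} \<longleftrightarrow> good s"
proof -
  interpret R: hirzebruch "- \<epsilon>" m "\<lambda>k. b (Suc m - k)" "\<lambda>k. g (Suc m - k)" by (rule rev)
  note E' = E[unfolded rset_rev[OF s, symmetric]]
  have idx: "0 < s \<Longrightarrow> Suc m - (m - s) = Suc s" "Suc m - Suc (m - s) = s" using s by auto
  have smooth: "Sing (toric c \<delta>) = {}" if gd: "good s"
  proof -
    consider "s = 0" "b (Suc 0) = 2" | "s = m" "b m = 2" | "0 < s" "s < m" "b s = 2" "b (Suc s) = 2"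
      | "0 < s" "s < m" "b s = 2" "b (Suc s) = 3" | "0 < s" "s < m" "b s = 3" "b (Suc s) = 2"
      using gd by (auto simp: good_def)
    then show ?thesis
    proof cases
      case 1
      then show ?thesis using smooth_adjacent_end_2 E by blast
    next
      case 2
      then show ?thesis using R.smooth_adjacent_end_2[of c \<delta>] E' by simp
    next
      case 3
      then show ?thesis using smooth_adjacent_2_2 E by blast
    next
      case 4
      then show ?thesis using smooth_adjacent_2_3 E by blast
    next
      case 5
      then show ?thesis using R.smooth_adjacent_2_3[of "m - s" c \<delta>] E' idx by simp
    qed
  qed
  have singular: "Sing (toric c \<delta>) \<noteq> {}" if ng: "\<not> good s"
  proof -
    have L: "0 < s \<Longrightarrow> 2 \<le> b s" and Rb: "s < m \<Longrightarrow> 2 \<le> b (Suc s)"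
      using b_ge_2[of s] b2[of s] s by auto
    show ?thesis
    proof (cases "0 < s \<and> s < m")
      case False
      then consider "s = 0" "b (Suc 0) \<noteq> 2" | "s = m" "b m \<noteq> 2" using ng s by (auto simp: good_def)
      then have "(0 < s \<longrightarrow> 3 \<le> b s) \<and> (s < m \<longrightarrow> 3 \<le> b (Suc s))"
      proof cases
        case 1
        then show ?thesis using Rb by auto
      next
        case 2
        then show ?thesis using L by auto
      qed
      then show ?thesis using singular_adjacent_no_2[OF s _ _ E] by blast
    next
      case True
      then have "\<not> (b s = 2 \<and> b (Suc s) = 2)" "\<not> (b s = 2 \<and> b (Suc s) = 3)" "\<not> (b s = 3 \<and> b (Suc s) = 2)"
        "2 \<le> b s" "2 \<le> b (Suc s)" using ng L Rb by (auto simp: good_def)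
      then consider "3 \<le> b s" "3 \<le> b (Suc s)" | "b s = 2" "4 \<le> b (Suc s)" | "4 \<le> b s" "b (Suc s) = 2"
        by linarith
      then show ?thesis
      proof cases
        case 1
        then show ?thesis using singular_adjacent_no_2[OF s _ _ E] by blast
      next
        case 2
        then show ?thesis using singular_adjacent_2_4 E True by blast
      next
        case 3
        then show ?thesis using R.singular_adjacent_2_4[of "m - s" c \<delta>] E' idx True by simp
      qed
    qed
  qed
  show ?thesis using smooth singular by blast
qed

lemma all_good_iff:
  "(\<forall>s\<le>m. good s) \<longleftrightarrow> b 1 = 2 \<and> b m = 2 \<and> (\<forall>k. 1 \<le> k \<and> k < m \<longrightarrow> (b k, b (Suc k)) \<in> {(2, 2), (2, 3), (3, 2)})"
proof
  assume a: "\<forall>s\<le>m. good s"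
  have "good 0" "good m" using a by auto
  moreover have "good k" if "1 \<le> k \<and> k < m" for k using a that by auto
  ultimately show "b 1 = 2 \<and> b m = 2 \<and> (\<forall>k. 1 \<le> k \<and> k < m \<longrightarrow> (b k, b (Suc k)) \<in> {(2, 2), (2, 3), (3, 2)})"
    using m unfolding good_def by auto
next
  assume a: "b 1 = 2 \<and> b m = 2 \<and> (\<forall>k. 1 \<le> k \<and> k < m \<longrightarrow> (b k, b (Suc k)) \<in> {(2, 2), (2, 3), (3, 2)})"
  show "\<forall>s\<le>m. good s"
  proof (intro allI impI)
    fix s assume "s \<le> m"
    then consider "s = 0" | "s = m" | "1 \<le> s \<and> s < m" by linarith
    then show "good s" using a by cases (auto simp: good_def)
  qed
qed

end

section \<open>The Nash blowup of a toric surface given by a Hirzebruch--Jung sequence\<close>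

locale toric_hirzebruch = hirzebruch +
  fixes \<delta> :: "'n::finite \<Rightarrow> int \<times> int" and X :: "('k::field_char_0 ^ 'n) set"
  assumes X: "X = toric (\<lambda>_. 1) \<delta>" and semigroup: "mon (range \<delta>) = mon gens"
begin

lemma generator_index: "k \<le> Suc m \<Longrightarrow> \<exists>i. \<delta> i = g k"
proof -
  assume "k \<le> Suc m"
  then have "atom (mon (range \<delta>)) (g k)" using atom_gens semigroup by simp
  then have "g k \<in> range \<delta>" by (rule atom_is_generator)
  then show ?thesis by (metis rangeE)
qed

lemma expo_in_mon: "\<delta> k \<in> mon gens"
  using semigroup mon_base[of "\<delta> k" "range \<delta>"] by simp

lemma expos_one: "expos (\<lambda>_. 1 :: 'k) \<delta> = range \<delta>"
  by (simp add: expos_def)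

text \<open>On \<open>X\<close> the monomial \<open>n\<close> agrees with a multiple of the coordinate \<open>l\<close>.\<close>

lemma nonvanishing_divisor:
  assumes q: "q \<in> X" and n: "expdeg \<delta> n = \<delta> l + x" "x \<in> mon gens" and nz: "mval n q \<noteq> 0"
  shows "q $ l \<noteq> 0"
proof -
  have one: "mval n' (\<chi> k. (1 :: 'k)) = 1" for n' :: "'n \<Rightarrow>\<^sub>0 nat"
    by (simp add: mval_def)
  obtain n' where n': "expdeg \<delta> n' = x"
    using mon_monomial[of x "\<lambda>_. 1 :: 'k" \<delta>] n(2) semigroup by (auto simp: expos_one)
  let ?n = "Poly_Mapping.single l (Suc 0) + n'"
  let ?p = "Poly_Mapping.single n 1 - Poly_Mapping.single ?n (1 :: 'k)"
  have "evalp ?p (pt (\<lambda>_. 1) \<delta> s t) = 0" if "s \<noteq> 0" "t \<noteq> 0" for s t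
    using mval_pt[OF that, of n "\<lambda>_. 1" \<delta>] mval_pt[OF that, of ?n "\<lambda>_. 1" \<delta>]
    by (simp add: evalp_eq_lfun[of "Poly_Mapping.single _ _"] one expdeg_add n n')
  then have "evalp ?p q = 0" using q unfolding X toric_def zclosure_iff orbit_def by blast
  then have "mval n q = q $ l * mval n' q"
    by (simp add: evalp_eq_lfun[of "Poly_Mapping.single _ _"] mval_add)
  then show ?thesis using nz by auto
qed

text \<open>Since \<open>b k g k = g (k - 1) + g (k + 1)\<close>, a nonvanishing coordinate with exponent \<open>g k\<close> forces
  one with exponent \<open>g (k - 1)\<close>, and finally \<open>g 0\<close>. So the common zero of the two extreme coordinates is the
  fixed point, where \<open>g 0, g 1, g 2\<close> give three tangent vectors.\<close>

lemma origin_singular: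
  assumes q: "q \<in> X" and z: "\<delta> u = g 0" "\<delta> w = g (Suc m)" "q $ u = 0" "q $ w = 0"
  shows "q \<in> Sing X"
proof -
  obtain ix where ix: "\<And>k. k \<le> Suc m \<Longrightarrow> \<delta> (ix k) = g k" using generator_index by metis
  have same: "q $ l \<noteq> 0" if "q $ k \<noteq> 0" "\<delta> k = \<delta> l" for k l
    using nonvanishing_divisor[OF q, of "Poly_Mapping.single k (Suc 0)" l 0] that mon_0 by simp
  have down: "q $ ix 0 \<noteq> 0" if "k \<le> m" "q $ ix k \<noteq> 0" for k
    using that
  proof (induction k)
    case (Suc k)
    let ?n = "Poly_Mapping.single (ix (Suc k)) (nat (b (Suc k)))"
    have deg: "expdeg \<delta> (Poly_Mapping.single i n) = (int n * fst (\<delta> i), int n * snd (\<delta> i))" for i n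
    proof (induction n)
      case (Suc n)
      have "expdeg \<delta> (Poly_Mapping.single i (Suc n)) = expdeg \<delta> (Poly_Mapping.single i (Suc 0) + Poly_Mapping.single i n)"
        by (simp flip: single_add)
      then show ?case by (simp only: expdeg_add expdeg_single Suc.IH) (simp add: plus_prod_def algebra_simps)
    qed (simp add: zero_prod_def)
    have k: "k < m" using Suc by simp
    have "expdeg \<delta> ?n = \<delta> (ix k) + g (Suc (Suc k))"
      using ix k b2[OF k] rec_fst[OF k] rec_snd[OF k] by (simp add: deg prod_eq_iff)
    moreover have "g (Suc (Suc k)) \<in> mon gens" using k by (auto intro!: mon_base)
    moreover have "mval ?n q \<noteq> 0" using Suc by simp
    ultimately have "q $ ix k \<noteq> 0" using nonvanishing_divisor[OF q] by blast
    then show ?case using Suc by simp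
  qed
  have zero: "q $ k = 0" if "\<delta> k \<noteq> 0" for k
  proof (rule ccontr)
    assume nz: "q $ k \<noteq> 0"
    obtain l y where l: "l \<le> Suc m" "y \<in> mon gens" "\<delta> k = g l + y"
      using mon_split_nonzero[OF expo_in_mon \<open>\<delta> k \<noteq> 0\<close>] by auto
    then have "q $ ix l \<noteq> 0"
      using nonvanishing_divisor[OF q, of "Poly_Mapping.single k (Suc 0)" "ix l" y] nz ix by simp
    then have "q $ ix 0 \<noteq> 0 \<or> q $ ix (Suc m) \<noteq> 0" using down[of l] l(1) by (cases "l = Suc m") simp_all
    then show False using same[of "ix 0" u] same[of "ix (Suc m)" w] z ix[of 0] ix[of "Suc m"] by auto
  qed
  have one: "q $ k = 1" if "\<delta> k = 0" for k
  proof -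
    have "evalp (Var k - Cst 1) (pt (\<lambda>_. 1) \<delta> s t) = 0" if "s \<noteq> 0" "t \<noteq> 0" for s t :: 'k
      using \<open>\<delta> k = 0\<close> by (simp add: pt_def)
    then have "evalp (Var k - Cst 1) q = 0" using q unfolding X toric_def zclosure_iff orbit_def by blast
    then show ?thesis by simp
  qed
  have q_eq: "q = (\<chi> k. if \<delta> k = 0 then 1 else 0)"
    using zero one by (simp add: vec_eq_iff)
  let ?D = "{g 0, g 1, g 2}"
  have "g 0 \<noteq> g 1" "g 0 \<noteq> g 2" "g 1 \<noteq> g 2"
    using cr_nonzero[of 0 1] cr_nonzero[of 0 2] cr_nonzero[of 1 2] m by auto
  then have card: "card ?D = 3" by simp
  have at: "atom (mon (expos (\<lambda>_. 1 :: 'k) \<delta>)) d" if "d \<in> ?D" for d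
    using that atom_gens[of 0] atom_gens[of 1] atom_gens[of 2] m by (auto simp: expos_one semigroup)
  have "0 < val 0 1 1 x" if "x \<in> mon gens" "x \<noteq> 0" for x
    by (rule mon_positive[where lev = "val 0 1 1" and G = gens, OF lin_add[OF lin_val] _ that])
       (use level_positive[of 0] in fastforce)
  then have pos: "0 < val 0 1 1 x" if "x \<in> expos (\<lambda>_. 1 :: 'k) \<delta>" "x \<noteq> 0" for x
    using that mon_base[of x "range \<delta>"] semigroup by (simp add: expos_one)
  show ?thesis unfolding X
    by (rule toric_singular[where lev = "val 0 1 1" and D = ?D, OF lin_add[OF lin_val] pos _ card at q_eq]) simp_all
qed

lemma toric_surface_frames_exist: "\<exists>u1 v1 u2 v2 \<epsilon>1 \<epsilon>2. toric_surface_frames \<delta> X u1 v1 u2 v2 \<epsilon>1 \<epsilon>2"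
proof -
  obtain u1 v1 u2 v2 where uv: "\<delta> u1 = g 0" "\<delta> v1 = g (Suc 0)" "\<delta> u2 = g (Suc m)" "\<delta> v2 = g m"
    using generator_index[of 0] generator_index[of "Suc 0"] generator_index[of "Suc m"] generator_index[of m] m by auto
  have 1: "0 \<le> \<epsilon> * cr (g 0) (\<delta> k)" for k
  proof -
    from expo_in_mon have "0 \<le> val 0 0 1 (\<delta> k)"
    proof (rule lin_mon_nonneg[rotated 2])
      fix x assume "x \<in> gens"
      then obtain l where "l \<le> Suc m" "x = g l" by auto
      then show "0 \<le> val 0 0 1 x" using cr_pos[of 0 l] by (cases "l = 0") (auto simp: val_def)
    qed simp
    then show ?thesis by (simp add: val_def)
  qed
  have 2: "0 \<le> - \<epsilon> * cr (g (Suc m)) (\<delta> k)" for k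
  proof -
    from expo_in_mon have "0 \<le> val m 1 0 (\<delta> k)"
    proof (rule lin_mon_nonneg[rotated 2])
      fix x assume "x \<in> gens"
      then obtain l where "l \<le> Suc m" "x = g l" by auto
      then show "0 \<le> val m 1 0 x" using cr_pos[of l "Suc m"] by (cases "l = Suc m") (auto simp: val_def)
    qed simp
    then show ?thesis by (simp add: val_def cr_def algebra_simps)
  qed
  have "toric_surface_frames \<delta> X u1 v1 u2 v2 \<epsilon> (- \<epsilon>)"
  proof
    show "cr (\<delta> u2) (\<delta> v2) = - \<epsilon>" using det[of m] by (simp add: uv cr_def algebra_simps)
    show "q \<in> Sing X" if "q \<in> X" "q $ u1 = 0" "q $ u2 = 0" for q
      using origin_singular[OF that(1) uv(1,3)] that by simp
  qed (use X 1 2 det[of 0] eps in \<open>simp_all add: uv\<close>)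
  then show ?thesis by blast
qed

definition gset :: "'n \<Rightarrow> 'n \<Rightarrow> (int \<times> int) set" where
  "gset i j = range \<delta> \<union> {\<delta> k - \<delta> i | k. cr (\<delta> k) (\<delta> j) \<noteq> 0} \<union> {\<delta> k - \<delta> j | k. cr (\<delta> k) (\<delta> i) \<noteq> 0}"

lemma gset_commute: "gset i j = gset j i"
  by (auto simp: gset_def)

text \<open>The differences that carry a zero coefficient are exactly those left out in \<open>gset\<close>.\<close>

lemma expos_nash:
  assumes D: "cr (\<delta> i) (\<delta> j) \<noteq> 0"
  shows "expos (nash_coeff \<delta> i j :: _ \<Rightarrow> 'k) (nash_expo \<delta>) = gset i j"
proof -
  let ?c = "nash_coeff \<delta> i j :: _ \<Rightarrow> 'k"
  have ij: "i \<noteq> j" using D by auto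
  have sw: "cr (\<delta> i) (\<delta> k) = - cr (\<delta> k) (\<delta> i)" for k by (simp add: cr_def algebra_simps)
  have c: "?c (Inl k) \<noteq> 0" "?c (Inr (i, k)) \<noteq> 0 \<longleftrightarrow> cr (\<delta> k) (\<delta> j) \<noteq> 0"
    "?c (Inr (j, k)) \<noteq> 0 \<longleftrightarrow> cr (\<delta> k) (\<delta> i) \<noteq> 0" "l \<noteq> i \<Longrightarrow> l \<noteq> j \<Longrightarrow> ?c (Inr (l, k)) = 0" for k l
    using D ij by (auto simp: nash_coeff_def sw)
  show ?thesis
  proof
    show "expos ?c (nash_expo \<delta>) \<subseteq> gset i j"
    proof
      fix x assume "x \<in> expos ?c (nash_expo \<delta>)"
      then obtain \<kappa> where \<kappa>: "?c \<kappa> \<noteq> 0" "x = nash_expo \<delta> \<kappa>" by (auto simp: expos_def)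
      show "x \<in> gset i j"
      proof (cases \<kappa>)
        case (Inr lk)
        obtain l k where lk: "lk = (l, k)" by fastforce
        then have "l = i \<or> l = j" using \<kappa> c(4) Inr by metis
        then show ?thesis using \<kappa> c(2,3)[of k] by (auto simp: Inr lk gset_def nash_expo_def)
      qed (use \<kappa> in \<open>auto simp: gset_def nash_expo_def\<close>)
    qed
    show "gset i j \<subseteq> expos ?c (nash_expo \<delta>)"
    proof
      fix x assume "x \<in> gset i j"
      then consider k where "x = \<delta> k" | k where "x = \<delta> k - \<delta> i" "cr (\<delta> k) (\<delta> j) \<noteq> 0"
        | k where "x = \<delta> k - \<delta> j" "cr (\<delta> k) (\<delta> i) \<noteq> 0" by (auto simp: gset_def)
      then obtain \<kappa> where "?c \<kappa> \<noteq> 0" "x = nash_expo \<delta> \<kappa>"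
      proof cases
        case (1 k)
        then show ?thesis using that[of "Inl k"] c(1) by (simp add: nash_expo_def)
      next
        case (2 k)
        then show ?thesis using that[of "Inr (i, k)"] c(2) by (simp add: nash_expo_def)
      next
        case (3 k)
        then show ?thesis using that[of "Inr (j, k)"] c(3) by (simp add: nash_expo_def)
      qed
      then show "x \<in> expos ?c (nash_expo \<delta>)" by (auto simp: expos_def)
    qed
  qed
qed

lemma gens_subset_range: "gens \<subseteq> range \<delta>"
  using generator_index by (metis atMost_iff image_subsetI rangeI)

text \<open>Exponents \<open>\<delta>\<^sub>k - \<delta>\<^sub>i\<close> with a decomposable \<open>\<delta>\<^sub>k\<close> add nothing new: a summand of \<open>\<delta>\<^sub>k\<close> that is not
  proportional to \<open>\<delta>\<^sub>j\<close> takes the place of \<open>\<delta>\<^sub>k\<close>.\<close>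

lemma gset_rset:
  assumes st: "\<delta> i = g s" "\<delta> j = g t" "s \<noteq> t" "s \<le> Suc m" "t \<le> Suc m"
  shows "rset s t \<subseteq> gset i j" "gset i j \<subseteq> mon (rset s t)"
proof -
  show "rset s t \<subseteq> gset i j"
  proof
    fix x assume "x \<in> rset s t"
    then obtain k where k: "k \<le> Suc m"
      "x = g k \<or> (x = g k - g s \<and> k \<noteq> t) \<or> (x = g k - g t \<and> k \<noteq> s)" by (auto simp: rset_def)
    obtain l where l: "\<delta> l = g k" using generator_index k by blast
    show "x \<in> gset i j"
    proof -
      consider "x = g k" | "x = g k - g s" "k \<noteq> t" | "x = g k - g t" "k \<noteq> s" using k by blast
      then show ?thesis
      proof cases
        case 1
        then have "x \<in> range \<delta>" using l by (metis rangeI)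
        then show ?thesis by (simp add: gset_def)
      next
        case 2
        then have "x = \<delta> l - \<delta> i" "cr (\<delta> l) (\<delta> j) \<noteq> 0" using l st k cr_nonzero by simp_all
        then show ?thesis unfolding gset_def by blast
      next
        case 3
        then have "x = \<delta> l - \<delta> j" "cr (\<delta> l) (\<delta> i) \<noteq> 0" using l st k cr_nonzero by simp_all
        then show ?thesis unfolding gset_def by blast
      qed
    qed
  qed
  have base: "mon gens \<subseteq> mon (rset s t)" by (rule mon_mono) (auto simp: rset_def)
  have diff: "\<delta> k - g a \<in> mon (rset s t)" if k: "cr (\<delta> k) (g c) \<noteq> 0" and ac: "(a, c) = (s, t) \<or> (a, c) = (t, s)" for k a c
  proof -
    obtain l y where l: "l \<le> Suc m" "y \<in> mon gens" "\<delta> k = g l + y" "cr (g l) (g c) \<noteq> 0"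
      using mon_split_cr[OF expo_in_mon k] by auto
    then have "l \<noteq> c" by auto
    then have "g l - g a \<in> mon (rset s t)" using l ac by (intro mon_base) (auto simp: rset_def)
    then have "(g l - g a) + y \<in> mon (rset s t)" using l base by (intro mon_add) auto
    then show ?thesis using l(3) by (simp add: algebra_simps)
  qed
  show "gset i j \<subseteq> mon (rset s t)"
    using base expo_in_mon diff[of _ t s] diff[of _ s t] st unfolding gset_def by auto
qed

text \<open>Write \<open>\<delta>\<^sub>i = l + x\<close> with a generator \<open>l\<close> that is not proportional to \<open>\<delta>\<^sub>j\<close>; then \<open>l - \<delta>\<^sub>i = - x\<close>
  is an exponent of the chart.\<close>

lemma chart_smooth_nongenerator:
  assumes D: "cr (\<delta> i) (\<delta> j) \<noteq> 0" and i: "\<delta> i \<notin> gens"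
  shows "\<exists>x\<in>mon gens. x \<noteq> 0 \<and> - x \<in> mon (gset i j)"
proof -
  obtain l x where l: "l \<in> gens" "x \<in> mon gens" "\<delta> i = l + x" "cr l (\<delta> j) \<noteq> 0"
    using mon_split_cr[OF expo_in_mon D] by blast
  obtain k where k: "\<delta> k = l" using gens_subset_range l(1) by force
  then have "\<delta> k - \<delta> i \<in> gset i j" using l by (auto simp: gset_def)
  moreover have "\<delta> k - \<delta> i = - x" using k l by (simp add: prod_eq_iff)
  ultimately have "- x \<in> mon (gset i j)" by (metis mon_base)
  moreover have "x \<noteq> 0" using l i by auto
  ultimately show ?thesis using l by blast
qed

lemma chart_smooth:
  assumes D: "cr (\<delta> i) (\<delta> j) \<noteq> 0"
    and adj: "\<And>s. s \<le> m \<Longrightarrow> {\<delta> i, \<delta> j} = {g s, g (Suc s)} \<Longrightarrow> good s"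
  shows "Sing (toric (nash_coeff \<delta> i j :: _ \<Rightarrow> 'k) (nash_expo \<delta>)) = {}"
proof -
  note E = expos_nash[OF D]
  have D': "cr (\<delta> j) (\<delta> i) \<noteq> 0" using D by (auto simp: cr_def algebra_simps)
  have gE: "gens \<subseteq> gset i j" using gens_subset_range by (auto simp: gset_def)
  consider "\<delta> i \<notin> gens" | "\<delta> j \<notin> gens" | s t where "\<delta> i = g s" "\<delta> j = g t" "s \<le> Suc m" "t \<le> Suc m"
    by blast
  then show ?thesis
  proof cases
    case 1
    then show ?thesis using chart_smooth_nongenerator[OF D] smooth_negative_element gE E by metis
  next
    case 2
    then show ?thesis
      using chart_smooth_nongenerator[OF D'] smooth_negative_element gE E gset_commute by metis
  next
    case (3 s t)
    have st: "s \<noteq> t" using D 3 by auto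
    have r1: "rset s t \<subseteq> gset i j" "gset i j \<subseteq> mon (rset s t)"
      using gset_rset[OF 3(1,2) st 3(3,4)] by auto
    have r2: "rset t s \<subseteq> gset i j" "gset i j \<subseteq> mon (rset t s)"
      using gset_rset[OF 3(2,1) st[symmetric] 3(4,3)] by (auto simp: gset_commute)
    consider "Suc s < t" | "t = Suc s" | "Suc t < s" | "s = Suc t" using st by linarith
    then show ?thesis
    proof cases
      case 1
      then show ?thesis using smooth_distant r1 3 E by metis
    next
      case 2
      then have "good s" using adj 3 by auto
      moreover have "Sing (toric (nash_coeff \<delta> i j :: _ \<Rightarrow> 'k) (nash_expo \<delta>)) = {} \<longleftrightarrow> good s"
        by (rule smooth_adjacent_iff) (use r1 2 3 E in simp_all)
      ultimately show ?thesis by blast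
    next
      case 3
      then show ?thesis using smooth_distant r2 \<open>s \<le> Suc m\<close> E by metis
    next
      case 4
      then have "good t" using adj 3 by auto
      moreover have "Sing (toric (nash_coeff \<delta> i j :: _ \<Rightarrow> 'k) (nash_expo \<delta>)) = {} \<longleftrightarrow> good t"
        by (rule smooth_adjacent_iff) (use r2 4 3 E in simp_all)
      ultimately show ?thesis by blast
    qed
  qed
qed

theorem nash_blowup_smooth_iff_good: "nash_blowup_smooth X \<longleftrightarrow> (\<forall>s\<le>m. good s)"
proof -
  obtain u1 v1 u2 v2 \<epsilon>1 \<epsilon>2 where "toric_surface_frames \<delta> X u1 v1 u2 v2 \<epsilon>1 \<epsilon>2"
    using toric_surface_frames_exist by blast
  then interpret T: toric_surface_frames \<delta> X u1 v1 u2 v2 \<epsilon>1 \<epsilon>2 .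
  show ?thesis unfolding T.nash_blowup_smooth_iff
  proof (intro iffI allI impI)
    fix s assume all: "\<forall>i j. cr (\<delta> i) (\<delta> j) \<noteq> 0 \<longrightarrow> Sing (toric (nash_coeff \<delta> i j :: _ \<Rightarrow> 'k) (nash_expo \<delta>)) = {}"
      and s: "s \<le> m"
    obtain i j where ij: "\<delta> i = g s" "\<delta> j = g (Suc s)"
      using generator_index[of s] generator_index[of "Suc s"] s by auto
    have D: "cr (\<delta> i) (\<delta> j) \<noteq> 0" using cr_nonzero[of s "Suc s"] s ij by simp
    have "rset s (Suc s) \<subseteq> gset i j" "gset i j \<subseteq> mon (rset s (Suc s))"
      using gset_rset[OF ij] s by auto
    then show "good s" using smooth_adjacent_iff[OF s] all D expos_nash[OF D] by metis
  next
    fix i j assume "\<forall>s\<le>m. good s" "cr (\<delta> i) (\<delta> j) \<noteq> 0"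
    then show "Sing (toric (nash_coeff \<delta> i j :: _ \<Rightarrow> 'k) (nash_expo \<delta>)) = {}"
      by (intro chart_smooth) auto
  qed
qed

end

section \<open>From the cone to the Hirzebruch--Jung sequence\<close>

context hirzebruch
begin

text \<open>A lattice point of the cone lies between two consecutive rays \<open>g s, g (s + 1)\<close>, and these form a
  basis of the lattice.\<close>

lemma mon_gens_eq_cone: "mon gens = {d. 0 \<le> \<epsilon> * cr (g 0) d \<and> 0 \<le> \<epsilon> * cr d (g (Suc m))}"
proof (intro equalityI subsetI CollectI conjI)
  fix d assume d: "d \<in> mon gens"
  have "0 \<le> val 0 0 1 x \<and> 0 \<le> val m 1 0 x" if "x \<in> gens" for x
  proof -
    note x = that
    obtain l where l: "l \<le> Suc m" "x = g l" using x by auto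
    have "0 \<le> \<epsilon> * cr (g 0) (g l)" using cr_pos[of 0 l] l by (cases "l = 0") auto
    moreover have "0 \<le> \<epsilon> * cr (g l) (g (Suc m))" using cr_pos[of l "Suc m"] l by (cases "l = Suc m") auto
    ultimately show ?thesis by (simp add: val_def l)
  qed
  then have "0 \<le> val 0 0 1 d" "0 \<le> val m 1 0 d" using lin_mon_nonneg[OF lin_val _ d] by blast+
  then show "0 \<le> \<epsilon> * cr (g 0) d" "0 \<le> \<epsilon> * cr d (g (Suc m))" by (simp_all add: val_def)
next
  fix d assume "d \<in> {d. 0 \<le> \<epsilon> * cr (g 0) d \<and> 0 \<le> \<epsilon> * cr d (g (Suc m))}"
  then have d: "0 \<le> \<epsilon> * cr (g 0) d" "0 \<le> \<epsilon> * cr d (g (Suc m))" by auto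
  have "\<exists>s\<le>m. 0 \<le> \<epsilon> * cr (g s) d \<and> 0 \<le> \<epsilon> * cr d (g (Suc s))"
  proof (rule ccontr)
    assume none: "\<not> ?thesis"
    have "0 \<le> \<epsilon> * cr (g s) d" if "s \<le> m" for s
      using that
    proof (induction s)
      case (Suc s)
      then have "\<not> 0 \<le> \<epsilon> * cr d (g (Suc s))" using none by auto
      moreover have "cr d (g (Suc s)) = - cr (g (Suc s)) d" by (simp add: cr_def)
      ultimately show ?case by simp
    qed (use d in simp)
    then show False using none d(2) by blast
  qed
  then obtain s where s: "s \<le> m" "0 \<le> \<epsilon> * cr (g s) d" "0 \<le> \<epsilon> * cr d (g (Suc s))" by blast
  let ?x = "\<epsilon> * cr d (g (Suc s))" and ?y = "\<epsilon> * cr (g s) d"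
  have "?x * fst (g s) + ?y * fst (g (Suc s)) = \<epsilon> * cr (g s) (g (Suc s)) * fst d"
    "?x * snd (g s) + ?y * snd (g (Suc s)) = \<epsilon> * cr (g s) (g (Suc s)) * snd d"
    by (simp_all add: cr_def algebra_simps)
  then have "d = (int (nat ?x) * fst (g s), int (nat ?x) * snd (g s)) + (int (nat ?y) * fst (g (Suc s)), int (nat ?y) * snd (g (Suc s)))"
    using s det[OF s(1)] eps by (simp add: prod_eq_iff)
  moreover have "g s \<in> mon gens" "g (Suc s) \<in> mon gens" using s by (auto intro!: mon_base)
  ultimately show "d \<in> mon gens" by (metis mon_add mon_multiple)
qed

text \<open>The numbers \<open>n k = det (g k, g (m + 1))\<close>, up to sign, satisfy \<open>n (k - 1) = b k n k - n (k + 1)\<close>, which is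
  the recursion of the continued fraction, and \<open>n m = 1\<close>, \<open>n (m + 1) = 0\<close>.\<close>

lemma neg_cfrac_cr:
  assumes "1 \<le> k" "k \<le> m"
  shows "neg_cfrac (map b [k..<Suc m]) = of_int (\<epsilon> * cr (g (k - 1)) (g (Suc m))) / of_int (\<epsilon> * cr (g k) (g (Suc m)))"
  using assms(2,1)
proof (induction k rule: inc_induct)
  case base
  obtain m' where m': "m = Suc m'" using m by (cases m) auto
  have "\<epsilon> * cr (g m') (g (Suc m)) = b m * (\<epsilon> * cr (g m') (g m))"
    using lin_rec[OF lin_cr(2), of m' \<epsilon> "g m'"] by (simp add: m')
  then show ?case using det[of m'] det[of m] eps by (simp add: m')
next
  case (step k)
  obtain k' where k': "k = Suc k'" using step.prems by (cases k) auto
  let ?n = "\<lambda>k. \<epsilon> * cr (g k) (g (Suc m))"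
  have pos: "0 < ?n k" "0 < ?n (Suc k)" using step by (auto intro!: cr_pos)
  have rec: "?n k' = b k * ?n k - ?n (Suc k)"
    using lin_rec[OF lin_cr(1), of k' \<epsilon> "g (Suc m)"] step by (simp add: k')
  have "map b [k..<Suc m] = b k # b (Suc k) # map b [Suc (Suc k)..<Suc m]"
    using step.hyps by (simp add: upt_conv_Cons del: upt_Suc)
  moreover have "map b [Suc k..<Suc m] = b (Suc k) # map b [Suc (Suc k)..<Suc m]"
    using step.hyps by (simp add: upt_conv_Cons del: upt_Suc)
  ultimately have "neg_cfrac (map b [k..<Suc m]) = of_int (b k) - 1 / neg_cfrac (map b [Suc k..<Suc m])"
    by (simp only: neg_cfrac.simps)
  also have "\<dots> = of_int (b k) - of_int (?n (Suc k)) / of_int (?n k)"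
    using step.IH by simp
  also have "\<dots> = of_int (?n k') / of_int (?n k)"
  proof -
    have "of_int (b k) - of_int q / of_int p = (of_int (b k * p - q) / of_int p :: rat)" if "0 < p" for p q
      using that by (simp add: field_simps)
    then show ?thesis unfolding rec using pos by blast
  qed
  finally show ?case by (simp add: k')
qed

end

fun hj_seq :: "(nat \<Rightarrow> int) \<Rightarrow> nat \<Rightarrow> int \<times> int" where
  "hj_seq b 0 = (1, 0)"
| "hj_seq b (Suc 0) = (0, 1)"
| "hj_seq b (Suc (Suc k)) = (b (Suc k) * fst (hj_seq b (Suc k)) - fst (hj_seq b k),
                             b (Suc k) * snd (hj_seq b (Suc k)) - snd (hj_seq b k))"

lemma hirzebruch_hj_seq:
  assumes "1 \<le> m" "\<And>k. k < m \<Longrightarrow> 2 \<le> b (Suc k)"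
  shows "hirzebruch 1 m b (hj_seq b)"
proof
  show "cr (hj_seq b k) (hj_seq b (Suc k)) = 1" for k
    by (induction k) (simp_all add: cr_def algebra_simps)
qed (use assms in simp_all)

text \<open>Both \<open>Q / (Q - P)\<close> and the quotient of the components of the last vector, up to sign, equal
  \<open>[b\<^sub>1, \<dots>, b\<^sub>m]\<close>, and both are in lowest terms.\<close>

lemma hj_seq_end:
  assumes m: "1 \<le> m" "\<And>k. k < m \<Longrightarrow> 2 \<le> b (Suc k)"
    and PQ: "coprime P Q" "1 \<le> P" "P < Q"
    and cf: "of_int P / of_int Q = 1 - 1 / neg_cfrac (map b [1..<Suc m])"
  shows "hj_seq b (Suc m) = (P - Q, Q)"
proof -
  interpret hirzebruch 1 m b "hj_seq b" by (rule hirzebruch_hj_seq) (use m in auto)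
  define x y where "x = snd (hj_seq b (Suc m))" and "y = - fst (hj_seq b (Suc m))"
  have x: "x = cr (hj_seq b 0) (hj_seq b (Suc m))" and y: "y = cr (hj_seq b 1) (hj_seq b (Suc m))"
    by (simp_all add: x_def y_def cr_def)
  have pos: "0 < x" "0 < y" unfolding x y using cr_pos[of 0 "Suc m"] cr_pos[of 1 "Suc m"] m by auto
  have "neg_cfrac (map b [1..<Suc m]) = of_int x / of_int y"
    using neg_cfrac_cr[of 1] m by (simp add: x y)
  then have "of_int P / of_int Q = (1 - of_int y / of_int x :: rat)" using cf by simp
  then have "of_int (P * x) = (of_int (Q * (x - y)) :: rat)" using pos PQ by (simp add: field_simps)
  then have "P * x = Q * (x - y)" by (simp only: of_int_eq_iff)
  then have eq: "x * (Q - P) = Q * y" by (simp add: algebra_simps)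
  have "fst (hj_seq b m) * x + snd (hj_seq b m) * y = 1"
    using det[of m] by (simp add: x_def y_def cr_def)
  then have "coprime x y" by (intro coprimeI) (metis dvd_add dvd_mult)
  moreover have "coprime Q (Q - P)"
  proof (rule coprimeI)
    fix c assume "c dvd Q" "c dvd Q - P"
    then have "c dvd Q - (Q - P)" by (rule dvd_diff)
    then have "c dvd P" by simp
    then show "is_unit c" using coprime_common_divisor[OF PQ(1)] \<open>c dvd Q\<close> by blast
  qed
  ultimately have "\<bar>x\<bar> = \<bar>Q\<bar> \<and> \<bar>Q - P\<bar> = \<bar>y\<bar>"
    using eq coprime_crossproduct_int[of x y Q "Q - P"] pos PQ by (simp add: abs_mult)
  then have "x = Q" "y = Q - P" using pos PQ by auto
  then show ?thesis by (simp add: x_def y_def prod_eq_iff)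
qed

lemma convex_cone_hull_pair: "convex_cone hull {u, w} = {x *\<^sub>R u + y *\<^sub>R w | x y. 0 \<le> x \<and> 0 \<le> y}" (is "_ = ?C")
proof (rule hull_unique)
  have "u = 1 *\<^sub>R u + 0 *\<^sub>R w" "w = 0 *\<^sub>R u + 1 *\<^sub>R w" by simp_all
  then show "{u, w} \<subseteq> ?C" by (smt (verit) empty_subsetI insert_subset mem_Collect_eq)
  show "convex_cone ?C"
    unfolding convex_cone_iff
  proof (intro conjI ballI allI impI)
    show "0 \<in> ?C" by (auto intro!: exI[of _ 0])
    fix p q assume "p \<in> ?C" "q \<in> ?C"
    then obtain x y x' y' where "p = x *\<^sub>R u + y *\<^sub>R w" "q = x' *\<^sub>R u + y' *\<^sub>R w" "0 \<le> x" "0 \<le> y" "0 \<le> x'" "0 \<le> y'" by blast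
    then show "p + q \<in> ?C" by (intro CollectI exI[of _ "x + x'"] exI[of _ "y + y'"]) (simp add: algebra_simps)
  next
    fix p c assume "p \<in> ?C" "0 \<le> (c :: real)"
    then obtain x y where "p = x *\<^sub>R u + y *\<^sub>R w" "0 \<le> x" "0 \<le> y" by blast
    then show "c *\<^sub>R p \<in> ?C" using \<open>0 \<le> c\<close> by (intro CollectI exI[of _ "c * x"] exI[of _ "c * y"]) (simp add: algebra_simps)
  qed
  fix T assume T: "{u, w} \<subseteq> T" "convex_cone T"
  then show "?C \<subseteq> T" unfolding convex_cone_iff by auto
qed

lemma normal_form_cone_iff:
  assumes "0 < Q"
  shows "real_vec z \<in> convex_cone hull (real_vec ` {vector [1, 0], vector [P, Q]}) \<longleftrightarrow>
    0 \<le> z $ 2 \<and> 0 \<le> Q * z $ 1 - P * z $ (2 :: 2)"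
proof -
  have "real_vec z \<in> convex_cone hull (real_vec ` {vector [1, 0], vector [P, Q]}) \<longleftrightarrow>
      (\<exists>x y. real_of_int (z $ 1) = x + y * real_of_int P \<and> real_of_int (z $ 2) = y * real_of_int Q \<and> 0 \<le> x \<and> 0 \<le> y)"
    by (simp add: convex_cone_hull_pair real_vec_def vec_eq_iff forall_2)
  also have "\<dots> \<longleftrightarrow> 0 \<le> z $ 2 \<and> 0 \<le> Q * z $ 1 - P * z $ 2"
  proof
    assume "\<exists>x y. real_of_int (z $ 1) = x + y * real_of_int P \<and> real_of_int (z $ 2) = y * real_of_int Q \<and> 0 \<le> x \<and> 0 \<le> y"
    then obtain x y where xy: "real_of_int (z $ 1) = x + y * real_of_int P" "real_of_int (z $ 2) = y * real_of_int Q" "0 \<le> x" "0 \<le> y" by blast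
    have "0 \<le> real_of_int (z $ 2)" using xy assms by simp
    moreover have "real_of_int (Q * z $ 1 - P * z $ 2) = Q * x" using xy by (simp add: algebra_simps)
    then have "0 \<le> real_of_int (Q * z $ 1 - P * z $ 2)" using xy assms by simp
    ultimately show "0 \<le> z $ 2 \<and> 0 \<le> Q * z $ 1 - P * z $ 2" by linarith
  next
    assume z: "0 \<le> z $ 2 \<and> 0 \<le> Q * z $ 1 - P * z $ 2"
    then have "0 \<le> real_of_int (Q * z $ 1 - P * z $ 2)" by (simp only: of_int_0_le_iff)
    then show "\<exists>x y. real_of_int (z $ 1) = x + y * real_of_int P \<and> real_of_int (z $ 2) = y * real_of_int Q \<and> 0 \<le> x \<and> 0 \<le> y"
      using z assms
      by (intro exI[of _ "real_of_int (Q * z $ 1 - P * z $ 2) / Q"] exI[of _ "real_of_int (z $ 2) / Q"])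
         (simp add: field_simps)
  qed
  finally show ?thesis .
qed

lemma matrix_vector_mult_2: "(A *v v) $ i = A $ i $ 1 * v $ 1 + A $ i $ 2 * v $ (2 :: 2)"
  by (simp add: matrix_vector_mult_def sum_2)

lemma unimodular_cone_iff:
  fixes A :: "int ^ 2 ^ 2"
  assumes A: "\<bar>det A\<bar> = 1" "(\<lambda>v. real_mat A *v v) ` C = D"
  shows "real_vec v \<in> C \<longleftrightarrow> real_vec (A *v v) \<in> D"
proof -
  have dA: "real_of_int (A $ 1 $ 1) * real_of_int (A $ 2 $ 2) - real_of_int (A $ 1 $ 2) * real_of_int (A $ 2 $ 1) \<noteq> 0" (is "?d \<noteq> 0")
  proof -
    have "det A \<noteq> 0" using A by auto
    then have "real_of_int (A $ 1 $ 1 * A $ 2 $ 2 - A $ 1 $ 2 * A $ 2 $ 1) \<noteq> 0" by (simp only: det_2 of_int_eq_0_iff not_False_eq_True)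
    then show ?thesis by simp
  qed
  have "inj (\<lambda>v. real_mat A *v v)"
  proof (rule injI)
    fix x y assume "real_mat A *v x = real_mat A *v y"
    then have "(real_mat A *v x) $ i = (real_mat A *v y) $ i" for i by simp
    from this[of 1] this[of 2]
    have e: "real_of_int (A $ 1 $ 1) * (x $ 1 - y $ 1) + real_of_int (A $ 1 $ 2) * (x $ 2 - y $ 2) = 0"
      "real_of_int (A $ 2 $ 1) * (x $ 1 - y $ 1) + real_of_int (A $ 2 $ 2) * (x $ 2 - y $ 2) = 0"
      by (simp_all add: matrix_vector_mult_2 real_mat_def algebra_simps)
    have "?d * (x $ 1 - y $ 1) = 0" "?d * (x $ 2 - y $ 2) = 0"
      using e by algebra+
    then show "x = y" using dA by (simp add: vec_eq_iff forall_2)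
  qed
  moreover have "real_mat A *v real_vec v = real_vec (A *v v)"
    by (simp add: vec_eq_iff matrix_vector_mult_2 real_mat_def real_vec_def)
  ultimately show ?thesis unfolding A(2)[symmetric] by (metis inj_image_mem_iff)
qed

lemma unimodular_surj:
  fixes A :: "int ^ 2 ^ 2"
  assumes "\<bar>det A\<bar> = 1" shows "\<exists>v. A *v v = w"
proof -
  let ?D = "det A"
  have D: "?D * ?D = 1" using assms by (metis abs_mult_self_eq mult_1)
  let ?v = "vector [?D * (A $ 2 $ 2 * w $ 1 - A $ 1 $ 2 * w $ 2), ?D * (A $ 1 $ 1 * w $ 2 - A $ 2 $ 1 * w $ 1)] :: int ^ 2"
  have "(A *v ?v) $ 1 = ?D * ?D * w $ 1" "(A *v ?v) $ 2 = ?D * ?D * w $ 2"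
    by (simp_all add: matrix_vector_mult_2) (simp_all add: det_2 algebra_simps)
  then have "A *v ?v = w" using D by (simp add: vec_eq_iff forall_2)
  then show ?thesis ..
qed

text \<open>The normal form of the cone in the basis \<open>(1, 0), (1, 1)\<close> of its first two minimal generators.\<close>

definition lattice_coords :: "int ^ 2 ^ 2 \<Rightarrow> int ^ 2 \<Rightarrow> int \<times> int" where
  "lattice_coords A v = ((A *v v) $ 1 - (A *v v) $ 2, (A *v v) $ 2)"

lemma lattice_coords_linear:
  "lattice_coords A (v + w) = lattice_coords A v + lattice_coords A w"
  "lattice_coords A (c *s v) = (c * fst (lattice_coords A v), c * snd (lattice_coords A v))"
  "lattice_coords A 0 = 0"
  by (simp_all add: lattice_coords_def matrix_vector_mult_2 algebra_simps zero_prod_def)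

lemma lattice_coords_sum: "lattice_coords A (\<Sum>i\<in>I. c i *s \<gamma> i) =
   (\<Sum>i\<in>I. c i * fst (lattice_coords A (\<gamma> i)), \<Sum>i\<in>I. c i * snd (lattice_coords A (\<gamma> i)))"
  by (induction I rule: infinite_finite_induct) (auto simp: lattice_coords_linear zero_prod_def)

lemma lattice_coords_surj:
  assumes "\<bar>det A\<bar> = 1" shows "\<exists>v. lattice_coords A v = d"
proof -
  obtain v where "A *v v = vector [fst d + snd d, snd d]" using unimodular_surj[OF assms] by blast
  then show ?thesis by (intro exI[of _ v]) (simp add: lattice_coords_def)
qed

lemma lattice_coords_inj:
  fixes A :: "int ^ 2 ^ 2"
  assumes "\<bar>det A\<bar> = 1" "lattice_coords A v = lattice_coords A w" shows "v = w"
proof -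
  have e: "A $ 1 $ 1 * v $ 1 + A $ 1 $ 2 * v $ 2 = A $ 1 $ 1 * w $ 1 + A $ 1 $ 2 * w $ 2"
    "A $ 2 $ 1 * v $ 1 + A $ 2 $ 2 * v $ 2 = A $ 2 $ 1 * w $ 1 + A $ 2 $ 2 * w $ 2"
    using assms(2) by (simp_all add: lattice_coords_def matrix_vector_mult_2)
  have "det A * (v $ 1 - w $ 1) = 0" "det A * (v $ 2 - w $ 2) = 0"
    unfolding det_2 using e by algebra+
  then show ?thesis using assms(1) by (auto simp: vec_eq_iff forall_2)
qed

section \<open>The zero set of the toric ideal\<close>

definition vdeg :: "('n::finite \<Rightarrow> int ^ 2) \<Rightarrow> ('n \<Rightarrow>\<^sub>0 nat) \<Rightarrow> int ^ 2" where
  "vdeg \<gamma> m = (\<Sum>i\<in>UNIV. int (Poly_Mapping.lookup m i) *s \<gamma> i)"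

lemma single_power: "Poly_Mapping.single (v :: int ^ 2) (1 :: 'k::comm_ring_1) ^ n = Poly_Mapping.single (int n *s v) 1"
proof (induction n)
  case (Suc n)
  have "v + int n *s v = int (Suc n) *s v" by (simp add: vec_eq_iff algebra_simps)
  then show ?case using Suc by (simp add: mult_single)
qed simp

lemma toric_hom_eq:
  fixes \<gamma> :: "'n::finite \<Rightarrow> int ^ 2" and p :: "('n, 'k::comm_ring_1) mpoly"
  shows "toric_hom \<gamma> p = (\<Sum>m\<in>Poly_Mapping.keys p. Poly_Mapping.single (vdeg \<gamma> m) (Poly_Mapping.lookup p m))"
proof -
  have "(\<Prod>i\<in>Poly_Mapping.keys m. Poly_Mapping.single (\<gamma> i) (1 :: 'k) ^ Poly_Mapping.lookup m i)
      = Poly_Mapping.single (vdeg \<gamma> m) 1" for m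
  proof -
    have "(\<Prod>i\<in>I. Poly_Mapping.single (\<gamma> i) (1 :: 'k) ^ Poly_Mapping.lookup m i)
       = Poly_Mapping.single (\<Sum>i\<in>I. int (Poly_Mapping.lookup m i) *s \<gamma> i) 1" for I
      by (induction I rule: infinite_finite_induct) (simp_all add: single_power mult_single)
    moreover have "(\<Sum>i\<in>Poly_Mapping.keys m. int (Poly_Mapping.lookup m i) *s \<gamma> i) = vdeg \<gamma> m"
      unfolding vdeg_def by (rule sum.mono_neutral_left) (auto simp: in_keys_iff)
    ultimately show ?thesis by simp
  qed
  then show ?thesis by (simp add: toric_hom_def subst_def mult_single)
qed

text \<open>The coefficients of the image of a polynomial under the toric homomorphism are its graded
  coefficients, so the kernel is the ideal of the torus orbit.\<close>

lemma toric_surface_eq_toric: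
  fixes \<gamma> :: "'n::finite \<Rightarrow> int ^ 2"
  assumes A: "\<bar>det A\<bar> = 1"
  shows "(toric_surface \<gamma> :: ('k::field_char_0 ^ 'n) set) = toric (\<lambda>_. 1) (\<lambda>i. lattice_coords A (\<gamma> i))"
proof -
  let ?\<delta> = "\<lambda>i. lattice_coords A (\<gamma> i)"
  have deg: "expdeg ?\<delta> m = lattice_coords A (vdeg \<gamma> m)" for m
    by (simp add: expdeg_def vdeg_def lattice_coords_sum)
  have one: "mval m (vec_lambda (\<lambda>_ :: 'n. 1 :: 'k)) = 1" for m by (simp add: mval_def)
  have "Poly_Mapping.lookup (toric_hom \<gamma> p) v = hcoeff (\<lambda>_. 1) ?\<delta> (lattice_coords A v) p" for p :: "('n, 'k) mpoly" and v
  proof -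
    have "(expdeg ?\<delta> m = lattice_coords A v) = (vdeg \<gamma> m = v)" for m
      unfolding deg using lattice_coords_inj[OF A] by blast
    then show ?thesis
      by (auto simp: toric_hom_eq lookup_sum lookup_single hcoeff_def lfun_def one when_def intro!: sum.cong)
  qed
  moreover have "(\<forall>d. hcoeff (\<lambda>_. 1) ?\<delta> d p = 0) \<longleftrightarrow> (\<forall>v. hcoeff (\<lambda>_. 1) ?\<delta> (lattice_coords A v) p = 0)" for p :: "('n, 'k) mpoly"
    using lattice_coords_surj[OF A] by metis
  ultimately have "toric_hom \<gamma> p = 0 \<longleftrightarrow> p \<in> vanishing_ideal (orbit (\<lambda>_. 1) ?\<delta>)" for p :: "('n, 'k) mpoly"
    unfolding vanishing_ideal_orbit_iff by (metis lookup_zero poly_mapping_eqI)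
  then show ?thesis by (simp add: toric_surface_def toric_def zclosure_def)
qed

lemma mon_range_eq:
  fixes \<gamma> :: "'n::finite \<Rightarrow> int ^ 2"
  assumes "generates_semigroup \<gamma> C"
  shows "mon (range (\<lambda>i. lattice_coords A (\<gamma> i))) = lattice_coords A ` {v. real_vec v \<in> C}"
proof -
  let ?\<delta> = "\<lambda>i. lattice_coords A (\<gamma> i)"
  have deg: "expdeg ?\<delta> m = lattice_coords A (vdeg \<gamma> m)" for m
    by (simp add: expdeg_def vdeg_def lattice_coords_sum)
  have ex: "expos (\<lambda>_. 1 :: rat) ?\<delta> = range ?\<delta>" by (simp add: expos_def)
  have one: "mval m (vec_lambda (\<lambda>_ :: 'n. 1 :: rat)) = 1" for m by (simp add: mval_def)
  have "mon (range ?\<delta>) = range (expdeg ?\<delta>)"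
    using mon_monomial[of _ "\<lambda>_. 1 :: rat" ?\<delta>] expdeg_in_mon[of _ "\<lambda>_. 1 :: rat" ?\<delta>]
    by (auto simp: ex one) (metis rangeI)
  also have "\<dots> = lattice_coords A ` range (vdeg \<gamma>)"
    by (auto simp: deg)
  also have "range (vdeg \<gamma>) = {\<Sum>i\<in>UNIV. int (c i) *s \<gamma> i | c. True}"
  proof -
    have "(\<Sum>i\<in>UNIV. int (c i) *s \<gamma> i) \<in> range (vdeg \<gamma>)" for c :: "'n \<Rightarrow> nat"
    proof -
      have "(\<Sum>i\<in>UNIV. int (c i) *s \<gamma> i) = vdeg \<gamma> (Abs_poly_mapping c)"
        by (simp add: vdeg_def Abs_poly_mapping_inverse)
      then show ?thesis by (rule range_eqI)
    qed
    then show ?thesis by (auto simp: vdeg_def)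
  qed
  also have "\<dots> = {v. real_vec v \<in> C}" using assms by (simp add: generates_semigroup_def)
  finally show ?thesis .
qed

text \<open>For \<open>r \<ge> 5\<close> the conditions on the pairs at both ends follow from those on the inner pairs, because the
  outermost entries are \<open>2\<close>.\<close>

lemma cfrac_list_iff:
  fixes a :: "nat \<Rightarrow> int"
  assumes r: "2 \<le> r" and a1: "a 1 = 1"
  shows "(a 2 = 2 \<and> a r = 2 \<and> (\<forall>i. 2 \<le> i \<and> i < r \<longrightarrow> (a i, a (Suc i)) \<in> {(2, 2), (2, 3), (3, 2)})) \<longleftrightarrow>
      map a [1..<Suc r] = [1, 2] \<or>
      map a [1..<Suc r] = [1, 2, 2] \<or>
      map a [1..<Suc r] = [1, 2, 2, 2] \<or> map a [1..<Suc r] = [1, 2, 3, 2] \<or>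
      (5 \<le> r \<and> a 2 = 2 \<and> a r = 2 \<and>
        (\<forall>i\<in>{3..r - 2}. (a i, a (i + 1)) \<in> {(2, 2), (2, 3), (3, 2)}))" (is "?L \<longleftrightarrow> ?R")
proof -
  consider "r = 2" | "r = 3" | "r = 4" | "5 \<le> r" using r by linarith
  then show ?thesis
  proof cases
    case 1
    have "map a [1..<Suc 2] = [1, a 2]" using a1 by (simp add: upt_rec numeral_2_eq_2)
    then show ?thesis using 1 by auto
  next
    case 2
    have "map a [1..<Suc 3] = [1, a 2, a 3]" using a1 by (simp add: upt_rec numeral_3_eq_3 numeral_2_eq_2)
    moreover have "(\<forall>i. 2 \<le> i \<and> i < 3 \<longrightarrow> P i) \<longleftrightarrow> P (2 :: nat)" for P
      by (auto simp: le_less_Suc_eq numeral_3_eq_3 numeral_2_eq_2)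
    ultimately show ?thesis unfolding 2 by auto
  next
    case 3
    have "map a [1..<Suc 4] = [1, a 2, a 3, a 4]"
      using a1 by (simp add: upt_rec numeral_3_eq_3 numeral_2_eq_2 eval_nat_numeral)
    moreover have "(\<forall>i. 2 \<le> i \<and> i < 4 \<longrightarrow> P i) \<longleftrightarrow> P (2 :: nat) \<and> P 3" for P
    proof -
      have "2 \<le> i \<and> i < 4 \<longleftrightarrow> i = 2 \<or> i = 3" for i :: nat by auto
      then show ?thesis by auto
    qed
    ultimately show ?thesis unfolding 3 by auto
  next
    case 4
    have len: "length (map a [1..<Suc r]) = r" by simp
    have "map a [1..<Suc r] \<noteq> l" if "length l < 5" for l
    proof
      assume "map a [1..<Suc r] = l"
      then have "length l = r" using len by simp
      then show False using 4 that by simp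
    qed
    then have "?R \<longleftrightarrow> a 2 = 2 \<and> a r = 2 \<and> (\<forall>i\<in>{3..r - 2}. (a i, a (i + 1)) \<in> {(2, 2), (2, 3), (3, 2)})"
      using 4 by auto
    also have "\<dots> \<longleftrightarrow> ?L"
    proof
      assume R: "a 2 = 2 \<and> a r = 2 \<and> (\<forall>i\<in>{3..r - 2}. (a i, a (i + 1)) \<in> {(2, 2), (2, 3), (3, 2)})"
      have "(a 3, a 4) \<in> {(2, 2), (2, 3), (3, 2)}" "(a (r - 2), a (r - 1)) \<in> {(2, 2), (2, 3), (3, 2)}"
        using R[THEN conjunct2, THEN conjunct2, rule_format, of 3] R[THEN conjunct2, THEN conjunct2, rule_format, of "r - 2"] 4
        by (simp_all add: Suc_diff_le numeral_2_eq_2 Suc_diff_Suc)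
      then have ends: "a 3 \<in> {2, 3}" "a (r - 1) \<in> {2, 3}" by auto
      have "(a i, a (Suc i)) \<in> {(2, 2), (2, 3), (3, 2)}" if i: "2 \<le> i" "i < r" for i
      proof -
        consider "i = 2" | "i = r - 1" | "i \<in> {3..r - 2}" using i by fastforce
        then show ?thesis
        proof cases
          case 1
          then show ?thesis using R ends by (auto simp: numeral_3_eq_3 numeral_2_eq_2)
        next
          case 2
          then have "Suc i = r" using 4 by simp
          then show ?thesis using R ends 2 by auto
        next
          case 3
          then show ?thesis using R by auto
        qed
      qed
      then show ?L using R by blast
    next
      assume L: ?L
      have "(a i, a (i + 1)) \<in> {(2, 2), (2, 3), (3, 2)}" if "i \<in> {3..r - 2}" for i
      proof -
        have "2 \<le> i" "i < r" using that 4 by auto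
        then show ?thesis using L by simp
      qed
      then show "a 2 = 2 \<and> a r = 2 \<and> (\<forall>i\<in>{3..r - 2}. (a i, a (i + 1)) \<in> {(2, 2), (2, 3), (3, 2)})"
        using L by blast
    qed
    finally show ?thesis by (rule sym)
  qed
qed

theorem theorem2:
  fixes \<sigma> :: "(real ^ 2) set"
    and \<gamma> :: "'n::finite \<Rightarrow> int ^ 2"
    and X :: "('k::{alg_closed_field, field_char_0} ^ 'n) set"
    and a :: "nat \<Rightarrow> int" and r :: nat
  assumes "rational_polyhedral_cone \<sigma>" and "strongly_convex \<sigma>" and "dim \<sigma> = 2"
    and "generates_semigroup \<gamma> \<sigma>"
    and "X = toric_surface \<gamma>"
    and "Sing X \<noteq> {}"
    and "associated_cfrac \<sigma> (map a [1..<Suc r])"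
  shows "nash_blowup_smooth X \<longleftrightarrow>
      map a [1..<Suc r] = [1, 2] \<or>
      map a [1..<Suc r] = [1, 2, 2] \<or>
      map a [1..<Suc r] = [1, 2, 2, 2] \<or> map a [1..<Suc r] = [1, 2, 3, 2] \<or>
      (5 \<le> r \<and> a 2 = 2 \<and> a r = 2 \<and>
        (\<forall>i\<in>{3..r - 2}. (a i, a (i + 1)) \<in> {(2, 2), (2, 3), (3, 2)}))"
proof -
  let ?as = "map a [1..<Suc r]"
  obtain P Q where nf: "has_normal_form \<sigma> P Q" and P: "1 \<le> P" and as: "?as \<noteq> []" "hd ?as = 1"
    "\<forall>x\<in>set (tl ?as). 1 < x" and PQ: "of_int P / of_int Q = neg_cfrac ?as"
    using assms(7) unfolding associated_cfrac_def by blast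
  obtain A :: "int ^ 2 ^ 2" where cop: "coprime P Q" "P < Q" and A: "\<bar>det A\<bar> = 1"
    "(\<lambda>v. real_mat A *v v) ` \<sigma> = convex_cone hull (real_vec ` {vector [1, 0], vector [P, Q]})"
    using nf unfolding has_normal_form_def by blast
  have r1: "1 \<le> r" using as(1) by (cases r) auto
  have as_eq: "?as = a 1 # map a [2..<Suc r]" using r1 by (simp add: upt_conv_Cons numeral_2_eq_2 del: upt_Suc)
  have a1: "a 1 = 1" using as(2) as_eq by simp
  have r2: "2 \<le> r"
  proof (rule ccontr)
    assume "\<not> 2 \<le> r"
    then have "?as = [1]" using as_eq a1 by simp
    then have "of_int P / of_int Q = (1 :: rat)" using PQ by simp
    then show False using cop(2) P by (simp add: field_simps)
  qed
  define m where "m = r - 1"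
  define b where "b = (\<lambda>k. a (Suc k))"
  have m: "1 \<le> m" "Suc m = r" using r2 by (auto simp: m_def)
  have b_map: "map b [k..<Suc m] = map a [Suc k..<Suc r]" for k
    using map_Suc_upt[of k "Suc m"] m(2) by (simp add: b_def del: upt_Suc flip: map_Suc_upt)
  have b2: "2 \<le> b (Suc k)" if "k < m" for k
  proof -
    have "a (Suc (Suc k)) \<in> set (tl ?as)" unfolding as_eq using that m(2) by (auto simp del: upt_Suc)
    then show ?thesis using as(3) by (fastforce simp: b_def)
  qed
  have "neg_cfrac ?as = 1 - 1 / neg_cfrac (map b [1..<Suc m])"
  proof -
    have "?as = a 1 # a 2 # map a [3..<Suc r]" using as_eq r2 by (simp add: upt_conv_Cons numeral_3_eq_3 numeral_2_eq_2 del: upt_Suc)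
    moreover have "map b [1..<Suc m] = a 2 # map a [3..<Suc r]"
      unfolding b_map using r2 by (simp add: upt_conv_Cons numeral_3_eq_3 numeral_2_eq_2 del: upt_Suc)
    ultimately show ?thesis using a1 by simp
  qed
  then have g_end: "hj_seq b (Suc m) = (P - Q, Q)"
    using PQ by (intro hj_seq_end m(1) b2 cop(1) P cop(2)) simp_all
  interpret H: hirzebruch 1 m b "hj_seq b" by (rule hirzebruch_hj_seq) (use m b2 in auto)
  define \<delta> where "\<delta> = (\<lambda>i. lattice_coords A (\<gamma> i))"
  have X: "X = toric (\<lambda>_. 1) \<delta>" unfolding assms(5) \<delta>_def by (rule toric_surface_eq_toric[OF A(1)])
  have "real_vec v \<in> \<sigma> \<longleftrightarrow> lattice_coords A v \<in> mon H.gens" for v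
  proof -
    have "real_vec v \<in> \<sigma> \<longleftrightarrow> 0 \<le> (A *v v) $ 2 \<and> 0 \<le> Q * (A *v v) $ 1 - P * (A *v v) $ 2"
      unfolding unimodular_cone_iff[OF A] by (rule normal_form_cone_iff) (use P cop in simp)
    also have "\<dots> \<longleftrightarrow> lattice_coords A v \<in> mon H.gens"
      unfolding H.mon_gens_eq_cone by (simp add: g_end cr_def lattice_coords_def algebra_simps)
    finally show ?thesis .
  qed
  then have "lattice_coords A ` {v. real_vec v \<in> \<sigma>} = mon H.gens"
    using lattice_coords_surj[OF A(1)] by (auto simp: image_iff) (metis surj_pair)
  then have sg: "mon (range \<delta>) = mon H.gens"
    unfolding \<delta>_def using mon_range_eq[OF assms(4)] by simp
  interpret T: toric_hirzebruch 1 m b "hj_seq b" \<delta> X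
    by unfold_locales (use X sg in auto)
  have "nash_blowup_smooth X \<longleftrightarrow> b 1 = 2 \<and> b m = 2 \<and> (\<forall>k. 1 \<le> k \<and> k < m \<longrightarrow> (b k, b (Suc k)) \<in> {(2, 2), (2, 3), (3, 2)})"
    unfolding T.nash_blowup_smooth_iff_good by (rule H.all_good_iff)
  also have "\<dots> \<longleftrightarrow> a 2 = 2 \<and> a r = 2 \<and> (\<forall>i. 2 \<le> i \<and> i < r \<longrightarrow> (a i, a (Suc i)) \<in> {(2, 2), (2, 3), (3, 2)})"
  proof -
    have "(\<forall>k. 1 \<le> k \<and> k < m \<longrightarrow> Pr (Suc k)) \<longleftrightarrow> (\<forall>i. 2 \<le> i \<and> i < r \<longrightarrow> Pr i)" for Pr
    proof
      assume l: "\<forall>k. 1 \<le> k \<and> k < m \<longrightarrow> Pr (Suc k)"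
      show "\<forall>i. 2 \<le> i \<and> i < r \<longrightarrow> Pr i"
      proof (intro allI impI)
        fix i assume i: "2 \<le> i \<and> i < r"
        then have "1 \<le> i - 1 \<and> i - 1 < m" "Suc (i - 1) = i" using m(2) by auto
        then show "Pr i" using l by metis
      qed
    qed (use m(2) in auto)
    from this[of "\<lambda>i. (a i, a (Suc i)) \<in> {(2, 2), (2, 3), (3, 2)}"] show ?thesis
      using m(2) by (simp add: b_def numeral_2_eq_2)
  qed
  also note cfrac_list_iff[where a = a, OF r2 a1]
  finally show ?thesis .
qed

end
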